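(* If $0<\alpha<1$, members of $I_\alpha(BMO)$ coincide with functions modulo constants: every tempered distribution modulo constants $f\in I_\alpha(BMO)\subseteq\mathcal S'/P_0$ can be identified with a function modulo constants. If $1\le\alpha<2$, members of $I_\alpha(BMO)\subseteq\mathcal S'/P_1$ coincide with functions modulo linear polynomials (polynomials of degree at most $1$). Here "$f\in\mathcal S'/P_{l}$ can be identified with a function modulo $P_l$" means that there is a locally integrable function $F$ on $\mathbb R^d$ which defines a tempered distribution by integration and whose class in $\mathcal S'/P_l$ is $f$, i.e. $f(\varphi)=\int_{\mathbb R^d} F(x)\varphi(x)\,dx$ for all $\varphi\in\mathcal S_l$.
   Context: $BMO=BMO(\mathbb R^d)$ is the space of (locally integrable) functions modulo constants with $\|f\|_*=\sup_{x\in\mathbb R^d,\,r>0}\frac1{|B_r(x)|}\int_{B_r(x)}|f(y)-\langle f\rangle_{B_r(x)}|\,dy<\infty$, where $B_r(x)$ is the open ball and $\langle f\rangle_{B}$ is the average of $f$ over $B$. $\mathcal S$ is the Schwartz space on $\mathbb R^d$, $\mathcal S'$ the tempered distributions, and $\hat\varphi(\xi)=\int\varphi(x)e^{-2\pi i x\cdot\xi}dx$. For an integer $l\ge0$: $P_l$ is the space of polynomials of degree at most $l$; $\mathcal S'/P_l$ is $\mathcal S'$ modulo the relation $u\sim v$ iff $u-v\in P_l$; and $\mathcal S_l=\{\varphi\in\mathcal S:\int x^\gamma\varphi(x)\,dx=0\text{ for all }|\gamma|\le l\}$. The dual of $\mathcal S_l$ is identified with $\mathcal S'/P_l$ by restriction.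 For $\alpha>0$, $I_\alpha(\varphi)$ is the inverse Fourier transform of $(2\pi|\xi|)^{-\alpha}\hat\varphi(\xi)$. $I_\alpha(BMO)$ is the subset of $\mathcal S'/P_{\lfloor\alpha\rfloor}$ consisting of the distributions $I_\alpha(b)$, $b\in BMO$, acting on $\varphi\in\mathcal S_{\lfloor\alpha\rfloor}$ by $I_\alpha(b)(\varphi)=\int b(x)\,I_\alpha(\varphi)(x)\,dx$ (this integral is well defined). *)

theory Defs
  imports "HOL-Analysis.Analysis"
begin

text \<open>
  The space \<open>\<real>\<^sup>d\<close> is an arbitrary Euclidean space \<open>'a\<close> (so \<open>d = DIM('a) \<ge> 1\<close>), with coordinates
  taken along \<^term>\<open>Basis\<close>.  All functions are complex valued, and all integrals are Lebesgue
  integrals with respect to \<^term>\<open>lebesgue\<close>.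
\<close>

section \<open>Functions of bounded mean oscillation\<close>

definition locally_integrable :: "('a::euclidean_space \<Rightarrow> complex) \<Rightarrow> bool" where
  "locally_integrable f \<longleftrightarrow> (\<forall>K. compact K \<longrightarrow> f absolutely_integrable_on K)"

definition average :: "('a::euclidean_space \<Rightarrow> complex) \<Rightarrow> 'a set \<Rightarrow> complex" where
  "average f B = (LINT y:B|lebesgue. f y) / of_real (measure lebesgue B)"

definition mean_oscillation :: "('a::euclidean_space \<Rightarrow> complex) \<Rightarrow> 'a set \<Rightarrow> real" where
  "mean_oscillation f B = (LINT y:B|lebesgue. norm (f y - average f B)) / measure lebesgue B"

definition bmo_norm :: "('a::euclidean_space \<Rightarrow> complex) \<Rightarrow> ereal" where
  "bmo_norm f = (SUP (x, r) \<in> UNIV \<times> {0<..}. ereal (mean_oscillation f (ball x r)))"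

text \<open>
  \<open>bmo\<close> is the set of representatives: the elements of \<open>BMO\<close> are the classes of its members modulo
  constants.
\<close>

definition bmo :: "('a::euclidean_space \<Rightarrow> complex) set" where
  "bmo = {f. locally_integrable f \<and> bmo_norm f < \<infinity>}"

section \<open>Schwartz functions and tempered distributions\<close>

definition partial_deriv :: "'a::euclidean_space \<Rightarrow> ('a \<Rightarrow> complex) \<Rightarrow> 'a \<Rightarrow> complex" where
  "partial_deriv i f = (\<lambda>x. frechet_derivative f (at x) i)"

definition iterated_partial_deriv ::
    "'a::euclidean_space list \<Rightarrow> ('a \<Rightarrow> complex) \<Rightarrow> 'a \<Rightarrow> complex" where
  "iterated_partial_deriv is f = foldr partial_deriv is f"

definition smooth :: "('a::euclidean_space \<Rightarrow> complex) \<Rightarrow> bool" where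
  "smooth f \<longleftrightarrow> (\<forall>is \<in> lists Basis. \<forall>x. iterated_partial_deriv is f differentiable (at x))"

definition schwartz :: "('a::euclidean_space \<Rightarrow> complex) set" where
  "schwartz = {f. smooth f \<and>
     (\<forall>k. \<forall>is \<in> lists Basis.
        bounded (range (\<lambda>x. of_real ((1 + norm x) ^ k) * iterated_partial_deriv is f x)))}"

definition schwartz_seminorm ::
    "nat \<Rightarrow> 'a::euclidean_space list \<Rightarrow> ('a \<Rightarrow> complex) \<Rightarrow> real" where
  "schwartz_seminorm k is f = (SUP x. (1 + norm x) ^ k * norm (iterated_partial_deriv is f x))"

definition schwartz_topology :: "('a::euclidean_space \<Rightarrow> complex) topology" where
  "schwartz_topology = topology_generated_by
     {{g \<in> schwartz. schwartz_seminorm k is (\<lambda>x. g x - f x) < e} | k is f e.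
        is \<in> lists Basis \<and> f \<in> schwartz \<and> e > 0}"

text \<open>
  The members of \<open>tempered\<close> are functionals on all functions, of which only the values on
  \<^term>\<open>schwartz\<close> matter; \<open>poly_rel\<close> below ignores the other values.
\<close>

definition tempered :: "(('a::euclidean_space \<Rightarrow> complex) \<Rightarrow> complex) set" where
  "tempered = {u.
     (\<forall>f \<in> schwartz. \<forall>g \<in> schwartz. u (\<lambda>x. f x + g x) = u f + u g) \<and>
     (\<forall>c. \<forall>f \<in> schwartz. u (\<lambda>x. c * f x) = c * u f) \<and>
     continuous_map schwartz_topology euclidean u}"

section \<open>Polynomials and tempered distributions modulo polynomials\<close>

definition multi_indices :: "nat \<Rightarrow> ('a::euclidean_space \<Rightarrow> nat) set" where
  "multi_indices l = {\<gamma>. (\<forall>i. i \<notin> Basis \<longrightarrow> \<gamma> i = 0) \<and> (\<Sum>i\<in>Basis. \<gamma> i) \<le> l}"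

definition monomial :: "('a::euclidean_space \<Rightarrow> nat) \<Rightarrow> 'a \<Rightarrow> complex" where
  "monomial \<gamma> x = of_real (\<Prod>i\<in>Basis. (x \<bullet> i) ^ \<gamma> i)"

definition polys :: "nat \<Rightarrow> ('a::euclidean_space \<Rightarrow> complex) set" where
  "polys l = {\<lambda>x. \<Sum>\<gamma>\<in>multi_indices l. c \<gamma> * monomial \<gamma> x | c. True}"

definition schwartz_vanishing :: "nat \<Rightarrow> ('a::euclidean_space \<Rightarrow> complex) set" where
  "schwartz_vanishing l =
     {f \<in> schwartz. \<forall>\<gamma> \<in> multi_indices l. (LINT x|lebesgue. monomial \<gamma> x * f x) = 0}"

definition distribution_of ::
    "('a::euclidean_space \<Rightarrow> complex) \<Rightarrow> ('a \<Rightarrow> complex) \<Rightarrow> complex" where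
  "distribution_of F = (\<lambda>f. LINT x|lebesgue. F x * f x)"

definition poly_rel ::
    "nat \<Rightarrow> ((('a::euclidean_space \<Rightarrow> complex) \<Rightarrow> complex) \<times> (('a \<Rightarrow> complex) \<Rightarrow> complex)) set" where
  "poly_rel l = {(u, v). u \<in> tempered \<and> v \<in> tempered \<and>
     (\<exists>p \<in> polys l. \<forall>f \<in> schwartz. u f - v f = distribution_of p f)}"

definition tempered_mod :: "nat \<Rightarrow> (('a::euclidean_space \<Rightarrow> complex) \<Rightarrow> complex) set set" where
  "tempered_mod l = tempered // poly_rel l"

section \<open>Riesz potentials\<close>

definition fourier :: "('a::euclidean_space \<Rightarrow> complex) \<Rightarrow> 'a \<Rightarrow> complex" where
  "fourier f \<xi> = (LINT x|lebesgue. f x * exp (- (2 * of_real pi * \<i> * of_real (x \<bullet> \<xi>))))"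

definition inverse_fourier :: "('a::euclidean_space \<Rightarrow> complex) \<Rightarrow> 'a \<Rightarrow> complex" where
  "inverse_fourier g x = (LINT \<xi>|lebesgue. g \<xi> * exp (2 * of_real pi * \<i> * of_real (x \<bullet> \<xi>)))"

definition riesz_potential ::
    "real \<Rightarrow> ('a::euclidean_space \<Rightarrow> complex) \<Rightarrow> 'a \<Rightarrow> complex" where
  "riesz_potential \<alpha> f =
     inverse_fourier (\<lambda>\<xi>. of_real ((2 * pi * norm \<xi>) powr (- \<alpha>)) * fourier f \<xi>)"

text \<open>
  Under the identification of the dual of \<^term>\<open>schwartz_vanishing l\<close> with
  \<^term>\<open>tempered_mod l\<close>, a functional corresponds to the set of all tempered distributions that
  extend it.  So \<open>I\<^sub>\<alpha>(b)\<close> is the set of all tempered extensions of \<open>\<phi> \<mapsto> \<integral> b I\<^sub>\<alpha>(\<phi>)\<close>.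
  It depends only on \<open>b\<close> modulo constants, since \<open>I\<^sub>\<alpha>(\<phi>)\<close> has integral zero.
  The use of \<^const>\<open>has_bochner_integral\<close> makes the convergence of the integral explicit.
\<close>

definition riesz_bmo ::
    "real \<Rightarrow> ('a::euclidean_space \<Rightarrow> complex) \<Rightarrow> (('a \<Rightarrow> complex) \<Rightarrow> complex) set" where
  "riesz_bmo \<alpha> b = {u \<in> tempered. \<forall>f \<in> schwartz_vanishing (nat \<lfloor>\<alpha>\<rfloor>).
     has_bochner_integral lebesgue (\<lambda>x. b x * riesz_potential \<alpha> f x) (u f)}"

definition I_BMO :: "real \<Rightarrow> (('a::euclidean_space \<Rightarrow> complex) \<Rightarrow> complex) set set" where
  "I_BMO \<alpha> = riesz_bmo \<alpha> ` bmo"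

section \<open>Identification with functions modulo polynomials\<close>

definition defines_tempered :: "('a::euclidean_space \<Rightarrow> complex) \<Rightarrow> bool" where
  "defines_tempered F \<longleftrightarrow>
     (\<forall>f \<in> schwartz. integrable lebesgue (\<lambda>x. F x * f x)) \<and> distribution_of F \<in> tempered"

definition is_function_mod ::
    "nat \<Rightarrow> (('a::euclidean_space \<Rightarrow> complex) \<Rightarrow> complex) set \<Rightarrow> bool" where
  "is_function_mod l C \<longleftrightarrow>
     (\<exists>F. locally_integrable F \<and> defines_tempered F \<and> C = poly_rel l `` {distribution_of F})"

end

theory Submission
  imports Defs "HOL-Probability.Characteristic_Functions"
begin

text \<open>
  Let \<open>l = \<lfloor>\<alpha>\<rfloor>\<close>.  The Riesz potential is a superposition of heat kernels: from
  \<open>(2\<pi>\<bar>\<xi>\<bar>)\<^bsup>-\<alpha>\<^esup> = \<Gamma>(\<alpha>/2)\<^bsup>-1\<^esup> \<integral>\<^sub>0\<^sup>\<infinity> t\<^bsup>\<alpha>/2-1\<^esup> e\<^bsup>-4\<pi>\<^sup>2 t \<bar>\<xi>\<bar>\<^sup>2\<^esup> dt\<close> one obtains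
  \<open>I\<^sub>\<alpha>(\<phi>)(x) = \<Gamma>(\<alpha>/2)\<^bsup>-1\<^esup> \<integral>\<^sub>0\<^sup>\<infinity> t\<^bsup>\<alpha>/2-1\<^esup> (G\<^sub>t * \<phi>)(x) dt\<close> for \<open>\<phi>\<close> with vanishing moments up to order \<open>l\<close>
  (\<open>riesz_potential_heat_kernel\<close>).  Pairing with \<open>b\<close> and exchanging integrals suggests to represent
  \<open>I\<^sub>\<alpha>(b)\<close> by the function \<open>F(y) = \<Gamma>(\<alpha>/2)\<^bsup>-1\<^esup> \<integral>\<integral> b(x) t\<^bsup>\<alpha>/2-1\<^esup> G\<^sub>t(x - y) dx dt\<close>, but in general this integral
  diverges at \<open>t = \<infinity>\<close>.

  The remedy is to subtract from \<open>G\<^sub>t(x - y)\<close>, for \<open>t \<ge> 1\<close>, its Taylor polynomial of degree \<open>l\<close> in \<open>y\<close>.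
  The vanishing moments of \<open>\<phi>\<close> make this change invisible, and it gains the factor \<open>t\<^bsup>-(l+1)/2\<^esup>\<close>
  (\<open>heat_remainder_large_time\<close>).  The averages of a BMO function over balls of radius \<open>R\<close> grow only
  logarithmically, so \<open>b\<close> costs at most \<open>t\<^bsup>\<epsilon>/2\<^esup>\<close> (\<open>bmo_growth\<close>), and \<open>\<integral>\<^sub>1\<^sup>\<infinity> t\<^bsup>\<alpha>/2-1+\<epsilon>/2-(l+1)/2\<^esup> dt\<close> is
  finite as soon as \<open>\<alpha> + \<epsilon> < l + 1\<close>.  Hence the triple integral over \<open>x\<close>, \<open>y\<close> and \<open>t\<close> converges absolutely
  even when \<open>\<phi>\<close> is replaced by a polynomial weight (\<open>heat_potential_integrable\<close>), and Fubini's theorem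
  yields at once that \<open>F\<close> is locally integrable, that it defines a tempered distribution, and that
  \<open>\<integral> F \<phi> = \<integral> b I\<^sub>\<alpha>(\<phi>)\<close> (\<open>riesz_potential_dual_function\<close>).

  It remains to see that the tempered extensions of the functional \<open>\<phi> \<mapsto> \<integral> b I\<^sub>\<alpha>(\<phi>)\<close> form exactly one class
  modulo polynomials of degree at most \<open>l\<close>.  The functions with vanishing moments are the common kernel
  of finitely many moment functionals on the Schwartz space, so by linear algebra two extensions differ
  by a combination of these functionals (\<open>poly_rel_iff\<close>).
\<close>

section \<open>Polynomially decaying weights\<close>

text \<open>
  The weight \<open>(1 + \<bar>x\<bar>)\<^bsup>-N\<^esup>\<close>.  Decay of Schwartz functions, growth of the functions
  that are paired with them, and Gaussian tails are all measured by comparison with it.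
\<close>

definition decay :: "nat \<Rightarrow> 'a::real_normed_vector \<Rightarrow> real" where
  "decay N x = 1 / (1 + norm x) ^ N"

lemma decay_pos: "0 < decay N x"
  by (simp add: decay_def add_pos_nonneg)

lemma decay_nonneg [simp]: "0 \<le> decay N x"
  using decay_pos by (rule less_imp_le)

lemma decay_le_1: "decay N x \<le> 1"
  by (simp add: decay_def divide_le_eq_1 add_pos_nonneg one_le_power)

lemma power_mult_decay: "(1 + norm x) ^ N * decay N x = 1"
proof -
  have "1 + norm x \<noteq> 0" by (smt (verit) norm_ge_zero)
  then show ?thesis by (simp add: decay_def)
qed

lemma decay_add: "decay (M + N) x = decay M x * decay N x"
  by (simp add: decay_def power_add)

text \<open>
  Polynomial factors are absorbed by spending part of the exponent.
\<close>

lemma power_mult_decay_add: "(1 + norm x) ^ N * decay (N + M) x = decay M x"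
  using power_mult_decay[of x N] by (simp add: decay_add mult.assoc[symmetric])

lemma le_decay_iff: "a \<le> C * decay N x \<longleftrightarrow> (1 + norm x) ^ N * a \<le> C"
proof -
  have "0 < (1 + norm x) ^ N" by (simp add: add_pos_nonneg)
  then show ?thesis by (simp add: decay_def pos_le_divide_eq mult.commute)
qed

lemma decay_antimono: "M \<le> N \<Longrightarrow> decay N x \<le> decay M x"
  unfolding decay_def by (intro divide_left_mono power_increasing mult_pos_pos zero_less_power)
    (auto simp: add_pos_nonneg)

lemma decay_borel_measurable [measurable]: "decay N \<in> borel_measurable borel"
  unfolding decay_def by measurable

text \<open>
  Peetre's inequality: translating the weight costs only a polynomial factor in the translation.
\<close>

lemma decay_diff_le: "decay N (x - y) \<le> (1 + norm y) ^ N * decay N x"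
proof -
  have "1 + norm x \<le> (1 + norm (x - y)) * (1 + norm y)"
    using norm_triangle_ineq[of "x - y" y] by (simp add: algebra_simps)
      (smt (verit) norm_ge_zero mult_nonneg_nonneg)
  then have "(1 + norm x) ^ N \<le> (1 + norm (x - y)) ^ N * (1 + norm y) ^ N"
    by (metis power_mono power_mult_distrib add_nonneg_nonneg norm_ge_zero zero_le_one)
  then show ?thesis
    unfolding decay_def
    by (simp add: divide_simps add_pos_nonneg add_nonneg_eq_0_iff mult.commute)
qed

text \<open>
  The factor produced by the geometric series over dyadic shells in \<open>nn_integral_decay_le\<close>.
\<close>

definition dyadic_const :: "real \<Rightarrow> nat \<Rightarrow> real" where
  "dyadic_const p N = 2 ^ N / (1 - 2 powr (p - real N))"

lemma dyadic_const_pos: "p < real N \<Longrightarrow> 0 < dyadic_const p N"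
proof -
  assume "p < real N"
  then have "2 powr (p - real N) < 2 powr (0::real)"
    by (intro powr_less_mono) auto
  then show ?thesis by (simp add: dyadic_const_def)
qed

text \<open>
  If \<open>x\<close> first lies in the ball of radius \<open>2\<^sup>k R\<close>, then the weight at \<open>x / R\<close> is at most
  \<open>2\<^sup>N 2\<^bsup>-kN\<^esup>\<close>, so that the term with index \<open>k\<close> alone suffices.
\<close>

lemma decay_le_dyadic_sum:
  fixes x :: "'a::real_normed_vector"
  assumes "0 < R"
  shows "ennreal (decay N (x /\<^sub>R R)) \<le> (\<Sum>k. ennreal (2 ^ N * (1 / 2 ^ N) ^ k) * indicator (ball 0 (2 ^ k * R)) x)"
proof -
  obtain k0 :: nat where k0: "norm x / R < 2 ^ k0"
    using real_arch_pow[of 2 "norm x / R"] by auto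
  define k where "k = (LEAST k. norm x < 2 ^ k * R)"
  have k: "norm x < 2 ^ k * R"
    unfolding k_def by (rule LeastI[of _ k0]) (use k0 assms in \<open>simp add: divide_simps mult.commute\<close>)
  have "decay N (x /\<^sub>R R) \<le> 2 ^ N * (1 / 2 ^ N) ^ k"
  proof (cases k)
    case 0
    have "decay N (x /\<^sub>R R) \<le> 1" by (rule decay_le_1)
    also have "1 \<le> (2::real) ^ N" by simp
    finally show ?thesis using 0 by simp
  next
    case (Suc j)
    have "\<not> norm x < 2 ^ j * R"
      using not_less_Least[of j "\<lambda>k. norm x < 2 ^ k * R"] Suc k_def by simp
    then have "2 ^ j \<le> norm (x /\<^sub>R R)"
      using assms by (simp add: divide_simps mult.commute)
    then have "(2 ^ j) ^ N \<le> (1 + norm (x /\<^sub>R R)) ^ N"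
      by (intro power_mono) auto
    then have "decay N (x /\<^sub>R R) \<le> 1 / (2 ^ j) ^ N"
      unfolding decay_def by (intro divide_left_mono mult_pos_pos) (auto simp: add_pos_nonneg)
    also have "\<dots> = 2 ^ N * (1 / 2 ^ N) ^ k"
      by (simp add: Suc power_divide power_mult[symmetric] mult.commute)
    finally show ?thesis .
  qed
  then have "ennreal (decay N (x /\<^sub>R R)) \<le> ennreal (2 ^ N * (1 / 2 ^ N) ^ k) * indicator (ball 0 (2 ^ k * R)) x"
    using k by (simp add: ennreal_leI)
  also have "\<dots> = (\<Sum>k\<in>{k}. ennreal (2 ^ N * (1 / 2 ^ N) ^ k) * indicator (ball 0 (2 ^ k * R)) x)"
    by (subst sum.insert) auto
  also have "\<dots> \<le> (\<Sum>k. ennreal (2 ^ N * (1 / 2 ^ N) ^ k) * indicator (ball 0 (2 ^ k * R)) x)"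
    by (rule sum_le_suminf) auto
  finally show ?thesis .
qed

text \<open>
  Bounds for integrals over balls turn into bounds for weighted integrals over the whole space:
  the shell of radius \<open>2\<^sup>k R\<close> contributes \<open>2\<^bsup>k(p - N)\<^esup>\<close>, which is summable for \<open>p < N\<close>.  With the
  scale \<open>R\<close> equal to the square root of the time this is how averages of a BMO function against
  heat kernels are estimated.
\<close>

lemma nn_integral_decay_le:
  fixes g :: "'a::euclidean_space \<Rightarrow> ennreal"
  assumes [measurable]: "g \<in> borel_measurable borel"
    and "0 < R" "0 \<le> C" and N: "p < real N"
    and growth: "\<And>r. R \<le> r \<Longrightarrow> (\<integral>\<^sup>+x\<in>ball 0 r. g x \<partial>lborel) \<le> ennreal (C * r powr p)"
  shows "(\<integral>\<^sup>+x. g x * ennreal (decay N (x /\<^sub>R R)) \<partial>lborel) \<le> ennreal (dyadic_const p N * C * R powr p)"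
proof -
  have q: "0 \<le> (2::real) powr (p - N)" "2 powr (p - N) < 1"
    using N powr_less_mono[of "p - N" 0 2] by auto
  have "(\<integral>\<^sup>+x. g x * ennreal (decay N (x /\<^sub>R R)) \<partial>lborel)
      \<le> (\<integral>\<^sup>+x. g x * (\<Sum>k. ennreal (2 ^ N * (1 / 2 ^ N) ^ k) * indicator (ball 0 (2 ^ k * R)) x) \<partial>lborel)"
    by (intro nn_integral_mono mult_left_mono decay_le_dyadic_sum assms) auto
  also have "\<dots> = (\<integral>\<^sup>+x. (\<Sum>k. ennreal (2 ^ N * (1 / 2 ^ N) ^ k) * (g x * indicator (ball 0 (2 ^ k * R)) x)) \<partial>lborel)"
    unfolding ennreal_suminf_cmult[symmetric] by (simp only: mult.left_commute)
  also have "\<dots> = (\<Sum>k. ennreal (2 ^ N * (1 / 2 ^ N) ^ k) * (\<integral>\<^sup>+x\<in>ball 0 (2 ^ k * R). g x \<partial>lborel))"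
  proof -
    have [measurable]: "ball (0::'a) r \<in> sets borel" for r by simp
    have eq: "(\<integral>\<^sup>+x. ennreal c * (g x * indicator (ball 0 r) x) \<partial>lborel) = ennreal c * (\<integral>\<^sup>+x\<in>ball 0 r. g x \<partial>lborel)" for c r
      by (rule nn_integral_cmult) measurable
    show ?thesis by (subst nn_integral_suminf) (measurable, simp only: eq)
  qed
  also have "\<dots> \<le> (\<Sum>k. ennreal (2 ^ N * (1 / 2 ^ N) ^ k) * ennreal (C * (2 ^ k * R) powr p))"
    by (intro suminf_le mult_left_mono growth summableI) (use \<open>0 < R\<close> in auto)
  also have "\<dots> = (\<Sum>k. ennreal (2 ^ N * C * R powr p * (2 powr (p - N)) ^ k))"
  proof (intro suminf_cong)
    fix k
    have "((2::real) powr (p - N)) ^ k = 2 powr (p * k) * 2 powr (- (real N * real k))"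
      by (simp add: powr_realpow[symmetric] powr_powr powr_add[symmetric] algebra_simps)
    also have "2 powr (- (real N * k)) = (1 / 2 ^ N) ^ k"
      by (simp add: powr_minus powr_realpow[symmetric] powr_powr power_divide power_mult[symmetric] divide_inverse power_inverse)
    also have "2 powr (p * k) = (2 ^ k) powr p"
      by (simp add: powr_realpow[symmetric] powr_powr mult.commute)
    finally have "2 ^ N * (1 / 2 ^ N) ^ k * (C * (2 ^ k * R) powr p) = 2 ^ N * C * R powr p * (2 powr (p - N)) ^ k"
      using \<open>0 < R\<close> by (simp add: powr_mult)
    then show "ennreal (2 ^ N * (1 / 2 ^ N) ^ k) * ennreal (C * (2 ^ k * R) powr p) = ennreal (2 ^ N * C * R powr p * (2 powr (p - N)) ^ k)"
      using \<open>0 \<le> C\<close> by (simp add: ennreal_mult'[symmetric])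
  qed
  also have "\<dots> = ennreal (\<Sum>k. 2 ^ N * C * R powr p * (2 powr (p - N)) ^ k)"
    using q \<open>0 \<le> C\<close> by (intro suminf_ennreal2 summable_mult summable_geometric) auto
  also have "(\<Sum>k. 2 ^ N * C * R powr p * (2 powr (p - N)) ^ k) = dyadic_const p N * C * R powr p"
    using q by (simp add: suminf_mult suminf_geometric dyadic_const_def)
  finally show ?thesis .
qed

text \<open>
  The case of Lebesgue measure, whose balls have volume proportional to \<open>r\<^sup>d\<close> at every scale.
\<close>

lemma nn_integral_decay_scaled_le:
  assumes "DIM('a) < N"
  shows "\<exists>K\<ge>0. \<forall>R>0. (\<integral>\<^sup>+x. ennreal (decay N ((x::'a::euclidean_space) /\<^sub>R R)) \<partial>lborel) \<le> ennreal (K * R powr DIM('a))"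
proof (intro exI conjI allI impI)
  let ?V = "unit_ball_vol (DIM('a))"
  show "0 \<le> dyadic_const (DIM('a)) N * ?V"
    using dyadic_const_pos[of "DIM('a)" N] assms by (intro mult_nonneg_nonneg) auto
  fix R :: real assume "0 < R"
  have "(\<integral>\<^sup>+x. 1 * ennreal (decay N ((x::'a) /\<^sub>R R)) \<partial>lborel) \<le> ennreal (dyadic_const (DIM('a)) N * ?V * R powr DIM('a))"
  proof (rule nn_integral_decay_le)
    fix r assume "R \<le> r"
    then show "(\<integral>\<^sup>+x\<in>ball (0::'a) r. 1 \<partial>lborel) \<le> ennreal (?V * r powr DIM('a))"
      using \<open>0 < R\<close> by (simp add: emeasure_ball powr_realpow)
  qed (use \<open>0 < R\<close> assms in auto)
  then show "(\<integral>\<^sup>+x. ennreal (decay N ((x::'a) /\<^sub>R R)) \<partial>lborel) \<le> ennreal (dyadic_const (DIM('a)) N * ?V * R powr DIM('a))"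
    by simp
qed

lemma integrable_decay:
  assumes "DIM('a) < N"
  shows "integrable lborel (decay N :: 'a::euclidean_space \<Rightarrow> real)"
proof (rule integrableI_bounded)
  obtain K where K: "\<And>R. 0 < R \<Longrightarrow> (\<integral>\<^sup>+x. ennreal (decay N ((x::'a) /\<^sub>R R)) \<partial>lborel) \<le> ennreal (K * R powr DIM('a))"
    using nn_integral_decay_scaled_le[OF assms] by blast
  then show "(\<integral>\<^sup>+x. ennreal (norm (decay N (x::'a))) \<partial>lborel) < \<infinity>"
    using K[of 1] by (auto simp: less_top[symmetric] top_unique)
qed simp

lemma integrable_if_decay_bound:
  fixes f :: "'a::euclidean_space \<Rightarrow> 'b::{banach, second_countable_topology}"
  assumes "f \<in> borel_measurable borel" "DIM('a) < N" "\<And>x. norm (f x) \<le> C * decay N x"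
  shows "integrable lborel f"
  by (rule Bochner_Integration.integrable_bound[OF integrable_mult_right[OF integrable_decay[OF assms(2)], of C]])
     (use assms in \<open>auto intro: order_trans[OF _ abs_ge_self]\<close>)

section \<open>Schwartz functions\<close>

lemma smoothD: "smooth f \<Longrightarrow> is \<in> lists Basis \<Longrightarrow> iterated_partial_deriv is f differentiable (at x)"
  by (simp add: smooth_def)

lemma schwartz_smooth: "f \<in> schwartz \<Longrightarrow> smooth f"
  by (simp add: schwartz_def)

lemma iterated_partial_deriv_Nil [simp]: "iterated_partial_deriv [] f = f"
  by (simp add: iterated_partial_deriv_def)

lemma iterated_partial_deriv_Cons:
  "iterated_partial_deriv (i # is) f = partial_deriv i (iterated_partial_deriv is f)"
  by (simp add: iterated_partial_deriv_def)

lemma iterated_partial_deriv_partial_deriv: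
  "iterated_partial_deriv is (partial_deriv i f) = iterated_partial_deriv (is @ [i]) f"
  by (simp add: iterated_partial_deriv_def)

lemma smooth_differentiable: "smooth f \<Longrightarrow> f differentiable (at x)"
  using smoothD[of f "[]"] by simp

lemma schwartz_differentiable: "f \<in> schwartz \<Longrightarrow> f differentiable (at x)"
  by (simp add: schwartz_smooth smooth_differentiable)

lemma schwartz_borel_measurable:
  assumes "f \<in> schwartz"
  shows "f \<in> borel_measurable borel"
proof -
  have "continuous_on UNIV f"
    using schwartz_differentiable[OF assms]
    by (simp add: continuous_at_imp_continuous_on differentiable_imp_continuous_within)
  then show ?thesis by (rule borel_measurable_continuous_onI)
qed

lemma schwartz_iterated_decay:
  assumes "f \<in> schwartz" "is \<in> lists Basis"
  shows "\<exists>C. \<forall>x. norm (iterated_partial_deriv is f x) \<le> C * decay N x"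
proof -
  have "bounded (range (\<lambda>x. of_real ((1 + norm x) ^ N) * iterated_partial_deriv is f x))"
    using assms unfolding schwartz_def by blast
  then obtain C where "\<And>x. norm (of_real ((1 + norm x) ^ N) * iterated_partial_deriv is f x) \<le> C"
    unfolding bounded_iff by blast
  then have "norm (iterated_partial_deriv is f x) \<le> C * decay N x" for x
    unfolding le_decay_iff norm_mult norm_of_real by (simp add: power_abs)
  then show ?thesis by blast
qed

lemma schwartz_decay:
  assumes "f \<in> schwartz"
  obtains C where "\<And>x. norm (f x) \<le> C * decay N x"
  using schwartz_iterated_decay[OF assms, of "[]" N] by auto

lemma schwartz_partial_deriv:
  assumes "f \<in> schwartz" "i \<in> Basis"
  shows "partial_deriv i f \<in> schwartz"
proof -
  have "is @ [i] \<in> lists Basis" if "is \<in> lists Basis" for "is"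
    using that \<open>i \<in> Basis\<close> by simp
  with \<open>f \<in> schwartz\<close> show ?thesis
    unfolding schwartz_def smooth_def iterated_partial_deriv_partial_deriv mem_Collect_eq by blast
qed

lemma partial_deriv_linear:
  assumes "f differentiable (at x)" "g differentiable (at x)"
  shows "partial_deriv i (\<lambda>x. c * f x + g x) x = c * partial_deriv i f x + partial_deriv i g x"
proof -
  have "((\<lambda>x. c * f x + g x) has_derivative
      (\<lambda>h. c * frechet_derivative f (at x) h + frechet_derivative g (at x) h)) (at x)"
    using assms by (intro derivative_intros) (simp_all add: frechet_derivative_works[symmetric])
  from frechet_derivative_at[OF this] show ?thesis
    by (simp add: partial_deriv_def fun_eq_iff)
qed

lemma iterated_partial_deriv_linear:
  assumes "smooth f" "smooth g" "is \<in> lists Basis"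
  shows "iterated_partial_deriv is (\<lambda>x. c * f x + g x)
    = (\<lambda>x. c * iterated_partial_deriv is f x + iterated_partial_deriv is g x)"
  using assms(3)
proof (induction "is")
  case (Cons i "is")
  then have "is \<in> lists Basis" by simp
  with Cons.IH show ?case
    unfolding iterated_partial_deriv_Cons
    by (simp only:) (intro ext partial_deriv_linear smoothD assms)
qed simp

text \<open>
  The moment functionals are studied on the vector space of Schwartz functions, so this space has
  to be known to be closed under linear combinations.
\<close>

lemma schwartz_linear:
  assumes f: "f \<in> schwartz" and g: "g \<in> schwartz"
  shows "(\<lambda>x. c * f x + g x) \<in> schwartz"
proof -
  let ?h = "\<lambda>x. c * f x + g x"
  have [simp]: "smooth f" "smooth g" using f g by (simp_all add: schwartz_smooth)
  have "smooth ?h"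
    unfolding smooth_def by (auto simp: iterated_partial_deriv_linear smoothD)
  moreover have "bounded (range (\<lambda>x. of_real ((1 + norm x) ^ k) * iterated_partial_deriv is ?h x))"
    if in_lists: "is \<in> lists Basis" for k "is"
  proof -
    obtain A where A: "\<And>x. norm (iterated_partial_deriv is f x) \<le> A * decay k x"
      using schwartz_iterated_decay[OF f in_lists] by blast
    obtain D where D: "\<And>x. norm (iterated_partial_deriv is g x) \<le> D * decay k x"
      using schwartz_iterated_decay[OF g in_lists] by blast
    have "norm (iterated_partial_deriv is ?h x) \<le> (norm c * A + D) * decay k x" for x
    proof -
      have "norm (iterated_partial_deriv is ?h x) \<le> norm c * norm (iterated_partial_deriv is f x) + norm (iterated_partial_deriv is g x)"
        by (simp add: iterated_partial_deriv_linear in_lists norm_triangle_le norm_mult)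
      also have "\<dots> \<le> norm c * (A * decay k x) + D * decay k x"
        by (intro add_mono mult_left_mono A D) auto
      finally show ?thesis by (simp add: algebra_simps)
    qed
    then show ?thesis
      unfolding bounded_iff le_decay_iff
      by (intro exI[of _ "norm c * A + D"]) (simp add: norm_mult norm_power del: of_real_power of_real_add)
  qed
  ultimately show ?thesis by (simp add: schwartz_def)
qed

lemma zero_in_schwartz: "(\<lambda>x. 0) \<in> schwartz"
proof -
  have "iterated_partial_deriv is (\<lambda>x. 0::complex) = (\<lambda>x::'a. 0)" for "is"
    by (induction "is") (simp_all add: iterated_partial_deriv_Cons partial_deriv_def)
  then show ?thesis by (auto simp: schwartz_def smooth_def bounded_iff)
qed

lemma schwartz_cmult: "f \<in> schwartz \<Longrightarrow> (\<lambda>x. c * f x) \<in> schwartz"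
  using schwartz_linear[OF _ zero_in_schwartz, of f c] by simp

lemma schwartz_add: "f \<in> schwartz \<Longrightarrow> g \<in> schwartz \<Longrightarrow> (\<lambda>x. f x + g x) \<in> schwartz"
  using schwartz_linear[of f g 1] by simp

lemma schwartz_diff: "f \<in> schwartz \<Longrightarrow> g \<in> schwartz \<Longrightarrow> (\<lambda>x. f x - g x) \<in> schwartz"
  using schwartz_linear[of g f "-1"] by simp

section \<open>Functions as tempered distributions\<close>

lemma integrable_mult_schwartz:
  fixes F :: "'a::euclidean_space \<Rightarrow> complex"
  assumes "F \<in> borel_measurable borel" "integrable lborel (\<lambda>x. F x * decay N x)" "f \<in> schwartz"
  shows "integrable lborel (\<lambda>x. F x * f x)"
proof -
  obtain C where C: "\<And>x. norm (f x) \<le> C * decay N x"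
    using schwartz_decay[OF assms(3)] by blast
  show ?thesis
  proof (rule Bochner_Integration.integrable_bound[OF integrable_mult_right[OF assms(2), of C]])
    have "norm (F x * f x) \<le> norm (C * (F x * decay N x))" for x
      using mult_left_mono[OF order_trans[OF C[of x] abs_ge_self], of "norm (F x)"]
      by (simp add: norm_mult abs_mult mult_ac)
    then show "AE x in lborel. norm (F x * f x) \<le> norm (C * (F x * decay N x))" by simp
  qed (use assms(1) schwartz_borel_measurable[OF assms(3)] in measurable)
qed

lemma le_schwartz_seminorm:
  assumes "h \<in> schwartz"
  shows "norm (h x) \<le> schwartz_seminorm N [] h * decay N x"
  unfolding le_decay_iff schwartz_seminorm_def
proof (rule cSUP_upper2)
  obtain C where "\<And>x. norm (h x) \<le> C * decay N x" using schwartz_decay[OF assms] by blast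
  then show "bdd_above (range (\<lambda>x. (1 + norm x) ^ N * norm (iterated_partial_deriv [] h x)))"
    unfolding le_decay_iff by (auto intro!: bdd_aboveI)
qed auto

lemma topspace_schwartz: "topspace schwartz_topology = schwartz"
proof -
  have "f \<in> {g \<in> schwartz. schwartz_seminorm 0 [] (\<lambda>x. g x - f x) < 1}" if "f \<in> schwartz" for f :: "'a \<Rightarrow> complex"
    using that by (simp add: schwartz_seminorm_def)
  moreover have "[] \<in> lists Basis" "(0::real) < 1" by auto
  ultimately show ?thesis
    unfolding schwartz_topology_def topology_generated_by_topspace by blast
qed

text \<open>
  The pairing of \<open>F\<close> with \<open>f\<close> is at most \<open>\<integral> \<bar>F\<bar> (1 + \<bar>x\<bar>)\<^bsup>-N\<^esup>\<close> times the Schwartz seminorm of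
  order \<open>N\<close> without derivatives, so a single seminorm controls continuity.
\<close>

lemma defines_tempered_if_integrable:
  fixes F :: "'a::euclidean_space \<Rightarrow> complex"
  assumes F [measurable]: "F \<in> borel_measurable borel" and int: "integrable lborel (\<lambda>x. F x * decay N x)"
  shows "defines_tempered F"
proof -
  note intF = integrable_mult_schwartz[OF F int]
  have eq: "distribution_of F f = (LINT x|lborel. F x * f x)" if "f \<in> schwartz" for f
    using schwartz_borel_measurable[OF that] unfolding distribution_of_def
    by (intro integral_completion) measurable
  define K where "K = (LINT x|lborel. norm (F x * decay N x))"
  have K: "norm (distribution_of F f) \<le> schwartz_seminorm N [] f * K" if f: "f \<in> schwartz" for f
  proof -
    have "norm (distribution_of F f) \<le> (LINT x|lborel. norm (F x * f x))"
      unfolding eq[OF f] by (rule integral_norm_bound)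
    also have "\<dots> \<le> (LINT x|lborel. schwartz_seminorm N [] f * norm (F x * decay N x))"
    proof (rule integral_mono)
      show "integrable lborel (\<lambda>x. norm (F x * f x))" by (intro integrable_norm intF f)
      show "integrable lborel (\<lambda>x. schwartz_seminorm N [] f * norm (F x * decay N x))"
        by (intro integrable_mult_right integrable_norm int)
      show "norm (F x * f x) \<le> schwartz_seminorm N [] f * norm (F x * decay N x)" for x
        using mult_left_mono[OF le_schwartz_seminorm[OF f, of x N], of "norm (F x)"]
        by (simp add: norm_mult mult_ac)
    qed
    finally show ?thesis by (simp add: K_def)
  qed
  have add: "distribution_of F (\<lambda>x. f x + g x) = distribution_of F f + distribution_of F g"
    if "f \<in> schwartz" "g \<in> schwartz" for f g
    using that intF by (simp add: eq schwartz_add distrib_left)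
  have cmult: "distribution_of F (\<lambda>x. c * f x) = c * distribution_of F f" if "f \<in> schwartz" for c f
    using that intF by (simp add: eq schwartz_cmult mult.left_commute)
  have "continuous_map schwartz_topology euclidean (distribution_of F)"
  proof (subst continuous_map_alt, intro conjI allI impI)
    fix U :: "complex set" assume "openin euclidean U"
    then have "open U" by simp
    show "openin schwartz_topology (distribution_of F -` U \<inter> topspace schwartz_topology)"
    proof (subst openin_subopen, safe)
      fix f assume f: "distribution_of F f \<in> U" "f \<in> topspace schwartz_topology"
      then have fs: "f \<in> schwartz" by (simp add: topspace_schwartz)
      obtain e where e: "e > 0" "ball (distribution_of F f) e \<subseteq> U"
        using \<open>open U\<close> f(1) open_contains_ball by metis
      define T where "T = {g \<in> schwartz. schwartz_seminorm N [] (\<lambda>x. g x - f x) < e / (\<bar>K\<bar> + 1)}"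
      have "openin schwartz_topology T"
        unfolding schwartz_topology_def T_def
        by (intro topology_generated_by_Basis CollectI exI conjI[OF refl]) (use e fs in auto)
      moreover have "f \<in> T" using e fs by (simp add: T_def schwartz_seminorm_def add_pos_nonneg)
      moreover have "T \<subseteq> distribution_of F -` U \<inter> topspace schwartz_topology"
      proof
        fix g assume "g \<in> T"
        then have g: "g \<in> schwartz" "schwartz_seminorm N [] (\<lambda>x. g x - f x) < e / (\<bar>K\<bar> + 1)"
          by (simp_all add: T_def)
        have h: "(\<lambda>x. g x - f x) \<in> schwartz" using g fs by (simp add: schwartz_diff)
        have s0: "0 \<le> schwartz_seminorm N [] (\<lambda>x. g x - f x)"
          using order_trans[OF norm_ge_zero le_schwartz_seminorm[OF h, of 0 N]]
          by (simp add: decay_def)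
        have "distribution_of F g = distribution_of F f + distribution_of F (\<lambda>x. g x - f x)"
          using add[OF fs h] by simp
        then have "dist (distribution_of F f) (distribution_of F g) = norm (distribution_of F (\<lambda>x. g x - f x))"
          by (simp add: dist_norm)
        also have "\<dots> \<le> schwartz_seminorm N [] (\<lambda>x. g x - f x) * K" by (rule K[OF h])
        also have "\<dots> \<le> schwartz_seminorm N [] (\<lambda>x. g x - f x) * (\<bar>K\<bar> + 1)"
          using s0 by (intro mult_left_mono) auto
        also have "\<dots> < e" using g(2) by (simp add: pos_less_divide_eq add_pos_nonneg)
        finally show "g \<in> distribution_of F -` U \<inter> topspace schwartz_topology"
          using e g by (auto simp: topspace_schwartz)
      qed
      ultimately show "\<exists>T. openin schwartz_topology T \<and> f \<in> T \<and>
          T \<subseteq> distribution_of F -` U \<inter> topspace schwartz_topology" by blast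
    qed
  qed auto
  then have "distribution_of F \<in> tempered"
    using add cmult by (simp add: tempered_def)
  moreover have "integrable lebesgue (\<lambda>x. F x * f x)" if "f \<in> schwartz" for f
    using intF[OF that] schwartz_borel_measurable[OF that]
    by (subst integrable_completion) auto
  ultimately show ?thesis by (simp add: defines_tempered_def)
qed

lemma locally_integrable_if_integrable:
  fixes F :: "'a::euclidean_space \<Rightarrow> complex"
  assumes F [measurable]: "F \<in> borel_measurable borel" and int: "integrable lborel (\<lambda>x. F x * decay N x)"
  shows "locally_integrable F"
  unfolding locally_integrable_def set_integrable_def
proof (intro allI impI)
  fix K :: "'a set" assume "compact K"
  then obtain R where R: "\<And>x. x \<in> K \<Longrightarrow> norm x \<le> R" using compact_imp_bounded bounded_iff by metis
  have [measurable]: "K \<in> sets borel" using \<open>compact K\<close> by (simp add: borel_closed compact_imp_closed)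
  have "integrable lborel (\<lambda>x. indicator K x *\<^sub>R F x)"
  proof (rule Bochner_Integration.integrable_bound[OF integrable_mult_right[OF int, of "(1 + \<bar>R\<bar>) ^ N"]])
    have "norm (indicator K x *\<^sub>R F x) \<le> norm (((1 + \<bar>R\<bar>) ^ N) * (F x * decay N x))" for x
    proof (cases "x \<in> K")
      case True
      have "norm (F x) = norm (F x) * ((1 + norm x) ^ N * decay N x)" by (simp add: power_mult_decay)
      also have "\<dots> \<le> norm (F x) * ((1 + \<bar>R\<bar>) ^ N * decay N x)"
        using R[OF True] by (intro mult_left_mono mult_right_mono power_mono) auto
      finally show ?thesis using True by (simp add: norm_mult norm_power mult_ac)
          (metis abs_of_nonneg abs_ge_zero add_nonneg_nonneg norm_of_real of_real_1 of_real_add zero_le_one)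
    qed simp
    then show "AE x in lborel. norm (indicator K x *\<^sub>R F x) \<le> norm (((1 + \<bar>R\<bar>) ^ N) * (F x * decay N x))"
      by simp
  qed measurable
  then show "integrable lebesgue (\<lambda>x. indicator K x *\<^sub>R F x)"
    by (subst integrable_completion) measurable
qed

section \<open>Tempered distributions that agree on Schwartz functions with vanishing moments\<close>

text \<open>
  A functional that vanishes on the common kernel of finitely many functionals is a linear
  combination of them.  The space \<open>V\<close> is shrunk along with the family: on the kernel of \<open>L j\<close> the
  induction hypothesis applies, and one vector outside this kernel determines the coefficient of
  \<open>L j\<close>.
\<close>

lemma linear_functional_in_span:
  fixes V :: "('a \<Rightarrow> complex) set" and w :: "('a \<Rightarrow> complex) \<Rightarrow> complex"
  assumes "finite J"
    and V: "\<And>c f g. f \<in> V \<Longrightarrow> g \<in> V \<Longrightarrow> (\<lambda>x. c * f x + g x) \<in> V"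
    and w: "\<And>c f g. f \<in> V \<Longrightarrow> g \<in> V \<Longrightarrow> w (\<lambda>x. c * f x + g x) = c * w f + w g"
    and L: "\<And>j c f g. j \<in> J \<Longrightarrow> f \<in> V \<Longrightarrow> g \<in> V \<Longrightarrow> L j (\<lambda>x. c * f x + g x) = c * L j f + L j g"
    and ker: "\<And>f. f \<in> V \<Longrightarrow> (\<And>j. j \<in> J \<Longrightarrow> L j f = 0) \<Longrightarrow> w f = 0"
  shows "\<exists>c. \<forall>f\<in>V. w f = (\<Sum>j\<in>J. c j * L j f)"
  using assms
proof (induction J arbitrary: V rule: finite_induct)
  case empty
  then show ?case by simp
next
  case (insert j J)
  define V' where "V' = {f \<in> V. L j f = 0}"
  have "\<exists>c. \<forall>f\<in>V'. w f = (\<Sum>j\<in>J. c j * L j f)"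
  proof (rule insert.IH)
    show "(\<lambda>x. c * f x + g x) \<in> V'" if "f \<in> V'" "g \<in> V'" for c f g
      using that insert.prems(1,3) by (simp add: V'_def)
    show "w f = 0" if "f \<in> V'" "\<And>j. j \<in> J \<Longrightarrow> L j f = 0" for f
      using that insert.prems(4)[of f] by (auto simp: V'_def)
    show "w (\<lambda>x. c * f x + g x) = c * w f + w g" if "f \<in> V'" "g \<in> V'" for c f g
      using that insert.prems(2) by (simp add: V'_def)
    show "L i (\<lambda>x. c * f x + g x) = c * L i f + L i g" if "i \<in> J" "f \<in> V'" "g \<in> V'" for i c f g
      using that insert.prems(3) by (simp add: V'_def)
  qed
  then obtain c where c: "\<And>f. f \<in> V' \<Longrightarrow> w f = (\<Sum>j\<in>J. c j * L j f)" by blast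
  show ?case
  proof (cases "\<forall>f\<in>V. L j f = 0")
    case True
    then show ?thesis
      using c insert.hyps by (intro exI[of _ "c"]) (auto simp: V'_def)
  next
    case False
    then obtain f0 where f0: "f0 \<in> V" "L j f0 \<noteq> 0" by blast
    define a where "a = (w f0 - (\<Sum>j\<in>J. c j * L j f0)) / L j f0"
    have "w f = (\<Sum>i\<in>insert j J. (c(j := a)) i * L i f)" if f: "f \<in> V" for f
    proof -
      define s where "s = - (L j f / L j f0)"
      have g: "(\<lambda>x. s * f0 x + f x) \<in> V'"
        using insert.prems(1)[OF f0(1) f, of s] insert.prems(3)[OF insertI1 f0(1) f, of s] f0(2)
        by (simp add: V'_def s_def)
      have "s * w f0 + w f = w (\<lambda>x. s * f0 x + f x)" using insert.prems(2) f f0 by simp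
      also have "\<dots> = (\<Sum>i\<in>J. c i * L i (\<lambda>x. s * f0 x + f x))" by (rule c[OF g])
      also have "\<dots> = (\<Sum>i\<in>J. s * (c i * L i f0) + c i * L i f)"
        by (intro sum.cong refl) (use insert.prems(3) f f0 in \<open>simp add: algebra_simps\<close>)
      also have "\<dots> = s * (\<Sum>i\<in>J. c i * L i f0) + (\<Sum>i\<in>J. c i * L i f)"
        by (simp add: sum.distrib sum_distrib_left)
      finally have "w f = (\<Sum>i\<in>J. c i * L i f) - s * (w f0 - (\<Sum>j\<in>J. c j * L j f0))"
        by (simp add: algebra_simps)
      also have "- s * (w f0 - (\<Sum>j\<in>J. c j * L j f0)) = a * L j f"
        by (simp add: s_def a_def)
      then have "(\<Sum>i\<in>J. c i * L i f) - s * (w f0 - (\<Sum>j\<in>J. c j * L j f0)) = a * L j f + (\<Sum>i\<in>J. c i * L i f)"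
        by simp
      also have "\<dots> = (\<Sum>i\<in>insert j J. (c(j := a)) i * L i f)"
        using insert.hyps by (auto simp: intro!: sum.cong)
      finally show ?thesis .
    qed
    then show ?thesis by blast
  qed
qed

lemma finite_multi_indices: "finite (multi_indices l :: ('a::euclidean_space \<Rightarrow> nat) set)"
proof (rule finite_subset)
  show "(multi_indices l :: ('a \<Rightarrow> nat) set) \<subseteq> {f. \<forall>x. (x \<in> Basis \<longrightarrow> f x \<in> {..l}) \<and> (x \<notin> Basis \<longrightarrow> f x = 0)}"
  proof (intro subsetI CollectI allI conjI impI)
    fix \<gamma> :: "'a \<Rightarrow> nat" and x :: 'a assume \<gamma>: "\<gamma> \<in> multi_indices l"
    show "\<gamma> x = 0" if "x \<notin> Basis" using \<gamma> that by (simp add: multi_indices_def)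
    show "\<gamma> x \<in> {..l}" if "x \<in> Basis"
      using \<gamma> member_le_sum[OF that, of \<gamma>] by (simp add: multi_indices_def)
  qed
qed (intro finite_set_of_finite_funs, auto)

lemma monomial_borel_measurable [measurable]: "monomial \<gamma> \<in> borel_measurable borel"
  unfolding monomial_def by measurable

lemma norm_monomial_le: "norm (monomial \<gamma> x) \<le> (1 + norm x) ^ (\<Sum>i\<in>Basis. \<gamma> i)"
proof -
  have "norm (monomial \<gamma> x) = (\<Prod>i\<in>Basis. \<bar>x \<bullet> i\<bar> ^ \<gamma> i)"
    by (simp add: monomial_def abs_prod power_abs del: of_real_prod)
  also have "\<dots> \<le> (\<Prod>i\<in>Basis. (1 + norm x) ^ \<gamma> i)"
    by (intro prod_mono conjI power_mono) (auto simp: Basis_le_norm add_increasing)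
  also have "\<dots> = (1 + norm x) ^ (\<Sum>i\<in>Basis. \<gamma> i)" by (simp add: power_sum)
  finally show ?thesis .
qed

lemma integrable_monomial_mult_schwartz:
  fixes f :: "'a::euclidean_space \<Rightarrow> complex"
  assumes "f \<in> schwartz"
  shows "integrable lborel (\<lambda>x. monomial \<gamma> x * f x)"
proof (rule integrable_mult_schwartz[OF _ _ assms])
  show "integrable lborel (\<lambda>x::'a. monomial \<gamma> x * complex_of_real (decay ((\<Sum>i\<in>Basis. \<gamma> i) + Suc DIM('a)) x))"
  proof (rule integrable_if_decay_bound[where C = 1])
    fix x :: 'a
    show "norm (monomial \<gamma> x * complex_of_real (decay ((\<Sum>i\<in>Basis. \<gamma> i) + Suc DIM('a)) x)) \<le> 1 * decay (Suc DIM('a)) x"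
      using mult_right_mono[OF norm_monomial_le[of \<gamma> x], of "decay ((\<Sum>i\<in>Basis. \<gamma> i) + Suc DIM('a)) x"]
      unfolding power_mult_decay_add by (simp add: norm_mult)
  qed auto
qed measurable

lemma lebesgue_eq_lborel_monomial:
  fixes f :: "'a::euclidean_space \<Rightarrow> complex"
  assumes "f \<in> schwartz"
  shows "(LINT x|lebesgue. monomial \<gamma> x * f x) = (LINT x|lborel. monomial \<gamma> x * f x)"
  using schwartz_borel_measurable[OF assms] by (intro integral_completion) measurable

lemma distribution_of_polynomial:
  fixes f :: "'a::euclidean_space \<Rightarrow> complex"
  assumes "f \<in> schwartz"
  shows "distribution_of (\<lambda>x. \<Sum>\<gamma>\<in>J. c \<gamma> * monomial \<gamma> x) f = (\<Sum>\<gamma>\<in>J. c \<gamma> * (LINT x|lebesgue. monomial \<gamma> x * f x))"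
proof -
  have [measurable]: "f \<in> borel_measurable borel" by (rule schwartz_borel_measurable[OF assms])
  have "distribution_of (\<lambda>x. \<Sum>\<gamma>\<in>J. c \<gamma> * monomial \<gamma> x) f = (LINT x|lborel. (\<Sum>\<gamma>\<in>J. c \<gamma> * monomial \<gamma> x) * f x)"
    unfolding distribution_of_def by (intro integral_completion) measurable
  also have "\<dots> = (LINT x|lborel. (\<Sum>\<gamma>\<in>J. c \<gamma> * (monomial \<gamma> x * f x)))"
    by (simp add: sum_distrib_right mult.assoc)
  also have "\<dots> = (\<Sum>\<gamma>\<in>J. c \<gamma> * (LINT x|lborel. monomial \<gamma> x * f x))"
    by (subst Bochner_Integration.integral_sum) (auto simp: integrable_monomial_mult_schwartz[OF assms])
  finally show ?thesis by (simp add: lebesgue_eq_lborel_monomial[OF assms])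
qed

lemma distribution_of_poly_vanishing:
  assumes "p \<in> polys l" "f \<in> schwartz_vanishing l"
  shows "distribution_of p f = 0"
proof -
  obtain c where p: "p = (\<lambda>x. \<Sum>\<gamma>\<in>multi_indices l. c \<gamma> * monomial \<gamma> x)"
    using assms(1) by (auto simp: polys_def)
  show ?thesis
    unfolding p using assms(2) by (subst distribution_of_polynomial) (auto simp: schwartz_vanishing_def)
qed

lemma tempered_linear:
  assumes "u \<in> tempered" "f \<in> schwartz" "g \<in> schwartz"
  shows "u (\<lambda>x. c * f x + g x) = c * u f + u g"
  using assms schwartz_cmult[OF assms(2), of c] by (simp add: tempered_def)

text \<open>
  The functions with vanishing moments form the common kernel of the finitely many functionals
  \<open>f \<mapsto> \<integral> x\<^sup>\<gamma> f\<close>, so a difference of distributions that vanishes on them is a combination of these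
  functionals, which is integration against a polynomial.  This makes the identification of the dual
  space with a quotient of the tempered distributions concrete.
\<close>

lemma poly_rel_iff:
  fixes u v :: "('a::euclidean_space \<Rightarrow> complex) \<Rightarrow> complex"
  assumes u: "u \<in> tempered" and v: "v \<in> tempered"
  shows "(u, v) \<in> poly_rel l \<longleftrightarrow> (\<forall>f \<in> schwartz_vanishing l. u f = v f)"
proof
  assume "(u, v) \<in> poly_rel l"
  then show "\<forall>f \<in> schwartz_vanishing l. u f = v f"
    using distribution_of_poly_vanishing
    by (fastforce simp: poly_rel_def schwartz_vanishing_def)
next
  assume eq: "\<forall>f \<in> schwartz_vanishing l. u f = v f"
  have "\<exists>c. \<forall>f\<in>schwartz. u f - v f = (\<Sum>\<gamma>\<in>multi_indices l. c \<gamma> * (LINT x|lebesgue. monomial \<gamma> x * f x))"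
  proof (rule linear_functional_in_span[OF finite_multi_indices])
    show "(LINT x|lebesgue. monomial \<gamma> x * (c * f x + g x)) =
        c * (LINT x|lebesgue. monomial \<gamma> x * f x) + (LINT x|lebesgue. monomial \<gamma> x * g x)"
      if fg: "f \<in> schwartz" "g \<in> schwartz" for \<gamma> c f and g :: "'a \<Rightarrow> complex"
    proof -
      have "(LINT x|lborel. monomial \<gamma> x * (c * f x + g x)) = (LINT x|lborel. c * (monomial \<gamma> x * f x) + monomial \<gamma> x * g x)"
        by (simp add: algebra_simps)
      also have "\<dots> = c * (LINT x|lborel. monomial \<gamma> x * f x) + (LINT x|lborel. monomial \<gamma> x * g x)"
        using fg by (subst Bochner_Integration.integral_add) (auto simp: integrable_monomial_mult_schwartz)
      finally show ?thesis
        using fg by (simp add: lebesgue_eq_lborel_monomial schwartz_linear)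
    qed
    show "u (\<lambda>x. c * f x + g x) - v (\<lambda>x. c * f x + g x) = c * (u f - v f) + (u g - v g)"
      if "f \<in> schwartz" "g \<in> schwartz" for c f g
      by (simp only: tempered_linear[OF u that] tempered_linear[OF v that]) (simp add: algebra_simps)
    show "u f - v f = 0" if "f \<in> schwartz" "\<And>\<gamma>. \<gamma> \<in> multi_indices l \<Longrightarrow> (LINT x|lebesgue. monomial \<gamma> x * f x) = 0" for f
      using that eq by (simp add: schwartz_vanishing_def)
  qed (rule schwartz_linear)
  then obtain c where c: "\<And>f. f \<in> schwartz \<Longrightarrow>
      u f - v f = (\<Sum>\<gamma>\<in>multi_indices l. c \<gamma> * (LINT x|lebesgue. monomial \<gamma> x * f x))"
    by blast
  define p where "p = (\<lambda>x. \<Sum>\<gamma>\<in>multi_indices l. c \<gamma> * monomial \<gamma> (x::'a))"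
  have "p \<in> polys l"
    unfolding polys_def p_def by blast
  moreover have "u f - v f = distribution_of p f" if "f \<in> schwartz" for f
    using that by (simp only: c distribution_of_polynomial p_def)
  ultimately show "(u, v) \<in> poly_rel l"
    unfolding poly_rel_def
    by (intro CollectI case_prodI conjI u v bexI[where x = p] ballI)
qed

section \<open>Growth of functions of bounded mean oscillation\<close>

lemma locally_integrable_ball:
  assumes "locally_integrable f"
  shows "set_integrable lebesgue (ball x r) f"
proof (rule set_integrable_subset)
  show "set_integrable lebesgue (cball x r) f"
    using assms by (simp add: locally_integrable_def)
qed (auto simp: ball_subset_cball)

lemma locally_integrable_borel_measurable:
  fixes f :: "'a::euclidean_space \<Rightarrow> complex"
  assumes "locally_integrable f"
  shows "f \<in> borel_measurable lebesgue"
proof (rule borel_measurable_LIMSEQ_metric)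
  show "(\<lambda>x. indicator (ball 0 (real n)) x *\<^sub>R f x) \<in> borel_measurable lebesgue" for n
    using locally_integrable_ball[OF assms, of 0 "real n"] by (simp add: set_integrable_def)
  show "(\<lambda>n. indicator (ball 0 (real n)) x *\<^sub>R f x) \<longlonglongrightarrow> f x" for x
  proof (rule tendsto_eventually)
    obtain m where m: "norm x < real m" using reals_Archimedean2 by blast
    show "\<forall>\<^sub>F n in sequentially. indicator (ball 0 (real n)) x *\<^sub>R f x = f x"
      using eventually_ge_at_top[of m] by eventually_elim (use m in auto)
  qed
qed

lemma bmo_mean_oscillation_bound:
  assumes "b \<in> bmo"
  obtains A where "0 \<le> A" "\<And>x r. 0 < r \<Longrightarrow> mean_oscillation b (ball x r) \<le> A"
proof -
  have "bmo_norm b < \<infinity>" using assms by (simp add: bmo_def)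
  then obtain n :: nat where n: "bmo_norm b < ereal (real n)"
    using less_PInf_Ex_of_nat by auto
  have "mean_oscillation b (ball x r) \<le> real n" if "0 < r" for x r
  proof -
    have "ereal (mean_oscillation b (ball x r)) \<le> bmo_norm b"
      unfolding bmo_norm_def by (rule SUP_upper2[of "(x, r)"]) (use that in auto)
    with n show ?thesis by (metis ereal_less_eq(3) less_imp_le order_trans)
  qed
  then show thesis using that[of "real n"] by simp
qed

lemma set_integral_norm_bound:
  fixes f :: "'a \<Rightarrow> complex"
  assumes "set_integrable M S f"
  shows "norm (LINT x:S|M. f x) \<le> (LINT x:S|M. norm (f x))"
proof -
  have "norm (LINT x:S|M. f x) \<le> (LINT x|M. norm (indicator S x *\<^sub>R f x))"
    unfolding set_lebesgue_integral_def by (rule integral_norm_bound)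
  then show ?thesis by (simp add: set_lebesgue_integral_def)
qed

text \<open>
  The averages over two consecutive dyadic balls differ by at most \<open>2\<^sup>d\<close> times the bound for the mean
  oscillation, so the average over the ball of radius \<open>2\<^sup>k\<close> grows at most linearly in \<open>k\<close>.
\<close>

lemma bmo_dyadic_growth:
  fixes b :: "'a::euclidean_space \<Rightarrow> complex"
  assumes b: "b \<in> bmo"
  shows "\<exists>D\<ge>0. \<forall>k::nat. (LINT x:ball 0 (2 ^ k)|lebesgue. norm (b x)) \<le> D * (1 + real k) * 2 ^ (k * DIM('a))"
proof -
  define d where "d = DIM('a)"
  define B where "B k = ball (0::'a) (2 ^ k)" for k
  define V where "V k = measure lebesgue (B k)" for k
  define a where "a k = average b (B k)" for k
  obtain A where A0: "0 \<le> A" and A: "\<And>x r. 0 < r \<Longrightarrow> mean_oscillation b (ball x r) \<le> A"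
    using bmo_mean_oscillation_bound[OF b] by blast
  have loc: "locally_integrable b" using b by (simp add: bmo_def)
  have int: "set_integrable lebesgue (B k) b" for k
    unfolding B_def by (rule locally_integrable_ball[OF loc])
  have int1: "integrable lebesgue (indicator (B k) :: 'a \<Rightarrow> real)" for k
    using fmeasurableD2[OF lmeasurable_ball[of "0::'a" "2 ^ k"]] unfolding B_def
    by (intro integrable_real_indicator) (auto simp: less_top[symmetric])
  have intc: "set_integrable lebesgue (B k) (\<lambda>x. c)" for k and c :: complex
    using int1 unfolding set_integrable_def by (intro integrable_scaleR_left)
  have V: "V k = unit_ball_vol d * (2 ^ k) ^ d" for k
    unfolding V_def B_def d_def by (simp add: content_ball)
  have V_pos: "0 < V k" for k
    unfolding V by simp
  have osc: "(LINT x:B k|lebesgue. norm (b x - a k)) \<le> A * V k" for k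
    using A[of "2 ^ k" 0] V_pos[of k]
    by (simp add: mean_oscillation_def a_def V_def B_def pos_divide_le_eq)
  have step: "norm (a k) \<le> norm (a (Suc k)) + 2 ^ d * A \<and> norm (a (Suc k)) \<le> norm (a k) + 2 ^ d * A" for k
  proof -
    have i1: "set_integrable lebesgue (B k) (\<lambda>x. b x - a (Suc k))"
      and i2: "set_integrable lebesgue (B (Suc k)) (\<lambda>x. b x - a (Suc k))"
      by (intro set_integral_diff int intc)+
    have "(LINT x:B k|lebesgue. b x - a (Suc k)) = (LINT x:B k|lebesgue. b x) - (LINT x:B k|lebesgue. a (Suc k))"
      by (intro set_integral_diff int intc)
    also have "\<dots> = (a k - a (Suc k)) * V k"
    proof -
      have "(LINT x:B k|lebesgue. a (Suc k)) = V k *\<^sub>R a (Suc k)"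
        unfolding set_lebesgue_integral_def V_def
        by (subst integral_scaleR_left) (use int1[of k] in auto)
      moreover have "(LINT x:B k|lebesgue. b x) = a k * V k"
        using V_pos[of k] by (simp add: a_def average_def V_def)
      ultimately show ?thesis by (simp add: scaleR_conv_of_real algebra_simps)
    qed
    finally have "norm (a k - a (Suc k)) * V k = norm (LINT x:B k|lebesgue. b x - a (Suc k))"
      using V_pos[of k] by (simp add: norm_mult)
    also have "\<dots> \<le> (LINT x:B k|lebesgue. norm (b x - a (Suc k)))"
      by (rule set_integral_norm_bound[OF i1])
    also have "\<dots> \<le> (LINT x:B (Suc k)|lebesgue. norm (b x - a (Suc k)))"
    proof -
      have "B k \<subseteq> B (Suc k)" unfolding B_def by (intro subset_ball) simp
      then show ?thesis
        using set_integrable_norm[OF i1] set_integrable_norm[OF i2]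
        unfolding set_lebesgue_integral_def set_integrable_def
        by (intro integral_mono) (auto simp: indicator_def)
    qed
    also have "\<dots> \<le> A * V (Suc k)" by (rule osc)
    also have "\<dots> = 2 ^ d * A * V k" by (simp add: V power_mult_distrib)
    finally have "norm (a k - a (Suc k)) \<le> 2 ^ d * A"
      using V_pos[of k] by simp
    then show ?thesis
      using norm_triangle_ineq2[of "a k" "a (Suc k)"] norm_triangle_ineq2[of "a (Suc k)" "a k"]
      by (simp add: norm_minus_commute)
  qed
  have ak: "norm (a k) \<le> norm (a 0) + real k * (2 ^ d * A)" for k
  proof (induction k)
    case (Suc k)
    then show ?case using step[of k] by (simp add: algebra_simps)
  qed simp
  define D where "D = unit_ball_vol d * (norm (a 0) + 2 ^ d * A + A)"
  have "(LINT x:B k|lebesgue. norm (b x)) \<le> D * (1 + real k) * 2 ^ (k * d)" for k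
  proof -
    have i1: "set_integrable lebesgue (B k) (\<lambda>x. b x - a k)"
      by (intro set_integral_diff int intc)
    have "(LINT x:B k|lebesgue. norm (b x)) \<le> (LINT x:B k|lebesgue. norm (b x - a k) + norm (a k))"
      using set_integrable_norm[OF int, of k] set_integral_add(1)[OF set_integrable_norm[OF i1] set_integrable_norm[OF intc[of k "a k"]]]
      by (intro set_integral_mono) (auto intro: norm_triangle_sub order_trans[OF norm_triangle_sub] simp: add.commute)
    also have "\<dots> = (LINT x:B k|lebesgue. norm (b x - a k)) + (LINT x:B k|lebesgue. norm (a k))"
      by (intro set_integral_add set_integrable_norm i1 intc)
    also have "(LINT x:B k|lebesgue. norm (a k)) = norm (a k) * V k"
      unfolding set_lebesgue_integral_def V_def
      by (subst integral_scaleR_left) (use int1[of k] in auto)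
    also have "(LINT x:B k|lebesgue. norm (b x - a k)) + norm (a k) * V k \<le> A * V k + (norm (a 0) + real k * (2 ^ d * A)) * V k"
      using V_pos[of k] by (intro add_mono osc mult_right_mono ak) auto
    also have "\<dots> = (A + norm (a 0) + real k * (2 ^ d * A)) * V k" by (simp add: algebra_simps)
    also have "\<dots> \<le> ((norm (a 0) + 2 ^ d * A + A) * (1 + real k)) * V k"
      using A0 V_pos[of k] by (intro mult_right_mono) (auto simp: algebra_simps)
    also have "\<dots> = D * (1 + real k) * 2 ^ (k * d)" by (simp add: D_def V power_mult)
    finally show ?thesis .
  qed
  moreover have "0 \<le> D" using A0 by (simp add: D_def)
  ultimately show ?thesis unfolding B_def d_def by blast
qed

text \<open>
  The logarithmic growth of the averages is traded for an arbitrarily small power, which is all that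
  the convergence at large times can tell apart.
\<close>

lemma bmo_growth:
  fixes b :: "'a::euclidean_space \<Rightarrow> complex" and \<epsilon> :: real
  assumes b: "b \<in> bmo" and \<epsilon>: "0 < \<epsilon>"
  shows "\<exists>C\<ge>0. \<forall>R\<ge>1. (\<integral>\<^sup>+x\<in>ball 0 R. norm (b x) \<partial>lebesgue) \<le> ennreal (C * R powr (DIM('a) + \<epsilon>))"
proof -
  obtain D where D0: "0 \<le> D" and D: "\<And>k::nat. (LINT x:ball 0 (2 ^ k)|lebesgue. norm (b x)) \<le> D * (1 + real k) * 2 ^ (k * DIM('a))"
    using bmo_dyadic_growth[OF b] by blast
  have loc: "locally_integrable b" using b by (simp add: bmo_def)
  \<comment> \<open>chosen so that \<open>2 + log\<^sub>2 R \<le> L R\<^sup>\<epsilon>\<close> for \<open>R \<ge> 1\<close>\<close>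
  define L where "L = 2 + 1 / (\<epsilon> * ln 2)"
  have L0: "0 \<le> L" using \<epsilon> by (simp add: L_def)
  have "(\<integral>\<^sup>+x\<in>ball 0 R. norm (b x) \<partial>lebesgue) \<le> ennreal (D * L * 2 ^ DIM('a) * R powr (DIM('a) + \<epsilon>))" if R: "1 \<le> R" for R
  proof -
    define k where "k = nat \<lceil>log 2 R\<rceil>"
    have lg: "0 \<le> log 2 R" using R by simp
    have k: "log 2 R \<le> real k" "real k \<le> log 2 R + 1"
      using lg unfolding k_def by linarith+
    have Rk: "R \<le> 2 ^ k"
      using k(1) R by (simp add: log_le_iff powr_realpow)
    have kR: "2 ^ k \<le> 2 * R"
    proof -
      have "(2::real) ^ k = 2 powr real k" by (simp add: powr_realpow)
      also have "\<dots> \<le> 2 powr (log 2 R + 1)" using k(2) by simp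
      also have "\<dots> = 2 * R" using R by (simp add: powr_add)
      finally show ?thesis .
    qed
    have "1 + real k \<le> 2 + ln R / ln 2" using k(2) by (simp add: log_def)
    also have "\<dots> \<le> 2 * R powr \<epsilon> + R powr \<epsilon> / \<epsilon> / ln 2"
      using R \<epsilon> by (intro add_mono divide_right_mono ln_powr_bound) (auto simp: ge_one_powr_ge_zero)
    also have "\<dots> = L * R powr \<epsilon>" by (simp add: L_def algebra_simps)
    finally have kL: "1 + real k \<le> L * R powr \<epsilon>" .
    have "(\<integral>\<^sup>+x\<in>ball 0 R. norm (b x) \<partial>lebesgue) \<le> (\<integral>\<^sup>+x\<in>ball 0 (2 ^ k). norm (b x) \<partial>lebesgue)"
      using Rk by (intro nn_integral_mono) (auto simp: indicator_def)
    also have "\<dots> = (\<integral>\<^sup>+x. ennreal (indicator (ball 0 (2 ^ k)) x *\<^sub>R norm (b x)) \<partial>lebesgue)"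
      by (intro nn_integral_cong) (auto simp: indicator_def)
    also have "\<dots> = ennreal (LINT x:ball 0 (2 ^ k)|lebesgue. norm (b x))"
      unfolding set_lebesgue_integral_def
      using set_integrable_norm[OF locally_integrable_ball[OF loc, of 0 "2 ^ k"]]
      by (intro nn_integral_eq_integral) (auto simp: set_integrable_def)
    also have "\<dots> \<le> ennreal (D * (1 + real k) * 2 ^ (k * DIM('a)))"
      by (intro ennreal_leI D)
    also have "\<dots> \<le> ennreal (D * (L * R powr \<epsilon>) * (2 * R) ^ DIM('a))"
      unfolding power_mult using D0 L0 kL kR by (intro ennreal_leI mult_mono power_mono mult_nonneg_nonneg) auto
    also have "D * (L * R powr \<epsilon>) * (2 * R) ^ DIM('a) = D * L * 2 ^ DIM('a) * R powr (DIM('a) + \<epsilon>)"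
      using R by (simp add: powr_add powr_realpow power_mult_distrib)
    finally show ?thesis .
  qed
  moreover have "0 \<le> D * L * 2 ^ DIM('a)" using D0 L0 by simp
  ultimately show ?thesis by blast
qed

section \<open>Fourier transforms of Schwartz functions\<close>

lemma integral_lborel_translate:
  fixes f :: "'a::euclidean_space \<Rightarrow> complex"
  assumes [measurable]: "f \<in> borel_measurable borel"
  shows "(LINT x|lborel. f (x + a)) = (LINT x|lborel. f x)"
proof -
  have "(LINT x|lborel. f x) = (LINT x|distr lborel borel ((+) a). f x)" by (simp add: lborel_distr_plus)
  also have "\<dots> = (LINT x|lborel. f (a + x))" by (rule integral_distr) measurable
  finally show ?thesis by (simp add: add.commute)
qed

lemma schwartz_integrable: "f \<in> schwartz \<Longrightarrow> integrable lborel (f :: 'a::euclidean_space \<Rightarrow> complex)"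
  using schwartz_decay[of f "Suc DIM('a)"] schwartz_borel_measurable[of f]
  by (metis integrable_if_decay_bound lessI)

lemma cis_borel_measurable [measurable]: "cis \<in> borel_measurable borel"
  by (intro borel_measurable_continuous_onI continuous_intros)

lemma fourier_eq:
  fixes f :: "'a::euclidean_space \<Rightarrow> complex"
  assumes [measurable]: "f \<in> borel_measurable borel"
  shows "fourier f \<xi> = (LINT x|lborel. f x * cis (- (2 * pi * (x \<bullet> \<xi>))))"
proof -
  have "fourier f \<xi> = (LINT x|lborel. f x * exp (- (2 * of_real pi * \<i> * of_real (x \<bullet> \<xi>))))"
    unfolding fourier_def by (intro integral_completion) measurable
  then show ?thesis by (simp add: cis_conv_exp mult_ac)
qed

text \<open>
  Integration by parts without coordinates: difference quotients have integral zero because Lebesgue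
  measure is translation invariant, and by the mean value theorem together with Peetre's inequality
  they are dominated by the weight that bounds the derivative.
\<close>

lemma integral_directional_derivative_zero:
  fixes g :: "'a::euclidean_space \<Rightarrow> complex"
  assumes deriv: "\<And>x. (g has_derivative D x) (at x)"
    and [measurable]: "g \<in> borel_measurable borel" "(\<lambda>x. D x i) \<in> borel_measurable borel"
    and i: "i \<in> Basis"
    and g: "integrable lborel g"
    and N: "DIM('a) < N" and D: "\<And>x. norm (D x i) \<le> C * decay N x"
  shows "(LINT x|lborel. D x i) = 0"
proof -
  define h where "h n = inverse (real (Suc n))" for n
  have h: "0 < h n" "h n \<le> 1" for n by (auto simp: h_def divide_simps)
  define q where "q n x = (g (x + h n *\<^sub>R i) - g x) /\<^sub>R h n" for n x
  have line: "((\<lambda>t. g (x + t *\<^sub>R i)) has_vector_derivative D (x + t *\<^sub>R i) i) (at t within T)" for x t T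
  proof -
    have "((\<lambda>t. g (x + t *\<^sub>R i)) has_derivative (\<lambda>s. D (x + t *\<^sub>R i) (s *\<^sub>R i))) (at t within T)"
      by (rule has_derivative_compose[OF _ deriv]) (auto intro!: derivative_eq_intros)
    then show ?thesis
      using linear_scale[OF has_derivative_linear[OF deriv[of "x + t *\<^sub>R i"]]]
      by (simp add: has_vector_derivative_def)
  qed
  have C0: "0 \<le> C"
    using order_trans[OF norm_ge_zero D[of 0]] by (simp add: decay_def)
  have bound: "norm (q n x) \<le> C * 2 ^ N * decay N x" for n x
  proof -
    have "norm (g (x + h n *\<^sub>R i) - g (x + 0 *\<^sub>R i)) \<le> (C * 2 ^ N * decay N x) * norm (h n - 0)"
    proof (rule differentiable_bound)
      show "((\<lambda>t. g (x + t *\<^sub>R i)) has_derivative (\<lambda>s. s *\<^sub>R D (x + t *\<^sub>R i) i)) (at t within {0..1})" for t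
        using line by (simp add: has_vector_derivative_def)
      fix t :: real assume t: "t \<in> {0..1}"
      have "norm (D (x + t *\<^sub>R i) i) \<le> C * decay N (x - - (t *\<^sub>R i))" using D by simp
      also have "\<dots> \<le> C * ((1 + norm (- (t *\<^sub>R i))) ^ N * decay N x)"
        using C0 by (intro mult_left_mono decay_diff_le)
      also have "\<dots> \<le> C * (2 ^ N * decay N x)"
        using C0 t i by (intro mult_left_mono mult_right_mono power_mono) auto
      finally show "onorm (\<lambda>s. s *\<^sub>R D (x + t *\<^sub>R i) i) \<le> C * 2 ^ N * decay N x"
        by (intro onorm_bound) (auto simp: mult.commute[of _ "\<bar>_\<bar>"] mult.assoc intro!: mult_left_mono mult_nonneg_nonneg C0)
    qed (use h[of n] in auto)
    then show ?thesis
      using h[of n] by (simp add: q_def divide_simps mult.commute)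
  qed
  have "(\<lambda>n. LINT x|lborel. q n x) \<longlonglongrightarrow> (LINT x|lborel. D x i)"
  proof (rule integral_dominated_convergence)
    show "integrable lborel (\<lambda>x. C * 2 ^ N * decay N (x::'a))"
      by (intro integrable_mult_right integrable_decay N)
    show "AE x in lborel. (\<lambda>n. q n x) \<longlonglongrightarrow> D x i"
    proof (rule AE_I2)
      fix x
      have "((\<lambda>t. (g (x + t *\<^sub>R i) - g (x + 0 *\<^sub>R i)) /\<^sub>R (t - 0)) \<longlongrightarrow> D (x + 0 *\<^sub>R i) i) (at 0)"
      proof -
        have "(\<lambda>t. norm (g (x + t *\<^sub>R i) - g x - t *\<^sub>R D x i) / norm t) \<midarrow>0\<rightarrow> 0"
          using line[of x 0 UNIV] unfolding has_vector_derivative_def has_derivative_at by simp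
        moreover have "\<forall>\<^sub>F t in at 0. norm (g (x + t *\<^sub>R i) - g x - t *\<^sub>R D x i) / norm t
            = norm ((g (x + t *\<^sub>R i) - g x) /\<^sub>R t - D x i)"
          unfolding eventually_at_filter
        proof (rule always_eventually, intro allI impI)
          fix t :: real assume "t \<noteq> 0"
          then have "(g (x + t *\<^sub>R i) - g x) /\<^sub>R t - D x i = (g (x + t *\<^sub>R i) - g x - t *\<^sub>R D x i) /\<^sub>R t"
            by (simp add: scaleR_diff_right)
          then show "norm (g (x + t *\<^sub>R i) - g x - t *\<^sub>R D x i) / norm t
              = norm ((g (x + t *\<^sub>R i) - g x) /\<^sub>R t - D x i)"
            by (simp add: divide_inverse mult.commute)
        qed
        ultimately have "(\<lambda>t. norm ((g (x + t *\<^sub>R i) - g x) /\<^sub>R t - D x i)) \<midarrow>0\<rightarrow> 0"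
          by (rule Lim_transform_eventually)
        then show ?thesis
          by (simp add: tendsto_norm_zero_iff LIM_zero_iff)
      qed
      moreover have "filterlim h (at 0) sequentially"
        unfolding filterlim_at using LIMSEQ_inverse_real_of_nat h(1)
        by (simp add: h_def[abs_def])
      ultimately show "(\<lambda>n. q n x) \<longlonglongrightarrow> D x i"
        unfolding q_def by (auto dest: filterlim_compose)
    qed
    show "AE x in lborel. norm (q n x) \<le> C * 2 ^ N * decay N x" for n
      using bound by simp
  qed (simp_all add: q_def[abs_def])
  moreover have "(LINT x|lborel. q n x) = 0" for n
  proof -
    have "integrable lborel (\<lambda>x. g (x + h n *\<^sub>R i))"
      using g integrable_distr_eq[of "(+) (h n *\<^sub>R i)" lborel borel g]
      by (simp add: lborel_distr_plus add.commute)
    then have "(LINT x|lborel. q n x) = ((LINT x|lborel. g (x + h n *\<^sub>R i)) - (LINT x|lborel. g x)) /\<^sub>R h n"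
      unfolding q_def using g by (subst integral_scaleR_right) simp
    then show ?thesis by (simp add: integral_lborel_translate)
  qed
  ultimately show ?thesis using LIMSEQ_unique[OF _ tendsto_const[of 0]] by simp
qed

text \<open>
  The derivative of \<open>x \<mapsto> f x \<cdot> e\<^bsup>-2\<pi>\<i> x\<bullet>\<xi>\<^esup>\<close> in the direction \<open>i\<close> integrates to zero.
\<close>

lemma fourier_partial_deriv:
  fixes f :: "'a::euclidean_space \<Rightarrow> complex"
  assumes f: "f \<in> schwartz" and i: "i \<in> Basis"
  shows "fourier (partial_deriv i f) \<xi> = 2 * pi * \<i> * (\<xi> \<bullet> i) * fourier f \<xi>"
proof -
  let ?E = "\<lambda>x::'a. cis (- (2 * pi * (x \<bullet> \<xi>)))"
  have f': "partial_deriv i f \<in> schwartz" by (rule schwartz_partial_deriv[OF f i])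
  have [measurable]: "f \<in> borel_measurable borel" "partial_deriv i f \<in> borel_measurable borel"
    using f f' by (simp_all add: schwartz_borel_measurable)
  define D where "D x h = frechet_derivative f (at x) h * ?E x - f x * (2 * pi * \<i> * (h \<bullet> \<xi>) * ?E x)" for x h
  have Di: "D x i = partial_deriv i f x * ?E x - 2 * pi * \<i> * (\<xi> \<bullet> i) * (f x * ?E x)" for x
    by (simp add: D_def partial_deriv_def inner_commute algebra_simps)
  have int: "integrable lborel (\<lambda>x. f x * ?E x)" "integrable lborel (\<lambda>x. partial_deriv i f x * ?E x)"
    by (rule Bochner_Integration.integrable_bound[OF schwartz_integrable[OF f]]; simp add: norm_mult)
       (rule Bochner_Integration.integrable_bound[OF schwartz_integrable[OF f']]; simp add: norm_mult)
  obtain A where A: "\<And>x. norm (f x) \<le> A * decay (Suc DIM('a)) x" using schwartz_decay[OF f] by blast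
  obtain B where B: "\<And>x. norm (partial_deriv i f x) \<le> B * decay (Suc DIM('a)) x"
    using schwartz_decay[OF f'] by blast
  have "(LINT x|lborel. D x i) = 0"
  proof (rule integral_directional_derivative_zero[OF _ _ _ i int(1)])
    show "((\<lambda>x. f x * ?E x) has_derivative D x) (at x)" for x
    proof -
      have "(f has_derivative frechet_derivative f (at x)) (at x)"
        using schwartz_differentiable[OF f] by (simp add: frechet_derivative_works)
      then show ?thesis
        unfolding D_def by (auto intro!: derivative_eq_intros simp: scaleR_conv_of_real algebra_simps)
    qed
    show "norm (D x i) \<le> (B + 2 * pi * norm \<xi> * A) * decay (Suc DIM('a)) x" for x
    proof -
      have "norm (D x i) \<le> norm (partial_deriv i f x * ?E x) + norm (2 * pi * \<i> * (\<xi> \<bullet> i) * (f x * ?E x))"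
        unfolding Di by (rule norm_triangle_ineq4)
      also have "\<dots> = norm (partial_deriv i f x) + 2 * pi * \<bar>\<xi> \<bullet> i\<bar> * norm (f x)"
        by (simp add: norm_mult)
      also have "\<dots> \<le> B * decay (Suc DIM('a)) x + 2 * pi * norm \<xi> * (A * decay (Suc DIM('a)) x)"
        by (intro add_mono mult_mono A B order_refl Basis_le_norm i) auto
      finally show ?thesis by (simp add: algebra_simps)
    qed
  qed (simp_all add: Di[abs_def])
  then have "0 = (LINT x|lborel. partial_deriv i f x * ?E x) - 2 * pi * \<i> * (\<xi> \<bullet> i) * (LINT x|lborel. f x * ?E x)"
    unfolding Di using int by (subst (asm) Bochner_Integration.integral_diff) auto
  then show ?thesis by (simp add: fourier_eq)
qed

lemma norm_fourier_le:
  fixes f :: "'a::euclidean_space \<Rightarrow> complex"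
  assumes "f \<in> borel_measurable borel"
  shows "norm (fourier f \<xi>) \<le> (LINT x|lborel. norm (f x))"
  using integral_norm_bound[of lborel "\<lambda>x. f x * cis (- (2 * pi * (x \<bullet> \<xi>)))"]
  by (simp add: fourier_eq[OF assms] norm_mult)

text \<open>
  Each derivative in the direction \<open>i\<close> gains one power of \<open>\<xi> \<bullet> i\<close>.
\<close>

lemma fourier_coordinate_decay:
  fixes f :: "'a::euclidean_space \<Rightarrow> complex"
  assumes "f \<in> schwartz" and i: "i \<in> Basis"
  shows "\<exists>C. \<forall>\<xi>. \<bar>\<xi> \<bullet> i\<bar> ^ m * norm (fourier f \<xi>) \<le> C"
  using assms(1)
proof (induction m arbitrary: f)
  case 0
  then show ?case using norm_fourier_le[OF schwartz_borel_measurable] by auto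
next
  case (Suc m)
  obtain C where C: "\<And>\<xi>. \<bar>\<xi> \<bullet> i\<bar> ^ m * norm (fourier (partial_deriv i f) \<xi>) \<le> C"
    using Suc.IH[OF schwartz_partial_deriv[OF Suc.prems i]] by blast
  have "\<bar>\<xi> \<bullet> i\<bar> ^ Suc m * norm (fourier f \<xi>) \<le> C" for \<xi>
  proof -
    have "1 \<le> 2 * pi" using pi_ge_two by simp
    then have "\<bar>\<xi> \<bullet> i\<bar> * norm (fourier f \<xi>) \<le> norm (fourier (partial_deriv i f) \<xi>)"
      using mult_right_mono[of 1 "2 * pi" "\<bar>\<xi> \<bullet> i\<bar> * norm (fourier f \<xi>)"]
      by (simp add: fourier_partial_deriv[OF Suc.prems i] norm_mult mult.assoc)
    then have "\<bar>\<xi> \<bullet> i\<bar> ^ m * (\<bar>\<xi> \<bullet> i\<bar> * norm (fourier f \<xi>)) \<le> \<bar>\<xi> \<bullet> i\<bar> ^ m * norm (fourier (partial_deriv i f) \<xi>)"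
      by (intro mult_left_mono) auto
    with C[of \<xi>] show ?thesis by (simp add: mult_ac)
  qed
  then show ?case by blast
qed

text \<open>
  Some coordinate is comparable to the norm, which reduces decay in \<open>\<xi>\<close> to decay in single
  coordinates.
\<close>

lemma exists_large_coordinate: "\<exists>i\<in>Basis. norm \<xi> \<le> DIM('a) * \<bar>(\<xi>::'a::euclidean_space) \<bullet> i\<bar>"
proof (rule ccontr)
  assume "\<not> ?thesis"
  then have "(\<Sum>i\<in>Basis. DIM('a) * \<bar>\<xi> \<bullet> i\<bar>) < (\<Sum>i\<in>(Basis::'a set). norm \<xi>)"
    by (intro sum_strict_mono) (auto simp: not_le)
  then show False using norm_le_l1[of \<xi>] by (simp add: sum_distrib_left[symmetric])
qed

lemma fourier_decay:
  fixes f :: "'a::euclidean_space \<Rightarrow> complex"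
  assumes f: "f \<in> schwartz"
  shows "\<exists>C\<ge>0. \<forall>\<xi>. norm (fourier f \<xi>) \<le> C * decay m \<xi>"
proof -
  have "\<exists>C. \<forall>i\<in>(Basis::'a set). \<forall>\<xi>. \<bar>\<xi> \<bullet> i\<bar> ^ m * norm (fourier f \<xi>) \<le> C i"
    by (rule bchoice) (use fourier_coordinate_decay[OF f] in blast)
  then obtain C where C: "\<And>i \<xi>. i \<in> Basis \<Longrightarrow> \<bar>\<xi> \<bullet> i\<bar> ^ m * norm (fourier f \<xi>) \<le> C i" by blast
  have C0: "0 \<le> C i" if "i \<in> Basis" for i
    by (rule order_trans[OF _ C[OF that, of 0]]) simp
  define S where "S = real DIM('a) ^ m * (\<Sum>i\<in>Basis. C i)"
  define M where "M = (LINT x|lborel. norm (f x))"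
  have M: "norm (fourier f \<xi>) \<le> M" for \<xi>
    unfolding M_def by (rule norm_fourier_le[OF schwartz_borel_measurable[OF f]])
  have S: "norm \<xi> ^ m * norm (fourier f \<xi>) \<le> S" for \<xi>
  proof -
    obtain i :: 'a where i: "i \<in> Basis" "norm \<xi> \<le> DIM('a) * \<bar>\<xi> \<bullet> i\<bar>"
      using exists_large_coordinate by blast
    have "norm \<xi> ^ m * norm (fourier f \<xi>) \<le> (DIM('a) * \<bar>\<xi> \<bullet> i\<bar>) ^ m * norm (fourier f \<xi>)"
      by (intro mult_right_mono power_mono i) auto
    also have "\<dots> = DIM('a) ^ m * (\<bar>\<xi> \<bullet> i\<bar> ^ m * norm (fourier f \<xi>))"
      by (simp add: power_mult_distrib)
    also have "\<dots> \<le> DIM('a) ^ m * (\<Sum>i\<in>Basis. C i)"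
      using C[OF i(1), of \<xi>] member_le_sum[of i Basis C] i(1) C0
      by (intro mult_left_mono) auto
    finally show ?thesis by (simp add: S_def)
  qed
  have "norm (fourier f \<xi>) \<le> 2 ^ m * (M + S) * decay m \<xi>" for \<xi>
  proof -
    have "(1 + norm \<xi>) ^ m \<le> 2 ^ m * (1 + norm \<xi> ^ m)"
    proof (cases "norm \<xi> \<le> 1")
      case True
      then have "(1 + norm \<xi>) ^ m \<le> 2 ^ m" by (intro power_mono) auto
      then show ?thesis by (simp add: distrib_left add_increasing2)
    next
      case False
      then have "(1 + norm \<xi>) ^ m \<le> (2 * norm \<xi>) ^ m" by (intro power_mono) auto
      then show ?thesis by (simp add: distrib_left power_mult_distrib add_increasing)
    qed
    then have "(1 + norm \<xi>) ^ m * norm (fourier f \<xi>) \<le> 2 ^ m * (1 + norm \<xi> ^ m) * norm (fourier f \<xi>)"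
      by (intro mult_right_mono) auto
    also have "\<dots> = 2 ^ m * (norm (fourier f \<xi>) + norm \<xi> ^ m * norm (fourier f \<xi>))" by (simp add: algebra_simps)
    also have "\<dots> \<le> 2 ^ m * (M + S)" by (intro mult_left_mono add_mono M S) auto
    finally show ?thesis by (simp add: le_decay_iff)
  qed
  moreover have "0 \<le> 2 ^ m * (M + S)"
    unfolding M_def S_def using C0 by (intro mult_nonneg_nonneg add_nonneg_nonneg sum_nonneg) auto
  ultimately show ?thesis by blast
qed

lemma schwartz_vanishing_schwartz: "f \<in> schwartz_vanishing l \<Longrightarrow> f \<in> schwartz"
  by (simp add: schwartz_vanishing_def)

lemma monomial_zero: "monomial (\<lambda>_. 0) x = 1"
  by (simp add: monomial_def)

lemma monomial_single:
  assumes "i \<in> Basis"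
  shows "monomial (\<lambda>j. if j = i then 1 else 0) x = of_real (x \<bullet> i)"
  using assms by (simp add: monomial_def if_distrib[of "\<lambda>n. _ ^ n"] prod.delta cong: if_cong)

text \<open>
  The moments are given along the coordinates, while the Taylor expansions below need them along an
  arbitrary direction \<open>v\<close>.  Only the orders 0 and 1 occur.
\<close>

lemma integral_inner_power_vanishing:
  fixes f :: "'a::euclidean_space \<Rightarrow> complex"
  assumes f: "f \<in> schwartz_vanishing l" and k: "k \<le> l" "k \<le> 1"
  shows "has_bochner_integral lborel (\<lambda>x. of_real ((x \<bullet> v) ^ k) * f x) 0"
proof -
  have fs: "f \<in> schwartz" using f by (rule schwartz_vanishing_schwartz)
  have van: "has_bochner_integral lborel (\<lambda>x. monomial \<gamma> x * f x) 0" if "\<gamma> \<in> multi_indices l" for \<gamma>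
    using f that integrable_monomial_mult_schwartz[OF fs] lebesgue_eq_lborel_monomial[OF fs]
    by (simp add: schwartz_vanishing_def has_bochner_integral_iff)
  show ?thesis
  proof (cases "k = 0")
    case True
    have "(\<lambda>_. 0) \<in> multi_indices l" by (simp add: multi_indices_def)
    from van[OF this] show ?thesis by (simp add: True monomial_zero)
  next
    case False
    with k have "k = 1" "1 \<le> l" by auto
    have "has_bochner_integral lborel (\<lambda>x. of_real (x \<bullet> i) * f x) 0" if i: "i \<in> Basis" for i
    proof -
      have "(\<lambda>j. if j = i then 1 else 0) \<in> multi_indices l"
        using i \<open>1 \<le> l\<close> by (auto simp: multi_indices_def)
      from van[OF this] show ?thesis by (simp add: monomial_single[OF i])
    qed
    then have "has_bochner_integral lborel (\<lambda>x. \<Sum>i\<in>Basis. of_real (v \<bullet> i) * (of_real (x \<bullet> i) * f x)) (\<Sum>i\<in>(Basis::'a set). of_real (v \<bullet> i) * 0)"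
      by (intro has_bochner_integral_sum has_bochner_integral_mult_right)
    moreover have "(\<Sum>i\<in>Basis. of_real (v \<bullet> i) * (of_real (x \<bullet> i) * f x)) = of_real ((x \<bullet> v) ^ k) * f x" for x
      using \<open>k = 1\<close> by (simp add: euclidean_inner[of x v] sum_distrib_left sum_distrib_right mult_ac)
    ultimately show ?thesis by simp
  qed
qed

lemma cis_Taylor_bound:
  "norm (cis x - (\<Sum>k\<le>n. (\<i> * x) ^ k / fact k)) \<le> \<bar>x\<bar> ^ Suc n / fact (Suc n)"
  using iexp_approx1[of x n] by (simp add: cis_conv_exp)

text \<open>
  Vanishing moments allow the Taylor polynomial of the exponential to be subtracted under the
  integral, which leaves a remainder of order \<open>\<bar>x \<bullet> \<xi>\<bar>\<^bsup>l+1\<^esup>\<close>.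
\<close>

lemma fourier_vanishing:
  fixes f :: "'a::euclidean_space \<Rightarrow> complex"
  assumes f: "f \<in> schwartz_vanishing l" and l: "l \<le> 1"
  shows "\<exists>C\<ge>0. \<forall>\<xi>. norm (fourier f \<xi>) \<le> C * norm \<xi> ^ Suc l"
proof -
  have fs: "f \<in> schwartz" using f by (rule schwartz_vanishing_schwartz)
  have [measurable]: "f \<in> borel_measurable borel" by (rule schwartz_borel_measurable[OF fs])
  have fint: "integrable lborel f" by (rule schwartz_integrable[OF fs])
  obtain A where A: "\<And>x. norm (f x) \<le> A * decay (Suc l + Suc DIM('a)) x" using schwartz_decay[OF fs] by blast
  have mom: "integrable lborel (\<lambda>x. norm x ^ Suc l * norm (f x))"
  proof (rule integrable_if_decay_bound[of _ "Suc DIM('a)" A])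
    fix x :: 'a
    have "norm x ^ Suc l * norm (f x) \<le> (1 + norm x) ^ Suc l * (A * decay (Suc l + Suc DIM('a)) x)"
      by (intro mult_mono power_mono A) auto
    also have "\<dots> = A * decay (Suc DIM('a)) x"
      using power_mult_decay_add[of x "Suc l" "Suc DIM('a)"] by (simp add: mult.left_commute)
    finally show "norm (norm x ^ Suc l * norm (f x)) \<le> A * decay (Suc DIM('a)) x" by simp
  qed auto
  define C where "C = (2 * pi) ^ Suc l * (LINT x|lborel. norm x ^ Suc l * norm (f x))"
  have "norm (fourier f \<xi>) \<le> C * norm \<xi> ^ Suc l" for \<xi>
  proof -
    define \<theta> where "\<theta> x = - (2 * pi * (x \<bullet> \<xi>))" for x
    have [measurable]: "\<theta> \<in> borel_measurable borel" unfolding \<theta>_def by measurable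
    define T where "T x = (\<Sum>k\<le>l. (\<i> * \<theta> x) ^ k / fact k)" for x
    have "has_bochner_integral lborel (\<lambda>x. \<Sum>k\<le>l. ((- 2 * pi * \<i>) ^ k / fact k) * (of_real ((x \<bullet> \<xi>) ^ k) * f x))
        (\<Sum>k\<le>l. ((- 2 * pi * \<i>) ^ k / fact k) * 0)"
      using f l by (intro has_bochner_integral_sum has_bochner_integral_mult_right integral_inner_power_vanishing) auto
    moreover have "(\<Sum>k\<le>l. ((- 2 * pi * \<i>) ^ k / fact k) * (of_real ((x \<bullet> \<xi>) ^ k) * f x)) = f x * T x" for x
      unfolding T_def sum_distrib_left \<theta>_def
      by (intro sum.cong refl) (simp add: power_mult_distrib[symmetric] mult_ac)
    ultimately have T: "has_bochner_integral lborel (\<lambda>x. f x * T x) 0" by simp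
    have i1: "integrable lborel (\<lambda>x. f x * cis (\<theta> x))"
      by (rule Bochner_Integration.integrable_bound[OF fint]) (auto simp: norm_mult)
    have "fourier f \<xi> = (LINT x|lborel. f x * cis (\<theta> x)) - (LINT x|lborel. f x * T x)"
      using T by (simp add: fourier_eq \<theta>_def has_bochner_integral_iff)
    also have "\<dots> = (LINT x|lborel. f x * (cis (\<theta> x) - T x))"
      using T i1 by (simp add: has_bochner_integral_iff right_diff_distrib)
    finally have "norm (fourier f \<xi>) \<le> (LINT x|lborel. norm (f x * (cis (\<theta> x) - T x)))"
      using integral_norm_bound by metis
    also have "\<dots> \<le> (LINT x|lborel. (2 * pi) ^ Suc l * norm \<xi> ^ Suc l * (norm x ^ Suc l * norm (f x)))"
    proof (rule integral_mono)
      have "integrable lborel (\<lambda>x. f x * (cis (\<theta> x) - T x))"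
        using T i1 by (simp add: has_bochner_integral_iff right_diff_distrib)
      then show "integrable lborel (\<lambda>x. norm (f x * (cis (\<theta> x) - T x)))" by (rule integrable_norm)
      show "integrable lborel (\<lambda>x. (2 * pi) ^ Suc l * norm \<xi> ^ Suc l * (norm x ^ Suc l * norm (f x)))"
        by (intro integrable_mult_right mom)
      fix x :: 'a
      have "norm (cis (\<theta> x) - T x) \<le> \<bar>\<theta> x\<bar> ^ Suc l / fact (Suc l)"
        unfolding T_def by (rule cis_Taylor_bound)
      also have "\<dots> \<le> \<bar>\<theta> x\<bar> ^ Suc l / 1"
        by (intro divide_left_mono fact_ge_1) auto
      also have "\<dots> \<le> (2 * pi * (norm x * norm \<xi>)) ^ Suc l"
        unfolding div_by_1 \<theta>_def using Cauchy_Schwarz_ineq2[of x \<xi>]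
        by (intro power_mono) (auto simp: abs_mult)
      finally have "norm (f x) * norm (cis (\<theta> x) - T x) \<le> norm (f x) * (2 * pi * (norm x * norm \<xi>)) ^ Suc l"
        by (intro mult_left_mono) auto
      then show "norm (f x * (cis (\<theta> x) - T x)) \<le> (2 * pi) ^ Suc l * norm \<xi> ^ Suc l * (norm x ^ Suc l * norm (f x))"
        by (simp only: norm_mult power_mult_distrib mult_ac)
    qed
    also have "\<dots> = C * norm \<xi> ^ Suc l" by (simp add: C_def)
    finally show ?thesis .
  qed
  moreover have "0 \<le> C" unfolding C_def by (intro mult_nonneg_nonneg integral_nonneg_AE) auto
  ultimately show ?thesis by blast
qed

text \<open>
  The singularity of the multiplier at the origin is cancelled by the zero of order \<open>l + 1 > \<alpha>\<close> of the
  Fourier transform, and at infinity the multiplier is at most 1.  In particular the integral that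
  defines the Riesz potential converges absolutely.
\<close>

lemma riesz_multiplier_decay:
  fixes f :: "'a::euclidean_space \<Rightarrow> complex"
  assumes f: "f \<in> schwartz_vanishing l" and l: "l \<le> 1" and \<alpha>: "0 < \<alpha>" "\<alpha> < real l + 1"
  shows "\<exists>C. \<forall>\<xi>. (2 * pi * norm \<xi>) powr (- \<alpha>) * norm (fourier f \<xi>) \<le> C * decay N \<xi>"
proof -
  obtain C where C: "0 \<le> C" "\<And>\<xi>. norm (fourier f \<xi>) \<le> C * norm \<xi> ^ Suc l"
    using fourier_vanishing[OF f l] by blast
  obtain B where B: "0 \<le> B" "\<And>\<xi>. norm (fourier f \<xi>) \<le> B * decay N \<xi>"
    using fourier_decay[OF schwartz_vanishing_schwartz[OF f]] by blast
  have "(2 * pi * norm \<xi>) powr (- \<alpha>) * norm (fourier f \<xi>) \<le> (C * 2 ^ N + B) * decay N \<xi>" for \<xi>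
  proof -
    have pi2: "1 \<le> 2 * pi" using pi_ge_two by simp
    consider "\<xi> = 0" | "\<xi> \<noteq> 0" "norm \<xi> \<le> 1" | "1 \<le> norm \<xi>" by linarith
    then show ?thesis
    proof cases
      case 1
      then show ?thesis using B C by simp
    next
      case 2
      then have "(2 * pi * norm \<xi>) powr (- \<alpha>) \<le> norm \<xi> powr (- \<alpha>)"
        using \<alpha> pi2 mult_right_mono[OF pi2, of "norm \<xi>"] by (intro powr_mono2') auto
      then have "(2 * pi * norm \<xi>) powr (- \<alpha>) * norm (fourier f \<xi>) \<le> norm \<xi> powr (- \<alpha>) * (C * norm \<xi> ^ Suc l)"
        by (intro mult_mono C) auto
      also have "\<dots> = C * norm \<xi> powr (real l + 1 - \<alpha>)"
        using 2 by (simp add: powr_realpow[symmetric] powr_add[symmetric] algebra_simps del: powr_realpow power_Suc)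
      also have "\<dots> \<le> C * 1"
        using 2 \<alpha> C by (intro mult_left_mono powr_le1) auto
      also have "\<dots> \<le> C * (2 ^ N * decay N \<xi>)"
      proof (intro mult_left_mono C)
        have "(1 + norm \<xi>) ^ N * decay N \<xi> \<le> 2 ^ N * decay N \<xi>"
          using 2 by (intro mult_right_mono power_mono) auto
        then show "1 \<le> 2 ^ N * decay N \<xi>" by (simp add: power_mult_decay)
      qed
      finally show ?thesis using B by (simp add: distrib_right add_increasing2)
    next
      case 3
      then have "1 \<le> 2 * pi * norm \<xi>"
        using mult_mono[OF pi2 3] by simp
      then have "(2 * pi * norm \<xi>) powr (- \<alpha>) \<le> 1"
        using \<alpha> by (simp add: powr_minus inverse_le_1_iff ge_one_powr_ge_zero)
      then have "(2 * pi * norm \<xi>) powr (- \<alpha>) * norm (fourier f \<xi>) \<le> 1 * (B * decay N \<xi>)"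
        by (intro mult_mono B) auto
      then show ?thesis using C by (simp add: distrib_right add_increasing)
    qed
  qed
  then show ?thesis by blast
qed

section \<open>Riesz potentials as superpositions of heat kernels\<close>

text \<open>
  Euler's integral with the variable scaled by \<open>a\<close>: it expresses the power \<open>a\<^bsup>-s\<^esup>\<close> as a superposition
  of exponentials, and turns into a superposition of Gaussians for \<open>a = 4\<pi>\<^sup>2\<bar>\<xi>\<bar>\<^sup>2\<close>.
\<close>

lemma has_bochner_integral_Gamma:
  fixes a s :: real
  assumes "0 < a" "0 < s"
  shows "has_bochner_integral lborel (\<lambda>t. indicator {0<..} t * t powr (s - 1) * exp (- (a * t))) (Gamma s * a powr (- s))"
proof (rule has_bochner_integral_nn_integral)
  have "ennreal (Gamma s) = (\<integral>\<^sup>+t. ennreal (indicator {0..} t * t powr (s - 1) / exp t) \<partial>lborel)"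
    by (rule Gamma_conv_nn_integral_real[OF assms(2)])
  also have "\<dots> = ennreal \<bar>a\<bar> * (\<integral>\<^sup>+t. ennreal (indicator {0..} (0 + a * t) * (0 + a * t) powr (s - 1) / exp (0 + a * t)) \<partial>lborel)"
    using assms by (intro nn_integral_real_affine) auto
  also have "\<dots> = ennreal a * (\<integral>\<^sup>+t. ennreal (a powr (s - 1)) * ennreal (indicator {0<..} t * t powr (s - 1) * exp (- (a * t))) \<partial>lborel)"
  proof (intro arg_cong2[where f = "(*)"] nn_integral_cong)
    show "ennreal \<bar>a\<bar> = ennreal a" using assms by simp
    fix t
    show "ennreal (indicator {0..} (0 + a * t) * (0 + a * t) powr (s - 1) / exp (0 + a * t))
        = ennreal (a powr (s - 1)) * ennreal (indicator {0<..} t * t powr (s - 1) * exp (- (a * t)))"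
    proof (cases "0 < t")
      case True
      then show ?thesis
        using assms by (simp add: ennreal_mult'[symmetric] powr_mult exp_minus divide_inverse mult_ac)
    next
      case False
      then show ?thesis
        using assms by (cases "t = 0") (auto simp: zero_le_mult_iff)
    qed
  qed
  also have "\<dots> = ennreal a * (ennreal (a powr (s - 1)) * (\<integral>\<^sup>+t. ennreal (indicator {0<..} t * t powr (s - 1) * exp (- (a * t))) \<partial>lborel))"
    by (subst nn_integral_cmult) auto
  also have "\<dots> = ennreal (a powr s) * (\<integral>\<^sup>+t. ennreal (indicator {0<..} t * t powr (s - 1) * exp (- (a * t))) \<partial>lborel)"
  proof -
    have "a * a powr (s - 1) = a powr s"
      using assms powr_mult_base[of a "s - 1"] by simp
    then show ?thesis
      using assms by (simp add: mult.assoc[symmetric] ennreal_mult'[symmetric])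
  qed
  finally have eq: "ennreal (Gamma s) = ennreal (a powr s) * (\<integral>\<^sup>+t. ennreal (indicator {0<..} t * t powr (s - 1) * exp (- (a * t))) \<partial>lborel)" .
  have "ennreal (a powr (- s)) * ennreal (a powr s) = 1"
    using assms by (simp add: ennreal_mult'[symmetric] powr_add[symmetric])
  then have "(\<integral>\<^sup>+t. ennreal (indicator {0<..} t * t powr (s - 1) * exp (- (a * t))) \<partial>lborel)
      = ennreal (a powr (- s)) * ennreal (Gamma s)"
    unfolding eq mult.assoc[symmetric] by simp
  then show "(\<integral>\<^sup>+t. ennreal (indicator {0<..} t * t powr (s - 1) * exp (- (a * t))) \<partial>lborel) = ennreal (Gamma s * a powr (- s))"
    using Gamma_real_pos[OF assms(2)] by (simp add: ennreal_mult mult.commute)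
  show "0 \<le> Gamma s * a powr (- s)" using Gamma_real_pos[OF assms(2)] by simp
qed auto

text \<open>
  This is the characteristic function of the standard normal distribution after a change of scale.
\<close>

lemma has_bochner_integral_gaussian_cis_1d:
  assumes t: "0 < t"
  shows "has_bochner_integral lborel (\<lambda>x. of_real (exp (- (4 * pi\<^sup>2 * t * x\<^sup>2))) * cis (2 * pi * z * x))
    (of_real ((4 * pi * t) powr (- 1 / 2) * exp (- z\<^sup>2 / (4 * t))))"
proof -
  define \<sigma> where "\<sigma> = sqrt (8 * pi\<^sup>2 * t)"
  have \<sigma>: "0 < \<sigma>" "\<sigma>\<^sup>2 = 8 * pi\<^sup>2 * t" using t by (simp_all add: \<sigma>_def)
  define u where "u = 2 * pi * z / \<sigma>"
  define g where "g x = of_real (std_normal_density x) * cis (u * x)" for x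
  have [measurable]: "g \<in> borel_measurable borel" unfolding g_def by measurable
  have g: "integrable lborel g"
    by (rule Bochner_Integration.integrable_bound[of lborel std_normal_density])
       (auto simp: g_def norm_mult)
  have "char std_normal_distribution u = (LINT x|lborel. std_normal_density x *\<^sub>R cis (u * x))"
    unfolding char_def cis_conv_exp[symmetric] by (rule integral_density) auto
  then have g1: "(LINT x|lborel. g x) = of_real (exp (- u\<^sup>2 / 2))"
    by (simp add: char_std_normal_distribution g_def scaleR_conv_of_real)
  have "(LINT x|lborel. g x) = \<bar>\<sigma>\<bar> *\<^sub>R (LINT x|lborel. g (0 + \<sigma> * x))"
    by (rule lborel_integral_real_affine) (use \<sigma> in simp)
  moreover have "integrable lborel (\<lambda>x. g (0 + \<sigma> * x))"
    by (rule lborel_integrable_real_affine[OF g]) (use \<sigma> in simp)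
  ultimately have g2: "has_bochner_integral lborel (\<lambda>x. of_real (sqrt (2 * pi)) * g (\<sigma> * x))
      (of_real (sqrt (2 * pi)) * (of_real (exp (- u\<^sup>2 / 2)) / of_real \<sigma>))"
    using \<sigma> by (intro has_bochner_integral_mult_right) (simp add: has_bochner_integral_iff g1 scaleR_conv_of_real)
  have "of_real (sqrt (2 * pi)) * g (\<sigma> * x) = of_real (exp (- (4 * pi\<^sup>2 * t * x\<^sup>2))) * cis (2 * pi * z * x)" for x
  proof -
    have "sqrt (2 * pi) * std_normal_density (\<sigma> * x) = exp (- (4 * pi\<^sup>2 * t * x\<^sup>2))"
      by (simp add: std_normal_density_def power_mult_distrib \<sigma>(2))
    moreover have "u * (\<sigma> * x) = 2 * pi * z * x" using \<sigma>(1) by (simp add: u_def)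
    ultimately show ?thesis
      unfolding g_def by (simp only: mult.assoc[symmetric] of_real_mult[symmetric])
  qed
  moreover have "sqrt (2 * pi) * (exp (- u\<^sup>2 / 2) / \<sigma>) = (4 * pi * t) powr (- 1 / 2) * exp (- z\<^sup>2 / (4 * t))"
  proof -
    have "u\<^sup>2 = z\<^sup>2 / (2 * t)"
      using t by (simp add: u_def power_divide power_mult_distrib \<sigma>(2) field_simps)
    then have "exp (- u\<^sup>2 / 2) = exp (- z\<^sup>2 / (4 * t))" by simp
    moreover have "sqrt (2 * pi) / \<sigma> = (4 * pi * t) powr (- 1 / 2)"
    proof -
      have "sqrt (2 * pi) / \<sigma> = sqrt (1 / (4 * pi * t))"
        unfolding \<sigma>_def real_sqrt_divide[symmetric] using t by (intro arg_cong[of _ _ sqrt]) (simp add: field_simps power2_eq_square)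
      also have "\<dots> = 1 / (4 * pi * t) powr (1 / 2)"
        using t by (simp add: real_sqrt_divide powr_half_sqrt)
      finally show ?thesis using t by (simp add: powr_minus_divide)
    qed
    moreover have "sqrt (2 * pi) * (exp (- u\<^sup>2 / 2) / \<sigma>) = sqrt (2 * pi) / \<sigma> * exp (- u\<^sup>2 / 2)"
      by simp
    ultimately show ?thesis by (simp only:)
  qed
  ultimately show ?thesis
    using g2 by (simp only: flip: of_real_mult of_real_divide)
qed

lemma has_bochner_integral_prod_Basis:
  fixes f :: "'a::euclidean_space \<Rightarrow> real \<Rightarrow> complex"
  assumes f: "\<And>i. i \<in> Basis \<Longrightarrow> has_bochner_integral lborel (f i) (c i)"
  shows "has_bochner_integral lborel (\<lambda>x::'a. \<Prod>i\<in>Basis. f i (x \<bullet> i)) (\<Prod>i\<in>Basis. c i)"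
proof -
  interpret product_sigma_finite "\<lambda>_::'a. lborel :: real measure" by standard
  let ?P = "\<Pi>\<^sub>M i\<in>(Basis::'a set). (lborel :: real measure)"
  let ?T = "\<lambda>g. \<Sum>b\<in>Basis. g b *\<^sub>R (b::'a)"
  have int: "integrable lborel (f i)" "integral\<^sup>L lborel (f i) = c i" if "i \<in> Basis" for i
    using f[OF that] by (simp_all add: has_bochner_integral_iff)
  have [measurable]: "(\<lambda>x::'a. \<Prod>i\<in>Basis. f i (x \<bullet> i)) \<in> borel_measurable borel"
    using int(1) by (intro borel_measurable_prod) (auto intro: measurable_compose dest!: borel_measurable_integrable)
  have T [measurable]: "?T \<in> measurable ?P borel" by measurable
  have eq: "(\<Prod>i\<in>Basis. f i (?T g \<bullet> i)) = (\<Prod>i\<in>Basis. f i (g i))" for g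
    by (intro prod.cong) auto
  have "integrable ?P (\<lambda>g. \<Prod>i\<in>Basis. f i (g i))"
    using int by (intro product_integrable_prod) auto
  then have "integrable (distr ?P borel ?T) (\<lambda>x. \<Prod>i\<in>Basis. f i (x \<bullet> i))"
    by (subst integrable_distr_eq) (simp_all add: eq)
  moreover have "(LINT x|(distr ?P borel ?T). (\<Prod>i\<in>Basis. f i (x \<bullet> i))) = (\<Prod>i\<in>Basis. c i)"
    using int by (subst integral_distr) (simp_all add: eq product_integral_prod)
  ultimately show ?thesis
    by (simp add: has_bochner_integral_iff lborel_eq[symmetric])
qed

text \<open>
  The fundamental solution of the heat equation with generator \<open>\<Delta>\<close>; its Fourier transform is
  \<open>e\<^bsup>-4\<pi>\<^sup>2 t \<bar>\<xi>\<bar>\<^sup>2\<^esup>\<close>.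
\<close>

definition heat_kernel :: "real \<Rightarrow> 'a::euclidean_space \<Rightarrow> real" where
  "heat_kernel t x = (4 * pi * t) powr (- (DIM('a) / 2)) * exp (- (norm x)\<^sup>2 / (4 * t))"

lemma heat_kernel_borel_measurable [measurable]:
  "(\<lambda>(t, x). heat_kernel t x) \<in> borel_measurable (borel \<Otimes>\<^sub>M borel)"
  unfolding heat_kernel_def by measurable

lemma prod_cis: "(\<Prod>i\<in>A. cis (f i)) = cis (\<Sum>i\<in>A. f i)"
  by (induction A rule: infinite_finite_induct) (auto simp: cis_mult)

lemma norm_power2_eq_sum: "(norm (x::'a::euclidean_space))\<^sup>2 = (\<Sum>i\<in>Basis. (x \<bullet> i)\<^sup>2)"
  unfolding power2_norm_eq_inner by (subst euclidean_inner) (simp add: power2_eq_square)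

text \<open>
  Everything factors over the coordinates.
\<close>

lemma has_bochner_integral_gaussian_cis:
  fixes z :: "'a::euclidean_space"
  assumes t: "0 < t"
  shows "has_bochner_integral lborel (\<lambda>\<xi>. of_real (exp (- (4 * pi\<^sup>2 * t * (norm \<xi>)\<^sup>2))) * cis (2 * pi * (z \<bullet> \<xi>)))
    (of_real (heat_kernel t z))"
proof -
  have "has_bochner_integral lborel
     (\<lambda>\<xi>::'a. \<Prod>i\<in>Basis. of_real (exp (- (4 * pi\<^sup>2 * t * (\<xi> \<bullet> i)\<^sup>2))) * cis (2 * pi * (z \<bullet> i) * (\<xi> \<bullet> i)))
     (\<Prod>i\<in>(Basis::'a set). of_real ((4 * pi * t) powr (- 1 / 2) * exp (- (z \<bullet> i)\<^sup>2 / (4 * t))))"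
    by (intro has_bochner_integral_prod_Basis has_bochner_integral_gaussian_cis_1d t)
  moreover have "(\<Prod>i\<in>Basis. of_real (exp (- (4 * pi\<^sup>2 * t * (\<xi> \<bullet> i)\<^sup>2))) * cis (2 * pi * (z \<bullet> i) * (\<xi> \<bullet> i)))
      = of_real (exp (- (4 * pi\<^sup>2 * t * (norm \<xi>)\<^sup>2))) * cis (2 * pi * (z \<bullet> \<xi>))" for \<xi> :: 'a
  proof -
    have "(\<Prod>i\<in>Basis. exp (- (4 * pi\<^sup>2 * t * (\<xi> \<bullet> i)\<^sup>2))) = exp (- (4 * pi\<^sup>2 * t * (norm \<xi>)\<^sup>2))"
      by (simp add: exp_sum[symmetric] norm_power2_eq_sum sum_distrib_left sum_negf)
    moreover have "(\<Prod>i\<in>Basis. cis (2 * pi * (z \<bullet> i) * (\<xi> \<bullet> i))) = cis (2 * pi * (z \<bullet> \<xi>))"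
      by (simp add: prod_cis euclidean_inner[of z \<xi>] sum_distrib_left mult.assoc)
    ultimately show ?thesis by (simp add: prod.distrib flip: of_real_prod)
  qed
  moreover have "(\<Prod>i\<in>(Basis::'a set). (4 * pi * t) powr (- 1 / 2) * exp (- (z \<bullet> i)\<^sup>2 / (4 * t))) = heat_kernel t z"
  proof -
    have "(\<Prod>i\<in>(Basis::'a set). exp (- (z \<bullet> i)\<^sup>2 / (4 * t))) = exp (- (norm z)\<^sup>2 / (4 * t))"
      by (simp add: exp_sum[symmetric] norm_power2_eq_sum sum_divide_distrib sum_negf)
    moreover have "((4 * pi * t) powr (- 1 / 2)) ^ DIM('a) = (4 * pi * t) powr (- (DIM('a) / 2))"
      using t by (simp add: powr_realpow[symmetric] powr_powr)
    ultimately show ?thesis by (simp add: prod.distrib heat_kernel_def)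
  qed
  ultimately show ?thesis by (simp only: flip: of_real_prod)
qed

lemma fourier_borel_measurable [measurable]:
  fixes f :: "'a::euclidean_space \<Rightarrow> complex"
  assumes [measurable]: "f \<in> borel_measurable borel"
  shows "fourier f \<in> borel_measurable borel"
  unfolding fourier_eq[OF assms] by measurable

text \<open>
  The Gaussian factor makes the double integral over \<open>\<xi>\<close> and \<open>y\<close> absolutely convergent, so that the
  Fourier transform of the Gaussian alone identifies this integral as a convolution, without any
  appeal to Fourier inversion for \<open>f\<close>.
\<close>

lemma gaussian_inverse_fourier:
  fixes f :: "'a::euclidean_space \<Rightarrow> complex"
  assumes f: "f \<in> schwartz" and t: "0 < t"
  shows "(LINT \<xi>|lborel. of_real (exp (- (4 * pi\<^sup>2 * t * (norm \<xi>)\<^sup>2))) * fourier f \<xi> * cis (2 * pi * (x \<bullet> \<xi>)))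
    = (LINT y|lborel. of_real (heat_kernel t (x - y)) * f y)"
proof -
  have fm [measurable]: "f \<in> borel_measurable borel" by (rule schwartz_borel_measurable[OF f])
  have fint: "integrable lborel f" by (rule schwartz_integrable[OF f])
  let ?E = "\<lambda>\<xi>::'a. exp (- (4 * pi\<^sup>2 * t * (norm \<xi>)\<^sup>2))"
  have Eint: "integrable lborel ?E"
  proof -
    have "integrable lborel (\<lambda>\<xi>::'a. of_real (?E \<xi>) * cis (2 * pi * (0 \<bullet> \<xi>)))"
      using has_bochner_integral_gaussian_cis[OF t, of "0::'a"] by (simp only: has_bochner_integral_iff)
    from integrable_norm[OF this] show ?thesis by (simp add: norm_mult)
  qed
  define H where "H \<xi> y = of_real (?E \<xi>) * (f y * cis (2 * pi * ((x - y) \<bullet> \<xi>)))" for \<xi> y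
  have [measurable]: "case_prod H \<in> borel_measurable (lborel \<Otimes>\<^sub>M lborel)"
    unfolding H_def by measurable
  have int: "integrable (lborel \<Otimes>\<^sub>M lborel) (case_prod H)"
  proof (rule lborel_pair.Fubini_integrable)
    show "integrable lborel (\<lambda>\<xi>. LINT y|lborel. norm (case (\<xi>, y) of (\<xi>, y) \<Rightarrow> H \<xi> y))"
      using Eint by (simp add: H_def norm_mult)
    show "AE \<xi> in lborel. integrable lborel (\<lambda>y. case (\<xi>, y) of (\<xi>, y) \<Rightarrow> H \<xi> y)"
      unfolding prod.case H_def
      by (intro AE_I2 integrable_mult_right Bochner_Integration.integrable_bound[OF fint]) (auto simp: norm_mult)
  qed simp
  have "of_real (?E \<xi>) * fourier f \<xi> * cis (2 * pi * (x \<bullet> \<xi>)) = (LINT y|lborel. H \<xi> y)" for \<xi>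
  proof -
    have "cis (2 * pi * ((x - y) \<bullet> \<xi>)) = cis (- (2 * pi * (y \<bullet> \<xi>))) * cis (2 * pi * (x \<bullet> \<xi>))" for y
      by (simp add: cis_mult inner_diff_left right_diff_distrib)
    then have "H \<xi> y = of_real (?E \<xi>) * ((f y * cis (- (2 * pi * (y \<bullet> \<xi>)))) * cis (2 * pi * (x \<bullet> \<xi>)))" for y
      by (simp add: H_def mult_ac)
    then have "(LINT y|lborel. H \<xi> y) = of_real (?E \<xi>) * (fourier f \<xi> * cis (2 * pi * (x \<bullet> \<xi>)))"
      by (simp only: integral_mult_right_zero integral_mult_left_zero fourier_eq[OF fm])
    then show ?thesis by (simp only: mult.assoc)
  qed
  then have "(LINT \<xi>|lborel. of_real (?E \<xi>) * fourier f \<xi> * cis (2 * pi * (x \<bullet> \<xi>))) = (LINT \<xi>|lborel. LINT y|lborel. H \<xi> y)"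
    by simp
  also have "\<dots> = (LINT y|lborel. LINT \<xi>|lborel. H \<xi> y)"
    by (rule lborel_pair.Fubini_integral[OF int, symmetric])
  also have "\<dots> = (LINT y|lborel. of_real (heat_kernel t (x - y)) * f y)"
  proof (intro Bochner_Integration.integral_cong refl)
    fix y
    have "(LINT \<xi>|lborel. H \<xi> y) = (LINT \<xi>|lborel. f y * (of_real (?E \<xi>) * cis (2 * pi * ((x - y) \<bullet> \<xi>))))"
      by (simp add: H_def mult.left_commute)
    also have "\<dots> = f y * of_real (heat_kernel t (x - y))"
      using has_bochner_integral_gaussian_cis[OF t, of "x - y"] by (simp add: has_bochner_integral_iff)
    finally show "(LINT \<xi>|lborel. H \<xi> y) = of_real (heat_kernel t (x - y)) * f y" by simp
  qed
  finally show ?thesis .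
qed

text \<open>
  Since \<open>(2\<pi>\<bar>\<xi>\<bar>)\<^bsup>-\<alpha>\<^esup> = \<Gamma>(\<alpha>/2)\<^bsup>-1\<^esup> \<integral>\<^sub>0\<^sup>\<infinity> t\<^bsup>\<alpha>/2-1\<^esup> e\<^bsup>-4\<pi>\<^sup>2 t \<bar>\<xi>\<bar>\<^sup>2\<^esup> dt\<close>, the Riesz potential is a superposition
  over \<open>t\<close> of convolutions with heat kernels.  The double integral over \<open>\<xi>\<close> and \<open>t\<close> converges absolutely
  because the multiplier times the Fourier transform is integrable.  The formula holds for all
  \<open>0 < \<alpha> < l + 1\<close> in every dimension, whereas the kernel \<open>\<bar>x\<bar>\<^bsup>\<alpha>-d\<^esup>\<close> would require \<open>\<alpha> < d\<close>.
\<close>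

lemma riesz_potential_heat_kernel:
  fixes f :: "'a::euclidean_space \<Rightarrow> complex"
  assumes f: "f \<in> schwartz_vanishing l" and l: "l \<le> 1" and \<alpha>: "0 < \<alpha>" "\<alpha> < real l + 1"
  shows "of_real (Gamma (\<alpha> / 2)) * riesz_potential \<alpha> f x
    = (LINT t|lborel. of_real (indicator {0<..} t * t powr (\<alpha> / 2 - 1)) * (LINT y|lborel. of_real (heat_kernel t (x - y)) * f y))"
proof -
  have fs: "f \<in> schwartz" by (rule schwartz_vanishing_schwartz[OF f])
  have [measurable]: "f \<in> borel_measurable borel" by (rule schwartz_borel_measurable[OF fs])
  obtain C where C: "\<And>\<xi>. (2 * pi * norm \<xi>) powr (- \<alpha>) * norm (fourier f \<xi>) \<le> C * decay (Suc DIM('a)) \<xi>"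
    using riesz_multiplier_decay[OF f l \<alpha>] by blast
  \<comment> \<open>at \<open>\<xi> = 0\<close> the superposition formula for the multiplier fails, but the Fourier transform vanishes\<close>
  have f0: "fourier f 0 = 0"
  proof -
    obtain K where "norm (fourier f 0) \<le> K * norm (0::'a) ^ Suc l"
      using fourier_vanishing[OF f l] by blast
    then show ?thesis by simp
  qed
  define k where "k \<xi> t = indicator {0<..} t * t powr (\<alpha> / 2 - 1) * exp (- (4 * pi\<^sup>2 * (norm \<xi>)\<^sup>2 * t))" for \<xi> :: 'a and t :: real
  define m where "m \<xi> = (2 * pi * norm \<xi>) powr (- \<alpha>)" for \<xi> :: 'a
  have k_nonneg: "0 \<le> k \<xi> t" for \<xi> t by (simp add: k_def)
  have k: "has_bochner_integral lborel (k \<xi>) (Gamma (\<alpha> / 2) * m \<xi>)" if "\<xi> \<noteq> 0" for \<xi>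
  proof -
    have "(4 * pi\<^sup>2 * (norm \<xi>)\<^sup>2) powr (- (\<alpha> / 2)) = ((2 * pi * norm \<xi>) powr 2) powr (- (\<alpha> / 2))"
      using that by (simp add: power_mult_distrib)
    also have "\<dots> = m \<xi>" by (simp only: powr_powr m_def) simp
    finally show ?thesis
      using has_bochner_integral_Gamma[of "4 * pi\<^sup>2 * (norm \<xi>)\<^sup>2" "\<alpha> / 2"] that \<alpha> by (simp add: k_def[abs_def])
  qed
  define H where "H \<xi> t = of_real (k \<xi> t) * (fourier f \<xi> * cis (2 * pi * (x \<bullet> \<xi>)))" for \<xi> t
  have [measurable]: "case_prod H \<in> borel_measurable (lborel \<Otimes>\<^sub>M lborel)"
    unfolding H_def k_def by measurable
  have Ht: "has_bochner_integral lborel (H \<xi>) (of_real (Gamma (\<alpha> / 2) * m \<xi>) * (fourier f \<xi> * cis (2 * pi * (x \<bullet> \<xi>))))" for \<xi>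
  proof (cases "\<xi> = 0")
    case True
    then show ?thesis by (simp add: H_def[abs_def] f0 has_bochner_integral_zero)
  next
    case False
    show ?thesis
      unfolding H_def by (intro has_bochner_integral_mult_left has_bochner_integral_of_real k False)
  qed
  have mint: "integrable lborel (\<lambda>\<xi>. m \<xi> * norm (fourier f \<xi>))"
    by (rule integrable_if_decay_bound[of _ "Suc DIM('a)" C]) (use C in \<open>auto simp: m_def\<close>)
  have int: "integrable (lborel \<Otimes>\<^sub>M lborel) (case_prod H)"
  proof (rule lborel_pair.Fubini_integrable)
    have "(LINT t|lborel. norm (H \<xi> t)) = Gamma (\<alpha> / 2) * (m \<xi> * norm (fourier f \<xi>))" for \<xi>
    proof (cases "\<xi> = 0")
      case True
      then show ?thesis by (simp add: H_def f0)
    next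
      case False
      have "(LINT t|lborel. norm (H \<xi> t)) = (LINT t|lborel. k \<xi> t * norm (fourier f \<xi>))"
        by (simp add: H_def norm_mult k_nonneg)
      then show ?thesis using k[OF False] by (simp add: has_bochner_integral_iff)
    qed
    then show "integrable lborel (\<lambda>\<xi>. LINT t|lborel. norm (case (\<xi>, t) of (\<xi>, t) \<Rightarrow> H \<xi> t))"
      using mint by simp
    show "AE \<xi> in lborel. integrable lborel (\<lambda>t. case (\<xi>, t) of (\<xi>, t) \<Rightarrow> H \<xi> t)"
      using Ht by (simp add: has_bochner_integral_iff)
  qed simp
  have "riesz_potential \<alpha> f x = (LINT \<xi>|lborel. of_real (m \<xi>) * fourier f \<xi> * exp (2 * of_real pi * \<i> * of_real (x \<bullet> \<xi>)))"
    unfolding riesz_potential_def inverse_fourier_def m_def by (intro integral_completion) measurable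
  also have "\<dots> = (LINT \<xi>|lborel. of_real (m \<xi>) * (fourier f \<xi> * cis (2 * pi * (x \<bullet> \<xi>))))"
    by (simp add: cis_conv_exp mult_ac)
  finally have "of_real (Gamma (\<alpha> / 2)) * riesz_potential \<alpha> f x
      = (LINT \<xi>|lborel. of_real (Gamma (\<alpha> / 2) * m \<xi>) * (fourier f \<xi> * cis (2 * pi * (x \<bullet> \<xi>))))"
    by (simp add: mult.assoc)
  also have "\<dots> = (LINT \<xi>|lborel. LINT t|lborel. H \<xi> t)"
    using Ht by (simp add: has_bochner_integral_iff)
  also have "\<dots> = (LINT t|lborel. LINT \<xi>|lborel. H \<xi> t)"
    by (rule lborel_pair.Fubini_integral[OF int, symmetric])
  also have "\<dots> = (LINT t|lborel. of_real (indicator {0<..} t * t powr (\<alpha> / 2 - 1)) * (LINT y|lborel. of_real (heat_kernel t (x - y)) * f y))"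
  proof (intro Bochner_Integration.integral_cong refl)
    fix t :: real
    show "(LINT \<xi>|lborel. H \<xi> t) = of_real (indicator {0<..} t * t powr (\<alpha> / 2 - 1)) * (LINT y|lborel. of_real (heat_kernel t (x - y)) * f y)"
    proof (cases "0 < t")
      case True
      have "(LINT \<xi>|lborel. H \<xi> t) = (LINT \<xi>|lborel. of_real (indicator {0<..} t * t powr (\<alpha> / 2 - 1)) *
          (of_real (exp (- (4 * pi\<^sup>2 * t * (norm \<xi>)\<^sup>2))) * fourier f \<xi> * cis (2 * pi * (x \<bullet> \<xi>))))"
        by (simp add: H_def k_def mult_ac)
      then show ?thesis by (simp only: integral_mult_right_zero gaussian_inverse_fourier[OF fs True])
    next
      case False
      then show ?thesis by (simp add: H_def k_def)
    qed
  qed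
  finally show ?thesis .
qed

section \<open>The heat kernel corrected at large times\<close>

lemma power_le_fact_mult_exp:
  fixes x :: real
  assumes "0 \<le> x"
  shows "x ^ n \<le> fact n * exp x"
proof -
  have "(\<Sum>k\<in>{n}. x ^ k /\<^sub>R fact k) \<le> (\<Sum>k. x ^ k /\<^sub>R fact k)"
    by (rule sum_le_suminf) (use assms in \<open>auto simp: summable_exp\<close>)
  then have "x ^ n /\<^sub>R fact n \<le> exp x" by (simp add: exp_def)
  then show ?thesis by (simp add: field_simps)
qed

text \<open>
  The factor \<open>1 + \<bar>v\<bar>\<^sup>2\<close> leaves room for the polynomials that appear in the first two derivatives of the
  Gaussian.
\<close>

lemma gaussian_decay:
  "\<exists>C\<ge>0. \<forall>v::'a::real_normed_vector. (1 + (norm v)\<^sup>2) * exp (- (norm v)\<^sup>2 / 4) \<le> C * decay N v"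
proof (intro exI conjI allI)
  show "0 \<le> fact (N + 2) * exp (2::real)" by simp
  fix v :: 'a
  define r where "r = norm v"
  have r: "0 \<le> r" by (simp add: r_def)
  have "(1 + r) ^ N * (1 + r\<^sup>2) \<le> (1 + r) ^ N * (1 + r)\<^sup>2"
    using r by (intro mult_left_mono) (auto simp: power2_sum)
  also have "\<dots> = (1 + r) ^ (N + 2)" by (simp only: power_add)
  also have "\<dots> \<le> fact (N + 2) * exp (1 + r)"
    by (rule power_le_fact_mult_exp) (use r in simp)
  finally have 1: "(1 + r) ^ N * (1 + r\<^sup>2) \<le> fact (N + 2) * exp (1 + r)" .
  have "r - 1 \<le> r\<^sup>2 / 4"
    using zero_le_power2[of "r / 2 - 1"] by (simp add: power2_eq_square algebra_simps)
  then have 2: "exp (- r\<^sup>2 / 4) \<le> exp (1 - r)" by simp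
  have "((1 + r) ^ N * (1 + r\<^sup>2)) * exp (- r\<^sup>2 / 4) \<le> (fact (N + 2) * exp (1 + r)) * exp (1 - r)"
    by (rule mult_mono[OF 1 2]) (use r in auto)
  also have "\<dots> = fact (N + 2) * exp 2" by (simp add: mult.assoc exp_add[symmetric])
  finally show "(1 + (norm v)\<^sup>2) * exp (- (norm v)\<^sup>2 / 4) \<le> fact (N + 2) * exp 2 * decay N v"
    unfolding le_decay_iff r_def by (simp add: mult.assoc)
qed

text \<open>
  Taylor's formula of order \<open>l + 1\<close> along the segment from \<open>z\<close> to \<open>z - w\<close>, followed by Peetre's
  inequality to replace the intermediate point by \<open>z\<close>.
\<close>

lemma gaussian_Taylor_bound:
  assumes l: "l \<le> 1"
  shows "\<exists>C\<ge>0. \<forall>z w :: 'a::euclidean_space.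
    \<bar>exp (- (norm (z - w))\<^sup>2 / 4) - exp (- (norm z)\<^sup>2 / 4) * (1 + real l * ((z \<bullet> w) / 2))\<bar>
      \<le> C * norm w ^ Suc l * (1 + norm w) ^ N * decay N z"
proof -
  obtain C where C0: "0 \<le> C" and C: "\<And>v::'a. (1 + (norm v)\<^sup>2) * exp (- (norm v)\<^sup>2 / 4) \<le> C * decay N v"
    using gaussian_decay[of N, where 'a='a] by blast
  have "\<bar>exp (- (norm (z - w))\<^sup>2 / 4) - exp (- (norm z)\<^sup>2 / 4) * (1 + real l * ((z \<bullet> w) / 2))\<bar>
      \<le> C * norm w ^ Suc l * (1 + norm w) ^ N * decay N z" for z w :: 'a
  proof -
    define v where "v s = z - s *\<^sub>R w" for s
    define E where "E s = exp (- (norm (v s))\<^sup>2 / 4)" for s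
    define D where "D m s = (if m = 0 then E s else if m = 1 then (w \<bullet> v s) / 2 * E s
        else (((w \<bullet> v s) / 2)\<^sup>2 - (norm w)\<^sup>2 / 2) * E s)" for m :: nat and s
    have E': "(E has_real_derivative (w \<bullet> v s) / 2 * E s) (at s)" for s
    proof -
      have "E = (\<lambda>s. exp (- (z \<bullet> z - 2 * s * (z \<bullet> w) + s\<^sup>2 * (w \<bullet> w)) / 4))"
        unfolding E_def v_def power2_norm_eq_inner
        by (intro ext arg_cong[of _ _ exp]) (simp add: algebra_simps inner_commute power2_eq_square)
      moreover have "w \<bullet> v s = z \<bullet> w - s * (w \<bullet> w)"
        by (simp add: v_def algebra_simps inner_commute)
      ultimately show ?thesis
        by (simp only:) (auto intro!: derivative_eq_intros simp: field_simps)
    qed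
    have D': "(D m has_real_derivative D (Suc m) s) (at s)" if "m \<le> 1" for m s
    proof (cases "m = 0")
      case True
      then show ?thesis using E' by (simp add: D_def[abs_def])
    next
      case False
      with that have "m = 1" by simp
      have "((\<lambda>s. (w \<bullet> v s) / 2) has_real_derivative - (norm w)\<^sup>2 / 2) (at s)"
        unfolding v_def power2_norm_eq_inner inner_diff_right inner_scaleR_right
        by (auto intro!: derivative_eq_intros)
      from DERIV_mult[OF this E'] show ?thesis
        unfolding \<open>m = 1\<close> D_def by (simp add: power2_eq_square algebra_simps)
    qed
    have "\<exists>t>0. t < 1 \<and> E 1 = (\<Sum>m<Suc l. D m 0 / fact m * 1 ^ m) + D (Suc l) t / fact (Suc l) * 1 ^ Suc l"
      by (rule Maclaurin) (use l D' in \<open>auto simp: D_def[abs_def]\<close>)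
    then obtain t where t: "0 < t" "t < 1" and eq: "E 1 = (\<Sum>m<Suc l. D m 0 / fact m) + D (Suc l) t / fact (Suc l)"
      by auto
    have "(\<Sum>m<Suc l. D m 0 / fact m) = exp (- (norm z)\<^sup>2 / 4) * (1 + real l * ((z \<bullet> w) / 2))"
      using l by (cases "l = 0") (auto simp: D_def E_def v_def inner_commute algebra_simps le_Suc_eq)
    with eq have "exp (- (norm (z - w))\<^sup>2 / 4) - exp (- (norm z)\<^sup>2 / 4) * (1 + real l * ((z \<bullet> w) / 2)) = D (Suc l) t / fact (Suc l)"
      by (simp add: E_def v_def)
    moreover have "\<bar>D (Suc l) t / fact (Suc l)\<bar> \<le> norm w ^ Suc l * ((1 + (norm (v t))\<^sup>2) * E t)"
    proof -
      have wv: "\<bar>w \<bullet> v t\<bar> \<le> norm w * norm (v t)" by (rule Cauchy_Schwarz_ineq2)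
      have E0: "0 \<le> E t" by (simp add: E_def)
      have "\<bar>D (Suc l) t\<bar> \<le> norm w ^ Suc l * ((1 + (norm (v t))\<^sup>2) * E t)"
      proof (cases "l = 0")
        case True
        have "2 * norm (v t) \<le> 1 + (norm (v t))\<^sup>2"
          using zero_le_power2[of "norm (v t) - 1"] by (simp add: power2_eq_square algebra_simps)
        then have "norm (v t) \<le> 1 + (norm (v t))\<^sup>2" by (smt (verit) norm_ge_zero)
        then have "\<bar>w \<bullet> v t\<bar> / 2 * E t \<le> norm w * (1 + (norm (v t))\<^sup>2) * E t"
          using wv mult_left_mono[of "norm (v t)" "1 + (norm (v t))\<^sup>2" "norm w"] E0
          by (intro mult_right_mono) auto
        then show ?thesis using True E0 by (simp add: D_def abs_mult mult.assoc)
      next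
        case False
        with l have "l = 1" by simp
        have "\<bar>((w \<bullet> v t) / 2)\<^sup>2 - (norm w)\<^sup>2 / 2\<bar> \<le> ((w \<bullet> v t) / 2)\<^sup>2 + (norm w)\<^sup>2 / 2"
          using abs_triangle_ineq4[of "((w \<bullet> v t) / 2)\<^sup>2" "(norm w)\<^sup>2 / 2"] by simp
        also have "((w \<bullet> v t) / 2)\<^sup>2 \<le> (norm w * norm (v t))\<^sup>2"
          using wv by (intro power2_le_iff_abs_le[THEN iffD2]) auto
        finally have "\<bar>((w \<bullet> v t) / 2)\<^sup>2 - (norm w)\<^sup>2 / 2\<bar> \<le> (norm w)\<^sup>2 * (1 + (norm (v t))\<^sup>2)"
          unfolding power_mult_distrib distrib_left using zero_le_power2[of "norm w"] by linarith
        from mult_right_mono[OF this E0] show ?thesis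
          using \<open>l = 1\<close> E0 by (simp add: D_def abs_mult mult.assoc numeral_2_eq_2)
      qed
      moreover have "\<bar>D (Suc l) t / fact (Suc l)\<bar> \<le> \<bar>D (Suc l) t\<bar>"
        using fact_ge_1[of "Suc l", where 'a=real] by (simp add: divide_le_eq mult_le_cancel_left1 del: fact_Suc)
      ultimately show ?thesis by linarith
    qed
    moreover have "(1 + (norm (v t))\<^sup>2) * E t \<le> C * ((1 + norm w) ^ N * decay N z)"
    proof -
      have "(1 + (norm (v t))\<^sup>2) * E t \<le> C * decay N (v t)" unfolding E_def by (rule C)
      also have "\<dots> \<le> C * ((1 + norm (t *\<^sub>R w)) ^ N * decay N z)"
        unfolding v_def by (intro mult_left_mono decay_diff_le C0)
      also have "\<dots> \<le> C * ((1 + norm w) ^ N * decay N z)"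
        using t by (intro mult_left_mono mult_right_mono power_mono C0) (auto simp: mult_left_le_one_le)
      finally show ?thesis .
    qed
    then have "norm w ^ Suc l * ((1 + (norm (v t))\<^sup>2) * E t) \<le> norm w ^ Suc l * (C * ((1 + norm w) ^ N * decay N z))"
      by (intro mult_left_mono) auto
    ultimately show ?thesis by (simp add: mult_ac)
  qed
  with C0 show ?thesis by blast
qed

lemma heat_kernel_nonneg [simp]: "0 \<le> heat_kernel t x"
  by (simp add: heat_kernel_def)

lemma heat_kernel_scaled:
  fixes x :: "'a::euclidean_space"
  assumes "0 < t"
  shows "heat_kernel t x = (4 * pi * t) powr (- (DIM('a) / 2)) * exp (- (norm (x /\<^sub>R sqrt t))\<^sup>2 / 4)"
proof -
  have "norm (x /\<^sub>R sqrt t) = norm x / sqrt t"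
    using assms by (simp add: divide_inverse mult.commute)
  then have "(norm (x /\<^sub>R sqrt t))\<^sup>2 = (norm x)\<^sup>2 / t"
    using assms by (simp only: power_divide) simp
  then show ?thesis by (simp only: heat_kernel_def) simp
qed

lemma four_pi_powr_le: "0 < t \<Longrightarrow> (4 * pi * t) powr (- (real d / 2)) \<le> t powr (- (real d / 2))"
  using pi_gt3 by (intro powr_mono2') auto

text \<open>
  The Taylor polynomial in \<open>y\<close> that is subtracted has degree at most \<open>l\<close>, so it is invisible to
  functions with vanishing moments; it improves the decay as \<open>t \<rightarrow> \<infinity>\<close>.  Small times are left alone:
  there the subtracted terms would concentrate at \<open>x = 0\<close>, where the function \<open>b\<close> integrated against them is only
  locally integrable.
\<close>

definition heat_remainder :: "nat \<Rightarrow> real \<Rightarrow> 'a::euclidean_space \<Rightarrow> 'a \<Rightarrow> real" where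
  "heat_remainder l t x y = heat_kernel t (x - y) -
     (if t < 1 then 0 else heat_kernel t x * (1 + real l * ((x \<bullet> y) / (2 * t))))"

text \<open>
  By parabolic scaling the Taylor remainder of order \<open>l + 1\<close> gains the factor \<open>t\<^bsup>-(l+1)/2\<^esup>\<close>.  The growth
  in \<open>y\<close> is left to be absorbed by the decay of a test function.
\<close>

lemma heat_remainder_large_time:
  assumes l: "l \<le> 1"
  shows "\<exists>C\<ge>0. \<forall>t\<ge>1. \<forall>x y :: 'a::euclidean_space. \<bar>heat_remainder l t x y\<bar>
    \<le> C * t powr (- (DIM('a) / 2) - (real l + 1) / 2) * decay N (x /\<^sub>R sqrt t) * (1 + norm y) ^ (N + Suc l)"
proof -
  obtain C where C0: "0 \<le> C" and C: "\<And>z w :: 'a.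
      \<bar>exp (- (norm (z - w))\<^sup>2 / 4) - exp (- (norm z)\<^sup>2 / 4) * (1 + real l * ((z \<bullet> w) / 2))\<bar>
      \<le> C * norm w ^ Suc l * (1 + norm w) ^ N * decay N z"
    using gaussian_Taylor_bound[OF l, of N, where 'a='a] by blast
  have "\<bar>heat_remainder l t x y\<bar>
    \<le> C * t powr (- (DIM('a) / 2) - (real l + 1) / 2) * decay N (x /\<^sub>R sqrt t) * (1 + norm y) ^ (N + Suc l)"
    if t: "1 \<le> t" for t and x y :: 'a
  proof -
    define z where "z = x /\<^sub>R sqrt t"
    define w where "w = y /\<^sub>R sqrt t"
    define p where "p = (4 * pi * t) powr (- (DIM('a) / 2))"
    have zw: "(z \<bullet> w) / 2 = (x \<bullet> y) / (2 * t)"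
      using t by (simp add: z_def w_def field_simps)
    have "heat_remainder l t x y = p * (exp (- (norm (z - w))\<^sup>2 / 4) - exp (- (norm z)\<^sup>2 / 4) * (1 + real l * ((z \<bullet> w) / 2)))"
      using t by (simp only: zw) (simp add: heat_remainder_def heat_kernel_scaled z_def w_def p_def scaleR_diff_right algebra_simps)
    then have "\<bar>heat_remainder l t x y\<bar> \<le> p * (C * norm w ^ Suc l * (1 + norm w) ^ N * decay N z)"
      using C[of z w] by (simp add: abs_mult p_def mult_left_mono)
    also have "\<dots> \<le> t powr (- (DIM('a) / 2)) * (C * (norm y ^ Suc l * t powr (- ((real l + 1) / 2))) * (1 + norm y) ^ N * decay N z)"
    proof (intro mult_mono mult_left_mono mult_nonneg_nonneg C0)
      show "p \<le> t powr (- (DIM('a) / 2))" unfolding p_def using t by (intro four_pi_powr_le) auto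
      have "inverse (sqrt t) = t powr (- (1 / 2))"
        using t by (simp add: powr_minus powr_half_sqrt)
      then have "inverse (sqrt t) ^ Suc l = t powr (- ((real l + 1) / 2))"
        using t by (simp add: powr_realpow[symmetric] powr_powr del: power_Suc) (simp add: algebra_simps add_divide_distrib)
      then show "norm w ^ Suc l \<le> norm y ^ Suc l * t powr (- ((real l + 1) / 2))"
        using t by (simp add: w_def power_mult_distrib mult.commute del: power_Suc)
      have "norm w \<le> norm y"
        using t by (simp add: w_def mult_left_le_one_le inverse_le_1_iff)
      then show "(1 + norm w) ^ N \<le> (1 + norm y) ^ N" by (intro power_mono) auto
    qed auto
    also have "\<dots> = C * t powr (- (DIM('a) / 2) - (real l + 1) / 2) * decay N z * (norm y ^ Suc l * (1 + norm y) ^ N)"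
      by (simp only: diff_conv_add_uminus powr_add mult_ac)
    also have "\<dots> \<le> C * t powr (- (DIM('a) / 2) - (real l + 1) / 2) * decay N z * ((1 + norm y) ^ Suc l * (1 + norm y) ^ N)"
      by (intro mult_left_mono mult_right_mono power_mono mult_nonneg_nonneg C0) auto
    finally show ?thesis by (simp add: z_def power_add mult_ac)
  qed
  with C0 show ?thesis by blast
qed

text \<open>
  The weight is moved from \<open>y\<close> to \<open>x\<close> by Peetre's inequality; for \<open>t < 1\<close> the resulting power of
  \<open>1 + \<bar>x - y\<bar>\<close> is absorbed by the Gaussian uniformly in \<open>t\<close>.
\<close>

lemma heat_kernel_small_time:
  "\<exists>C\<ge>0. \<forall>t. 0 < t \<and> t < 1 \<longrightarrow> (\<forall>x y :: 'a::euclidean_space. heat_kernel t (x - y) * decay M y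
    \<le> C * t powr (- (DIM('a) / 2)) * decay M x * decay N ((y - x) /\<^sub>R sqrt t))"
proof -
  obtain C where C0: "0 \<le> C" and C: "\<And>v::'a. (1 + (norm v)\<^sup>2) * exp (- (norm v)\<^sup>2 / 4) \<le> C * decay (M + N) v"
    using gaussian_decay[of "M + N", where 'a='a] by blast
  have "heat_kernel t (x - y) * decay M y \<le> C * t powr (- (DIM('a) / 2)) * decay M x * decay N ((y - x) /\<^sub>R sqrt t)"
    if t: "0 < t" "t < 1" for t and x y :: 'a
  proof -
    define v where "v = (y - x) /\<^sub>R sqrt t"
    have nv: "norm ((x - y) /\<^sub>R sqrt t) = norm v" by (simp add: v_def norm_minus_commute)
    have "exp (- (norm v)\<^sup>2 / 4) \<le> (1 + (norm v)\<^sup>2) * exp (- (norm v)\<^sup>2 / 4)" by simp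
    also have "\<dots> \<le> C * decay (M + N) v" by (rule C)
    finally have 1: "exp (- (norm v)\<^sup>2 / 4) \<le> C * decay (M + N) v" .
    have "decay M y = decay M (x - (x - y))" by simp
    also have "\<dots> \<le> (1 + norm (x - y)) ^ M * decay M x" by (rule decay_diff_le)
    also have "\<dots> \<le> (1 + norm v) ^ M * decay M x"
    proof (intro mult_right_mono power_mono)
      have "norm (y - x) * 1 \<le> norm (y - x) * inverse (sqrt t)"
        using t by (intro mult_left_mono) (auto simp: one_le_inverse_iff)
      then show "1 + norm (x - y) \<le> 1 + norm v"
        using t by (simp add: v_def norm_minus_commute mult.commute)
    qed auto
    finally have 2: "decay M y \<le> (1 + norm v) ^ M * decay M x" .
    have "heat_kernel t (x - y) * decay M y \<le> (t powr (- (DIM('a) / 2)) * (C * decay (M + N) v)) * ((1 + norm v) ^ M * decay M x)"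
      unfolding heat_kernel_scaled[OF t(1)] nv
      by (intro mult_mono 1 2 four_pi_powr_le t mult_nonneg_nonneg C0) auto
    also have "\<dots> = C * t powr (- (DIM('a) / 2)) * decay M x * ((1 + norm v) ^ M * decay (M + N) v)"
      by (simp add: mult_ac)
    finally show ?thesis by (simp only: power_mult_decay_add v_def)
  qed
  with C0 show ?thesis by blast
qed

lemma heat_remainder_borel_measurable [measurable]:
  assumes [measurable]: "f \<in> borel_measurable M" "g \<in> borel_measurable M" "h \<in> borel_measurable M"
  shows "(\<lambda>w. heat_remainder l (f w) (g w) (h w)) \<in> borel_measurable M"
  unfolding heat_remainder_def by measurable

lemma nn_integral_lborel_translate:
  fixes f :: "'a::euclidean_space \<Rightarrow> ennreal"
  assumes [measurable]: "f \<in> borel_measurable borel"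
  shows "(\<integral>\<^sup>+x. f (x - a) \<partial>lborel) = (\<integral>\<^sup>+x. f x \<partial>lborel)"
proof -
  have "(\<integral>\<^sup>+x. f x \<partial>lborel) = (\<integral>\<^sup>+x. f x \<partial>distr lborel borel ((+) (- a)))" by (simp only: lborel_distr_plus)
  also have "\<dots> = (\<integral>\<^sup>+x. f (- a + x) \<partial>lborel)" by (rule nn_integral_distr) measurable
  finally show ?thesis by simp
qed

text \<open>
  For small times the heat kernel has bounded mass and the weight in \<open>x\<close> makes \<open>g\<close> integrable.  For
  large times \<open>g\<close> is averaged at the scale \<open>t\<^bsup>1/2\<^esup>\<close>, where its mean value is at most of the order
  \<open>t\<^bsup>\<epsilon>/2\<^esup>\<close>, while the Taylor remainder contributes \<open>t\<^bsup>-(l+1)/2\<^esup>\<close>.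
\<close>

lemma heat_remainder_mass:
  fixes g :: "'a::euclidean_space \<Rightarrow> ennreal" and \<epsilon> :: real
  assumes l: "l \<le> 1" and [measurable]: "g \<in> borel_measurable borel" and "0 \<le> C" and \<epsilon>: "0 < \<epsilon>" "\<epsilon> \<le> 1"
    and growth: "\<And>r. 1 \<le> r \<Longrightarrow> (\<integral>\<^sup>+x\<in>ball 0 r. g x \<partial>lborel) \<le> ennreal (C * r powr (DIM('a) + \<epsilon>))"
    and M: "2 * DIM('a) + 5 \<le> M"
  shows "\<exists>K\<ge>0. \<forall>t>0. (\<integral>\<^sup>+x. g x * (\<integral>\<^sup>+y. ennreal (\<bar>heat_remainder l t x y\<bar> * decay M y) \<partial>lborel) \<partial>lborel)
    \<le> ennreal (K * (if t < 1 then 1 else t powr ((\<epsilon> - (real l + 1)) / 2)))"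
proof -
  let ?d = "DIM('a)"
  \<comment> \<open>the smallest exponent that exceeds \<open>d + \<epsilon>\<close> for all \<open>\<epsilon> \<le> 1\<close>, so that \<open>g\<close> may be integrated against the weight\<close>
  define N where "N = ?d + 2"
  let ?J = "\<lambda>t. \<integral>\<^sup>+x. g x * (\<integral>\<^sup>+y. ennreal (\<bar>heat_remainder l t x y\<bar> * decay M y) \<partial>lborel) \<partial>lborel"
  obtain K1 where K1: "0 \<le> K1" "\<And>R. 0 < R \<Longrightarrow> (\<integral>\<^sup>+x. ennreal (decay N ((x::'a) /\<^sub>R R)) \<partial>lborel) \<le> ennreal (K1 * R powr ?d)"
    using nn_integral_decay_scaled_le[of N, where 'a='a] by (auto simp: N_def)
  obtain A where A0: "0 \<le> A" and A: "\<And>t (x::'a) y. 0 < t \<Longrightarrow> t < 1 \<Longrightarrow> heat_kernel t (x - y) * decay M y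
      \<le> A * t powr (- (?d / 2)) * decay M x * decay N ((y - x) /\<^sub>R sqrt t)"
    using heat_kernel_small_time[of M N, where 'a='a] by blast
  obtain B where B0: "0 \<le> B" and B: "\<And>t (x::'a) y. 1 \<le> t \<Longrightarrow> \<bar>heat_remainder l t x y\<bar>
      \<le> B * t powr (- (?d / 2) - (real l + 1) / 2) * decay N (x /\<^sub>R sqrt t) * (1 + norm y) ^ (N + Suc l)"
    using heat_remainder_large_time[OF l, of N, where 'a='a] by blast
  define G where "G n = dyadic_const (?d + \<epsilon>) n * C" for n
  have G0: "0 \<le> G n" if "N \<le> n" for n
    using dyadic_const_pos[of "?d + \<epsilon>" n] that \<epsilon> \<open>0 \<le> C\<close> by (simp add: G_def N_def)
  have G: "(\<integral>\<^sup>+x. g x * ennreal (decay n (x /\<^sub>R R)) \<partial>lborel) \<le> ennreal (G n * R powr (?d + \<epsilon>))"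
    if "1 \<le> R" "N \<le> n" for R n
    unfolding G_def using that \<epsilon> \<open>0 \<le> C\<close> growth by (intro nn_integral_decay_le) (auto simp: N_def)
  have MN: "N \<le> M" using M by (simp add: N_def)
  have small: "?J t \<le> ennreal (A * K1 * G M)" if t: "0 < t" "t < 1" for t
  proof -
    have sq: "sqrt t powr ?d = t powr (?d / 2)"
      using t by (simp add: powr_half_sqrt[symmetric] powr_powr)
    have inner: "(\<integral>\<^sup>+y. ennreal (\<bar>heat_remainder l t x y\<bar> * decay M y) \<partial>lborel) \<le> ennreal (A * K1) * ennreal (decay M x)" for x :: 'a
    proof -
      have "(\<integral>\<^sup>+y. ennreal (\<bar>heat_remainder l t x y\<bar> * decay M y) \<partial>lborel)
          \<le> (\<integral>\<^sup>+y. ennreal (A * t powr (- (?d / 2)) * decay M x) * ennreal (decay N ((y - x) /\<^sub>R sqrt t)) \<partial>lborel)"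
        using A[OF t, of x] A0 t
        by (intro nn_integral_mono) (simp add: heat_remainder_def ennreal_mult'[symmetric] ennreal_leI)
      also have "\<dots> = ennreal (A * t powr (- (?d / 2)) * decay M x) * (\<integral>\<^sup>+y. ennreal (decay N ((y - x) /\<^sub>R sqrt t)) \<partial>lborel)"
        by (rule nn_integral_cmult) measurable
      also have "(\<integral>\<^sup>+y. ennreal (decay N ((y - x) /\<^sub>R sqrt t)) \<partial>lborel) = (\<integral>\<^sup>+y. ennreal (decay N ((y::'a) /\<^sub>R sqrt t)) \<partial>lborel)"
        by (rule nn_integral_lborel_translate) measurable
      also have "\<dots> \<le> ennreal (K1 * sqrt t powr ?d)" using t by (intro K1) auto
      finally have "(\<integral>\<^sup>+y. ennreal (\<bar>heat_remainder l t x y\<bar> * decay M y) \<partial>lborel)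
          \<le> ennreal (A * t powr (- (?d / 2)) * decay M x) * ennreal (K1 * t powr (?d / 2))"
        by (simp add: sq mult_left_mono)
      also have "\<dots> = ennreal (A * K1 * decay M x * (t powr (- (?d / 2)) * t powr (?d / 2)))"
        using A0 K1(1) by (simp add: ennreal_mult'[symmetric] mult_ac)
      also have "\<dots> = ennreal (A * K1) * ennreal (decay M x)"
        using t A0 K1(1) by (simp add: powr_add[symmetric] ennreal_mult)
      finally show ?thesis .
    qed
    have "?J t \<le> (\<integral>\<^sup>+x. ennreal (A * K1) * (g x * ennreal (decay M (x /\<^sub>R 1))) \<partial>lborel)"
      using mult_left_mono[OF inner] by (intro nn_integral_mono) (simp add: mult_ac)
    also have "\<dots> = ennreal (A * K1) * (\<integral>\<^sup>+x. g x * ennreal (decay M (x /\<^sub>R 1)) \<partial>lborel)"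
      by (rule nn_integral_cmult) measurable
    also have "\<dots> \<le> ennreal (A * K1) * ennreal (G M * 1 powr (?d + \<epsilon>))"
      by (intro mult_left_mono G MN) auto
    finally show ?thesis using A0 K1(1) G0[OF MN] by (simp add: ennreal_mult'[symmetric])
  qed
  define K2 where "K2 = enn2real (\<integral>\<^sup>+y. ennreal (decay (Suc ?d) (y::'a)) \<partial>lborel)"
  have K2: "(\<integral>\<^sup>+y. ennreal (decay (Suc ?d) (y::'a)) \<partial>lborel) = ennreal K2"
    using integrable_decay[of "Suc ?d", where 'a='a] unfolding K2_def
    by (subst ennreal_enn2real) (auto simp: integrable_iff_bounded)
  have large: "?J t \<le> ennreal (B * K2 * G N * t powr ((\<epsilon> - (real l + 1)) / 2))" if t: "1 \<le> t" for t
  proof -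
    define P where "P = t powr (- (?d / 2) - (real l + 1) / 2)"
    have inner: "(\<integral>\<^sup>+y. ennreal (\<bar>heat_remainder l t x y\<bar> * decay M y) \<partial>lborel) \<le> ennreal (B * P * K2) * ennreal (decay N (x /\<^sub>R sqrt t))" for x :: 'a
    proof -
      have "\<bar>heat_remainder l t x y\<bar> * decay M y \<le> B * P * decay N (x /\<^sub>R sqrt t) * decay (Suc ?d) y" for y
      proof -
        have "\<bar>heat_remainder l t x y\<bar> * decay M y
            \<le> (B * P * decay N (x /\<^sub>R sqrt t) * (1 + norm y) ^ (N + Suc l)) * decay (N + Suc l + Suc ?d) y"
          unfolding P_def using M l B0 by (intro mult_mono B t decay_antimono mult_nonneg_nonneg) (auto simp: N_def)
        also have "\<dots> = B * P * decay N (x /\<^sub>R sqrt t) * ((1 + norm y) ^ (N + Suc l) * decay (N + Suc l + Suc ?d) y)"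
          by (simp only: mult.assoc)
        finally show ?thesis by (simp only: power_mult_decay_add)
      qed
      then have "(\<integral>\<^sup>+y. ennreal (\<bar>heat_remainder l t x y\<bar> * decay M y) \<partial>lborel)
          \<le> (\<integral>\<^sup>+y. ennreal (B * P * decay N (x /\<^sub>R sqrt t)) * ennreal (decay (Suc ?d) (y::'a)) \<partial>lborel)"
        using B0 by (intro nn_integral_mono) (simp add: P_def ennreal_mult'[symmetric] ennreal_leI)
      also have "\<dots> = ennreal (B * P * decay N (x /\<^sub>R sqrt t)) * ennreal K2"
        unfolding K2[symmetric] by (rule nn_integral_cmult) measurable
      also have "\<dots> = ennreal (B * P * K2) * ennreal (decay N (x /\<^sub>R sqrt t))"
        using B0 by (simp add: P_def K2_def ennreal_mult'[symmetric] mult_ac)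
      finally show ?thesis .
    qed
    have "?J t \<le> (\<integral>\<^sup>+x. ennreal (B * P * K2) * (g x * ennreal (decay N (x /\<^sub>R sqrt t))) \<partial>lborel)"
      using mult_left_mono[OF inner] by (intro nn_integral_mono) (simp add: mult_ac)
    also have "\<dots> = ennreal (B * P * K2) * (\<integral>\<^sup>+x. g x * ennreal (decay N (x /\<^sub>R sqrt t)) \<partial>lborel)"
      by (rule nn_integral_cmult) measurable
    also have "\<dots> \<le> ennreal (B * P * K2) * ennreal (G N * sqrt t powr (?d + \<epsilon>))"
      using t by (intro mult_left_mono G) auto
    also have "\<dots> = ennreal (B * K2 * G N * (P * sqrt t powr (?d + \<epsilon>)))"
      using B0 G0[of N] by (simp add: P_def K2_def ennreal_mult'[symmetric] mult_ac)
    also have "P * sqrt t powr (?d + \<epsilon>) = t powr ((\<epsilon> - (real l + 1)) / 2)"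
    proof -
      have "sqrt t powr (?d + \<epsilon>) = t powr ((?d + \<epsilon>) / 2)"
        using t by (simp add: powr_half_sqrt[symmetric] powr_powr)
      then show ?thesis
        unfolding P_def by (simp add: powr_add[symmetric]) (simp add: add_divide_distrib diff_divide_distrib algebra_simps)
    qed
    finally show ?thesis .
  qed
  show ?thesis
  proof (intro exI conjI allI impI)
    show "0 \<le> A * K1 * G M + B * K2 * G N"
      using A0 B0 K1(1) G0[OF MN] G0[of N] by (simp add: K2_def)
    fix t :: real assume "0 < t"
    show "?J t \<le> ennreal ((A * K1 * G M + B * K2 * G N) * (if t < 1 then 1 else t powr ((\<epsilon> - (real l + 1)) / 2)))"
    proof (cases "t < 1")
      case True
      have "?J t \<le> ennreal (A * K1 * G M)" by (rule small[OF \<open>0 < t\<close> True])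
      also have "\<dots> \<le> ennreal (A * K1 * G M + B * K2 * G N)"
        using B0 G0[of N] by (intro ennreal_leI) (simp add: K2_def)
      finally show ?thesis using True by simp
    next
      case False
      have "?J t \<le> ennreal (B * K2 * G N * t powr ((\<epsilon> - (real l + 1)) / 2))" using large False by simp
      also have "\<dots> \<le> ennreal ((A * K1 * G M + B * K2 * G N) * t powr ((\<epsilon> - (real l + 1)) / 2))"
        using A0 K1(1) G0[OF MN] by (intro ennreal_leI mult_right_mono) auto
      finally show ?thesis using False by simp
    qed
  qed
qed

text \<open>
  Convergence at \<open>t = 0\<close> needs \<open>\<alpha> > 0\<close>, and convergence at \<open>t = \<infinity>\<close> needs \<open>\<alpha> + \<epsilon> < l + 1\<close>.
\<close>

lemma heat_remainder_total_mass:
  fixes g :: "'a::euclidean_space \<Rightarrow> ennreal" and \<epsilon> :: real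
  assumes l: "l \<le> 1" and gm [measurable]: "g \<in> borel_measurable borel" and "0 \<le> C" and \<epsilon>: "0 < \<epsilon>" "\<epsilon> \<le> 1"
    and growth: "\<And>r. 1 \<le> r \<Longrightarrow> (\<integral>\<^sup>+x\<in>ball 0 r. g x \<partial>lborel) \<le> ennreal (C * r powr (DIM('a) + \<epsilon>))"
    and M: "2 * DIM('a) + 5 \<le> M"
    and \<alpha>: "0 < \<alpha>" "\<alpha> + \<epsilon> < real l + 1"
  shows "(\<integral>\<^sup>+t. ennreal (indicator {0<..} t * t powr (\<alpha> / 2 - 1)) *
      (\<integral>\<^sup>+x. g x * (\<integral>\<^sup>+y. ennreal (\<bar>heat_remainder l t x y\<bar> * decay M y) \<partial>lborel) \<partial>lborel) \<partial>lborel) < \<infinity>"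
proof -
  let ?J = "\<lambda>t. \<integral>\<^sup>+x. g x * (\<integral>\<^sup>+y. ennreal (\<bar>heat_remainder l t x y\<bar> * decay M y) \<partial>lborel) \<partial>lborel"
  obtain K where K0: "0 \<le> K" and K: "\<And>t. 0 < t \<Longrightarrow> ?J t \<le> ennreal (K * (if t < 1 then 1 else t powr ((\<epsilon> - (real l + 1)) / 2)))"
    using heat_remainder_mass[OF l gm \<open>0 \<le> C\<close> \<epsilon> growth M] by blast
  define a where "a = \<alpha> / 2 - 1"
  define e where "e = a + (\<epsilon> - (real l + 1)) / 2"
  have a: "- 1 < a" using \<alpha> by (simp add: a_def)
  have "e = (\<alpha> + \<epsilon> - (real l + 1)) / 2 - 1" by (simp add: a_def e_def field_simps)
  then have e: "e < - 1" using \<alpha> by simp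
  have "ennreal (indicator {0<..} t * t powr a) * ?J t
      \<le> ennreal K * (ennreal (indicator {0..1} t * t powr a) + ennreal (indicator {1..} t * t powr e))" for t
  proof (cases "0 < t")
    case True
    have "ennreal (indicator {0<..} t * t powr a) * ?J t
        \<le> ennreal (t powr a) * ennreal (K * (if t < 1 then 1 else t powr ((\<epsilon> - (real l + 1)) / 2)))"
      using True K[OF True] by (simp add: mult_left_mono)
    also have "\<dots> = ennreal (K * (if t < 1 then t powr a else t powr e))"
      using K0 by (simp add: e_def powr_add ennreal_mult'[symmetric] mult_ac)
    also have "\<dots> \<le> ennreal (K * (indicator {0..1} t * t powr a + indicator {1..} t * t powr e))"
      using True K0 by (intro ennreal_leI mult_left_mono) (auto simp: indicator_def)
    also have "\<dots> = ennreal K * (ennreal (indicator {0..1} t * t powr a) + ennreal (indicator {1..} t * t powr e))"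
      using K0 by (subst ennreal_plus[symmetric]) (auto simp: ennreal_mult)
    finally show ?thesis .
  qed simp
  then have "(\<integral>\<^sup>+t. ennreal (indicator {0<..} t * t powr a) * ?J t \<partial>lborel)
      \<le> (\<integral>\<^sup>+t. ennreal K * (ennreal (indicator {0..1} t * t powr a) + ennreal (indicator {1..} t * t powr e)) \<partial>lborel)"
    by (intro nn_integral_mono) 
  also have "\<dots> = ennreal K * ((\<integral>\<^sup>+t. ennreal (indicator {0..1} t * t powr a) \<partial>lborel) + (\<integral>\<^sup>+t. ennreal (indicator {1..} t * t powr e) \<partial>lborel))"
    by (subst nn_integral_cmult) (auto simp: nn_integral_add)
  also have "(\<integral>\<^sup>+t. ennreal (indicator {0..1} t * t powr a) \<partial>lborel) = ennreal (1 powr (a + 1) / (a + 1))"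
    using a by (intro nn_integral_has_integral_lebesgue has_integral_powr_from_0) auto
  also have "(\<integral>\<^sup>+t. ennreal (indicator {1..} t * t powr e) \<partial>lborel) = ennreal (- (1 powr (e + 1)) / (e + 1))"
    using e by (intro nn_integral_has_integral_lebesgue has_integral_powr_to_inf) auto
  finally show ?thesis
    unfolding a_def[symmetric] by (rule le_less_trans) (simp add: ennreal_mult_less_top)
qed

section \<open>The function represented by a Riesz potential of a BMO function\<close>

text \<open>
  The integrand, as a function of \<open>p = (x, t)\<close>, of the function of \<open>y\<close> that will represent \<open>I\<^sub>\<alpha>(b)\<close>.
\<close>

definition heat_potential :: "nat \<Rightarrow> real \<Rightarrow> ('a::euclidean_space \<Rightarrow> complex) \<Rightarrow> 'a \<Rightarrow> 'a \<times> real \<Rightarrow> complex" where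
  "heat_potential l \<alpha> b y p = b (fst p) *
     of_real (indicator {0<..} (snd p) * snd p powr (\<alpha> / 2 - 1) * heat_remainder l (snd p) (fst p) y)"

lemma heat_potential_borel_measurable:
  fixes b :: "'a::euclidean_space \<Rightarrow> complex"
  assumes [measurable]: "b \<in> borel_measurable borel"
  shows "(\<lambda>(y, p). heat_potential l \<alpha> b y p) \<in> borel_measurable (lborel \<Otimes>\<^sub>M lborel)"
proof -
  have [measurable]: "fst \<in> borel_measurable (borel :: ('a \<times> real) measure)" "snd \<in> borel_measurable (borel :: ('a \<times> real) measure)"
    by (intro borel_measurable_continuous_onI continuous_intros)+
  show ?thesis unfolding heat_potential_def by measurable
qed

text \<open>
  This absolute convergence over all of \<open>(y, x, t)\<close>, with a polynomial weight in place of the test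
  function, licenses every exchange of integrals in \<open>riesz_potential_dual_function\<close>.
\<close>

lemma heat_potential_integrable:
  fixes b :: "'a::euclidean_space \<Rightarrow> complex" and \<epsilon> :: real
  assumes l: "l \<le> 1" and b [measurable]: "b \<in> borel_measurable borel" and "0 \<le> C" and \<epsilon>: "0 < \<epsilon>" "\<epsilon> \<le> 1"
    and growth: "\<And>r. 1 \<le> r \<Longrightarrow> (\<integral>\<^sup>+x\<in>ball 0 r. norm (b x) \<partial>lborel) \<le> ennreal (C * r powr (DIM('a) + \<epsilon>))"
    and M: "2 * DIM('a) + 5 \<le> M"
    and \<alpha>: "0 < \<alpha>" "\<alpha> + \<epsilon> < real l + 1"
  shows "integrable (lborel \<Otimes>\<^sub>M lborel) (\<lambda>(y, p). heat_potential l \<alpha> b y p * of_real (decay M y))"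
proof (rule integrableI_bounded)
  note [measurable] = heat_potential_borel_measurable[OF b]
  show m: "(\<lambda>(y, p). heat_potential l \<alpha> b y p * of_real (decay M y)) \<in> borel_measurable (lborel \<Otimes>\<^sub>M lborel)"
    by measurable
  define g where "g x = ennreal (norm (b x))" for x
  have gm [measurable]: "g \<in> borel_measurable borel" unfolding g_def by measurable
  define H where "H x t y = ennreal (indicator {0<..} t * t powr (\<alpha> / 2 - 1)) * (g x * ennreal (\<bar>heat_remainder l t x y\<bar> * decay M y))"
    for x y and t :: real
  have "ennreal (norm (case z of (y, p) \<Rightarrow> heat_potential l \<alpha> b y p * of_real (decay M y)))
      = (case z of (y, x, t) \<Rightarrow> H x t y)" for z
    by (cases z) (auto simp: heat_potential_def H_def g_def norm_mult abs_mult ennreal_mult'[symmetric] mult_ac)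
  then have "(\<integral>\<^sup>+z. ennreal (norm (case z of (y, p) \<Rightarrow> heat_potential l \<alpha> b y p * of_real (decay M y))) \<partial>(lborel \<Otimes>\<^sub>M lborel))
      = (\<integral>\<^sup>+z. (case z of (y, x, t) \<Rightarrow> H x t y) \<partial>(lborel \<Otimes>\<^sub>M lborel))"
    by simp
  also have "\<dots> = (\<integral>\<^sup>+p. \<integral>\<^sup>+y. (case p of (x, t) \<Rightarrow> H x t y) \<partial>lborel \<partial>lborel)"
  proof -
    have "(\<lambda>z. case z of (y, x, t) \<Rightarrow> H x t y) \<in> borel_measurable (lborel \<Otimes>\<^sub>M (lborel \<Otimes>\<^sub>M lborel))"
      unfolding H_def by measurable
    then have "(\<lambda>z. case z of (y, x, t) \<Rightarrow> H x t y) \<in> borel_measurable (lborel \<Otimes>\<^sub>M lborel)"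
      unfolding lborel_prod .
    from lborel_pair.nn_integral_snd[OF this] show ?thesis by simp
  qed
  also have "\<dots> = (\<integral>\<^sup>+p. \<integral>\<^sup>+y. (case p of (x, t) \<Rightarrow> H x t y) \<partial>lborel \<partial>(lborel \<Otimes>\<^sub>M lborel))"
    by (simp only: lborel_prod)
  also have "\<dots> = (\<integral>\<^sup>+t. \<integral>\<^sup>+x. \<integral>\<^sup>+y. H x t y \<partial>lborel \<partial>lborel \<partial>lborel)"
  proof -
    have "(\<lambda>p. \<integral>\<^sup>+y. (case p of (x, t) \<Rightarrow> H x t y) \<partial>lborel) \<in> borel_measurable (lborel \<Otimes>\<^sub>M lborel)"
      unfolding H_def by measurable
    then show ?thesis by (subst lborel_pair.nn_integral_snd[symmetric]) auto
  qed
  also have "\<dots> = (\<integral>\<^sup>+t. ennreal (indicator {0<..} t * t powr (\<alpha> / 2 - 1)) *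
      (\<integral>\<^sup>+x. g x * (\<integral>\<^sup>+y. ennreal (\<bar>heat_remainder l t x y\<bar> * decay M y) \<partial>lborel) \<partial>lborel) \<partial>lborel)"
  proof (intro nn_integral_cong)
    fix t
    have "(\<integral>\<^sup>+y. H x t y \<partial>lborel) = ennreal (indicator {0<..} t * t powr (\<alpha> / 2 - 1)) * (g x * (\<integral>\<^sup>+y. ennreal (\<bar>heat_remainder l t x y\<bar> * decay M y) \<partial>lborel))" for x
      unfolding H_def by (subst nn_integral_cmult, measurable)+
    then show "(\<integral>\<^sup>+x. \<integral>\<^sup>+y. H x t y \<partial>lborel \<partial>lborel) = ennreal (indicator {0<..} t * t powr (\<alpha> / 2 - 1)) *
      (\<integral>\<^sup>+x. g x * (\<integral>\<^sup>+y. ennreal (\<bar>heat_remainder l t x y\<bar> * decay M y) \<partial>lborel) \<partial>lborel)"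
      by (simp only:) (rule nn_integral_cmult, measurable)
  qed
  also have "\<dots> < \<infinity>"
    by (rule heat_remainder_total_mass[OF l gm \<open>0 \<le> C\<close> \<epsilon> _ M \<alpha>]) (use growth in \<open>simp add: g_def\<close>)
  finally show "(\<integral>\<^sup>+z. ennreal (norm (case z of (y, p) \<Rightarrow> heat_potential l \<alpha> b y p * of_real (decay M y))) \<partial>(lborel \<Otimes>\<^sub>M lborel)) < \<infinity>" .
qed

lemma heat_kernel_integrable_mult:
  fixes f :: "'a::euclidean_space \<Rightarrow> complex"
  assumes f: "f \<in> schwartz" and t: "0 < t"
  shows "integrable lborel (\<lambda>y. of_real (heat_kernel t (x - y)) * f y)"
proof (rule Bochner_Integration.integrable_bound)
  show "integrable lborel (\<lambda>y. of_real ((4 * pi * t) powr (- (DIM('a) / 2))) * f y)"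
    by (intro integrable_mult_right schwartz_integrable f)
  have "heat_kernel t z \<le> (4 * pi * t) powr (- (DIM('a) / 2))" for z :: 'a
    using t by (simp add: heat_kernel_def mult_left_le)
  then show "AE y in lborel. norm (of_real (heat_kernel t (x - y)) * f y) \<le> norm (of_real ((4 * pi * t) powr (- (DIM('a) / 2))) * f y)"
    by (simp add: norm_mult mult_right_mono)
qed (use schwartz_borel_measurable[OF f] in measurable)

text \<open>
  The subtracted Taylor polynomial integrates to zero against a function with vanishing moments.
\<close>

lemma integral_heat_remainder_vanishing:
  fixes f :: "'a::euclidean_space \<Rightarrow> complex"
  assumes f: "f \<in> schwartz_vanishing l" and l: "l \<le> 1" and t: "0 < t"
  shows "(LINT y|lborel. of_real (heat_remainder l t x y) * f y) = (LINT y|lborel. of_real (heat_kernel t (x - y)) * f y)"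
proof (cases "t < 1")
  case True
  then show ?thesis by (simp add: heat_remainder_def)
next
  case False
  have "has_bochner_integral lborel (\<lambda>y. of_real (heat_kernel t x) * (of_real ((y \<bullet> x) ^ 0) * f y)
      + of_real (heat_kernel t x / (2 * t)) * (of_nat l * (of_real ((y \<bullet> x) ^ l) * f y))) (of_real (heat_kernel t x) * 0 + of_real (heat_kernel t x / (2 * t)) * (of_nat l * 0))"
    by (intro has_bochner_integral_add has_bochner_integral_mult_right integral_inner_power_vanishing[OF f] l) auto
  moreover have "of_real (heat_kernel t x) * (of_real ((y \<bullet> x) ^ 0) * f y)
      + of_real (heat_kernel t x / (2 * t)) * (of_nat l * (of_real ((y \<bullet> x) ^ l) * f y))
    = of_real (heat_kernel t x * (1 + real l * ((x \<bullet> y) / (2 * t)))) * f y" for y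
    using l t by (cases "l = 0") (auto simp: le_Suc_eq inner_commute field_simps)
  ultimately have T: "has_bochner_integral lborel (\<lambda>y. of_real (heat_kernel t x * (1 + real l * ((x \<bullet> y) / (2 * t)))) * f y) 0"
    by simp
  have "of_real (heat_remainder l t x y) * f y = of_real (heat_kernel t (x - y)) * f y
      - of_real (heat_kernel t x * (1 + real l * ((x \<bullet> y) / (2 * t)))) * f y" for y
    using False by (simp add: heat_remainder_def left_diff_distrib)
  then have "(LINT y|lborel. of_real (heat_remainder l t x y) * f y) = (LINT y|lborel. of_real (heat_kernel t (x - y)) * f y)
      - (LINT y|lborel. of_real (heat_kernel t x * (1 + real l * ((x \<bullet> y) / (2 * t)))) * f y)"
    using heat_kernel_integrable_mult[OF schwartz_vanishing_schwartz[OF f] t] T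
    by (simp only: has_bochner_integral_iff Bochner_Integration.integral_diff)
  then show ?thesis using T by (simp only: has_bochner_integral_iff diff_zero)
qed

text \<open>
  Integrating \<open>heat_potential\<close> over \<open>(x, t)\<close> first gives \<open>F\<close>; pairing it with \<open>f\<close> and integrating over \<open>y\<close>
  first gives \<open>b\<close> times the heat flow of \<open>f\<close>, and then the integral over \<open>t\<close> is the Riesz potential.
\<close>

lemma riesz_potential_dual_function:
  fixes b :: "'a::euclidean_space \<Rightarrow> complex" and \<epsilon> :: real
  assumes l: "l \<le> 1" and b [measurable]: "b \<in> borel_measurable borel" and "0 \<le> C" and \<epsilon>: "0 < \<epsilon>" "\<epsilon> \<le> 1"
    and growth: "\<And>r. 1 \<le> r \<Longrightarrow> (\<integral>\<^sup>+x\<in>ball 0 r. norm (b x) \<partial>lborel) \<le> ennreal (C * r powr (DIM('a) + \<epsilon>))"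
    and \<alpha>: "0 < \<alpha>" "\<alpha> + \<epsilon> < real l + 1"
  shows "\<exists>F N. F \<in> borel_measurable borel \<and> integrable lborel (\<lambda>y. F y * of_real (decay N y)) \<and>
    (\<forall>f \<in> schwartz_vanishing l. has_bochner_integral lborel (\<lambda>x. b x * riesz_potential \<alpha> f x) (LINT y|lborel. F y * f y))"
proof -
  \<comment> \<open>room for the weights in \<open>x\<close> and \<open>y\<close> (\<open>d + 2\<close> and \<open>d + 1\<close>) and for the factor \<open>(1 + \<bar>y\<bar>)\<^bsup>l+1\<^esup>\<close> with \<open>l \<le> 1\<close>\<close>
  define M where "M = 2 * DIM('a) + 5"
  define F where "F y = (LINT p|lborel. heat_potential l \<alpha> b y p) / of_real (Gamma (\<alpha> / 2))" for y
  note Hm [measurable] = heat_potential_borel_measurable[OF b]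
  have G: "of_real (Gamma (\<alpha> / 2)) \<noteq> (0::complex)"
  proof -
    have "0 < Gamma (\<alpha> / 2)" using \<alpha> by (intro Gamma_real_pos) simp
    then show ?thesis by simp
  qed
  have int: "integrable (lborel \<Otimes>\<^sub>M lborel) (\<lambda>(y, p). heat_potential l \<alpha> b y p * of_real (decay M y))"
    using heat_potential_integrable[OF l b \<open>0 \<le> C\<close> \<epsilon> growth _ \<alpha>, of M] by (simp add: M_def)
  have Fm: "F \<in> borel_measurable borel"
    unfolding F_def by measurable
  have Fint: "integrable lborel (\<lambda>y. F y * of_real (decay M y))"
  proof -
    have "integrable lborel (\<lambda>y. (LINT p|lborel. heat_potential l \<alpha> b y p * of_real (decay M y)) / of_real (Gamma (\<alpha> / 2)))"
      using lborel_pair.integrable_fst'[OF int] by simp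
    then show ?thesis by (simp add: F_def)
  qed
  have "has_bochner_integral lborel (\<lambda>x. b x * riesz_potential \<alpha> f x) (LINT y|lborel. F y * f y)"
    if f: "f \<in> schwartz_vanishing l" for f
  proof -
    have fs: "f \<in> schwartz" by (rule schwartz_vanishing_schwartz[OF f])
    have [measurable]: "f \<in> borel_measurable borel" by (rule schwartz_borel_measurable[OF fs])
    obtain A where A: "\<And>y. norm (f y) \<le> A * decay M y" using schwartz_decay[OF fs] by blast
    have intf: "integrable (lborel \<Otimes>\<^sub>M lborel) (\<lambda>(y, p). heat_potential l \<alpha> b y p * f y)"
    proof (rule Bochner_Integration.integrable_bound[OF integrable_mult_right[OF int, of "of_real A"]])
      have "norm (f y) \<le> \<bar>A\<bar> * decay M y" for y
        by (rule order_trans[OF A]) (simp add: mult_right_mono)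
      then show "AE z in lborel \<Otimes>\<^sub>M lborel. norm (case z of (y, p) \<Rightarrow> heat_potential l \<alpha> b y p * f y)
          \<le> norm (of_real A * (case z of (y, p) \<Rightarrow> heat_potential l \<alpha> b y p * of_real (decay M y)))"
        by (intro AE_I2) (auto simp: norm_mult mult.left_commute[of "\<bar>A\<bar>"] intro!: mult_left_mono)
    qed measurable
    define k where "k x t = b x * of_real (indicator {0<..} t * t powr (\<alpha> / 2 - 1)) * (LINT y|lborel. of_real (heat_kernel t (x - y)) * f y)"
      for x t
    have k: "(LINT y|lborel. heat_potential l \<alpha> b y p * f y) = (case p of (x, t) \<Rightarrow> k x t)" for p
    proof -
      obtain x t where p: "p = (x, t)" by (cases p)
      show ?thesis
      proof (cases "0 < t")
        case True
        have "(LINT y|lborel. heat_potential l \<alpha> b y p * f y)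
            = (LINT y|lborel. (b x * of_real (t powr (\<alpha> / 2 - 1))) * (of_real (heat_remainder l t x y) * f y))"
          using True by (simp add: heat_potential_def p mult_ac)
        also have "\<dots> = k x t"
          using True by (simp only: integral_mult_right_zero integral_heat_remainder_vanishing[OF f l True]) (simp add: k_def)
        finally show ?thesis by (simp add: p)
      next
        case False
        then show ?thesis by (simp add: heat_potential_def k_def p)
      qed
    qed
    have kint: "integrable (lborel \<Otimes>\<^sub>M lborel) (\<lambda>(x, t). k x t)"
      using lborel_pair.integrable_snd[OF intf] by (simp add: k lborel_prod)
    have kx: "(LINT t|lborel. k x t) = of_real (Gamma (\<alpha> / 2)) * (b x * riesz_potential \<alpha> f x)" for x
    proof -
      have "(LINT t|lborel. k x t) = b x * (of_real (Gamma (\<alpha> / 2)) * riesz_potential \<alpha> f x)"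
        using riesz_potential_heat_kernel[OF f l, of \<alpha> x] \<alpha> \<epsilon> unfolding k_def mult.assoc
        by (simp only: integral_mult_right_zero)
      then show ?thesis by simp
    qed
    have "has_bochner_integral lborel (\<lambda>x. of_real (Gamma (\<alpha> / 2)) * (b x * riesz_potential \<alpha> f x)) (LINT p|lborel. (case p of (x, t) \<Rightarrow> k x t))"
      using lborel_pair.integrable_fst'[OF kint] lborel_pair.integral_fst'[OF kint]
      by (simp add: has_bochner_integral_iff kx lborel_prod)
    then have "has_bochner_integral lborel (\<lambda>x. (of_real (Gamma (\<alpha> / 2)) * (b x * riesz_potential \<alpha> f x)) / of_real (Gamma (\<alpha> / 2)))
        ((LINT p|lborel. (case p of (x, t) \<Rightarrow> k x t)) / of_real (Gamma (\<alpha> / 2)))"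
      by (rule has_bochner_integral_divide_zero)
    moreover have "(LINT p|lborel. (case p of (x, t) \<Rightarrow> k x t)) / of_real (Gamma (\<alpha> / 2)) = (LINT y|lborel. F y * f y)"
    proof -
      have "(LINT p|lborel. (case p of (x, t) \<Rightarrow> k x t)) = (LINT p|lborel. LINT y|lborel. heat_potential l \<alpha> b y p * f y)"
        by (simp only: k)
      also have "\<dots> = (LINT y|lborel. LINT p|lborel. heat_potential l \<alpha> b y p * f y)"
        using lborel_pair.Fubini_integral[OF intf] .
      finally show ?thesis by (simp add: F_def)
    qed
    ultimately show ?thesis using G by simp
  qed
  with Fm Fint show ?thesis by blast
qed

lemma complex_borel_version:
  fixes b :: "'a::euclidean_space \<Rightarrow> complex"
  assumes "b \<in> borel_measurable lebesgue"
  obtains b' where "b' \<in> borel_measurable borel" "AE x in lebesgue. b x = b' x"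
proof -
  have "(\<lambda>x. Re (b x)) \<in> borel_measurable (completion lborel)" "(\<lambda>x. Im (b x)) \<in> borel_measurable (completion lborel)"
    using assms by measurable
  then obtain u v where uv [measurable]: "u \<in> borel_measurable lborel" "v \<in> borel_measurable lborel"
    and ae: "AE x in lborel. Re (b x) = u x" "AE x in lborel. Im (b x) = v x"
    using completion_ex_borel_measurable_real by metis
  have "AE x in lborel. b x = Complex (u x) (v x)"
    using ae by eventually_elim (simp add: complex_eq_iff)
  then have "AE x in lebesgue. b x = Complex (u x) (v x)" by (rule AE_completion)
  moreover have "(\<lambda>x. Complex (u x) (v x)) \<in> borel_measurable borel"
    using uv by (simp add: borel_measurable_complex_iff)
  ultimately show thesis using that by blast
qed

text \<open>
  Passing to a Borel version of \<open>b\<close> reduces the claim to Lebesgue measure on the Borel sets, where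
  Fubini's theorem for product measures applies.
\<close>

lemma riesz_bmo_function:
  fixes b :: "'a::euclidean_space \<Rightarrow> complex"
  assumes b: "b \<in> bmo" and l: "l \<le> 1" and \<alpha>: "0 < \<alpha>" "\<alpha> < real l + 1"
  shows "\<exists>F. locally_integrable F \<and> defines_tempered F \<and>
    (\<forall>f \<in> schwartz_vanishing l. has_bochner_integral lebesgue (\<lambda>x. b x * riesz_potential \<alpha> f x) (distribution_of F f))"
proof -
  have loc: "locally_integrable b" using b by (simp add: bmo_def)
  have bm [measurable]: "b \<in> borel_measurable lebesgue" by (rule locally_integrable_borel_measurable[OF loc])
  obtain b' where b' [measurable]: "b' \<in> borel_measurable borel" and ae: "AE x in lebesgue. b x = b' x"
    using complex_borel_version[OF bm] by blast
  define \<epsilon> where "\<epsilon> = min 1 ((real l + 1 - \<alpha>) / 2)"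
  have \<epsilon>: "0 < \<epsilon>" "\<epsilon> \<le> 1" "\<alpha> + \<epsilon> < real l + 1" using \<alpha> by (auto simp: \<epsilon>_def min_def field_simps)
  obtain C where C: "0 \<le> C" "\<And>R. 1 \<le> R \<Longrightarrow> (\<integral>\<^sup>+x\<in>ball 0 R. norm (b x) \<partial>lebesgue) \<le> ennreal (C * R powr (DIM('a) + \<epsilon>))"
    using bmo_growth[OF b \<epsilon>(1)] by blast
  have growth: "(\<integral>\<^sup>+x\<in>ball 0 r. norm (b' x) \<partial>lborel) \<le> ennreal (C * r powr (DIM('a) + \<epsilon>))" if "1 \<le> r" for r
  proof -
    have "(\<integral>\<^sup>+x\<in>ball 0 r. norm (b' x) \<partial>lborel) = (\<integral>\<^sup>+x\<in>ball 0 r. norm (b' x) \<partial>lebesgue)"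
      by (rule nn_integral_completion[symmetric])
    also have "\<dots> = (\<integral>\<^sup>+x\<in>ball 0 r. norm (b x) \<partial>lebesgue)"
      using ae by (intro nn_integral_cong_AE) (auto elim!: eventually_mono)
    finally show ?thesis using C(2)[OF that] by simp
  qed
  obtain F N where Fm: "F \<in> borel_measurable borel" and Fint: "integrable lborel (\<lambda>y. F y * of_real (decay N y))"
    and F: "\<And>f. f \<in> schwartz_vanishing l \<Longrightarrow> has_bochner_integral lborel (\<lambda>x. b' x * riesz_potential \<alpha> f x) (LINT y|lborel. F y * f y)"
    using riesz_potential_dual_function[OF l b' C(1) \<epsilon>(1,2) growth \<alpha>(1) \<epsilon>(3)] by blast
  have "has_bochner_integral lebesgue (\<lambda>x. b x * riesz_potential \<alpha> f x) (distribution_of F f)"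
    if f: "f \<in> schwartz_vanishing l" for f
  proof -
    have [measurable]: "f \<in> borel_measurable borel"
      by (rule schwartz_borel_measurable[OF schwartz_vanishing_schwartz[OF f]])
    note [measurable] = Fm
    have rm [measurable]: "riesz_potential \<alpha> f \<in> borel_measurable borel"
      unfolding riesz_potential_def inverse_fourier_def
      by (subst integral_completion) measurable
    have "distribution_of F f = (LINT y|lborel. F y * f y)"
      unfolding distribution_of_def by (intro integral_completion) measurable
    with F[OF f] have "has_bochner_integral lebesgue (\<lambda>x. b' x * riesz_potential \<alpha> f x) (distribution_of F f)"
      by (simp add: has_bochner_integral_iff integrable_completion integral_completion)
    moreover have "AE x in lebesgue. b x * riesz_potential \<alpha> f x = b' x * riesz_potential \<alpha> f x"
      using ae by eventually_elim simp
    moreover have "riesz_potential \<alpha> f \<in> borel_measurable lebesgue" "b' \<in> borel_measurable lebesgue"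
      by (auto intro: measurable_completion)
    ultimately show ?thesis
      using bm by (subst has_bochner_integral_cong_AE[where g = "\<lambda>x. b' x * riesz_potential \<alpha> f x"]) auto
  qed
  then show ?thesis
    using locally_integrable_if_integrable[OF Fm Fint] defines_tempered_if_integrable[OF Fm Fint] by blast
qed

lemma riesz_bmo_eq_class:
  fixes b :: "'a::euclidean_space \<Rightarrow> complex"
  assumes F: "defines_tempered F" and l: "nat \<lfloor>\<alpha>\<rfloor> = l"
    and rep: "\<And>f. f \<in> schwartz_vanishing l \<Longrightarrow> has_bochner_integral lebesgue (\<lambda>x. b x * riesz_potential \<alpha> f x) (distribution_of F f)"
  shows "riesz_bmo \<alpha> b = poly_rel l `` {distribution_of F}"
proof -
  have Ft: "distribution_of F \<in> tempered" using F by (simp add: defines_tempered_def)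
  have "u \<in> riesz_bmo \<alpha> b \<longleftrightarrow> (distribution_of F, u) \<in> poly_rel l" if u: "u \<in> tempered" for u
  proof -
    have "u \<in> riesz_bmo \<alpha> b \<longleftrightarrow> (\<forall>f \<in> schwartz_vanishing l. has_bochner_integral lebesgue (\<lambda>x. b x * riesz_potential \<alpha> f x) (u f))"
      using u by (simp add: riesz_bmo_def l)
    also have "\<dots> \<longleftrightarrow> (\<forall>f \<in> schwartz_vanishing l. distribution_of F f = u f)"
      using rep has_bochner_integral_eq by metis
    also have "\<dots> \<longleftrightarrow> (distribution_of F, u) \<in> poly_rel l"
      by (rule poly_rel_iff[OF Ft u, symmetric])
    finally show ?thesis .
  qed
  moreover have "u \<in> tempered" if "u \<in> riesz_bmo \<alpha> b \<or> (distribution_of F, u) \<in> poly_rel l" for u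
    using that by (auto simp: riesz_bmo_def poly_rel_def)
  ultimately show ?thesis by blast
qed

lemma I_BMO_functions:
  assumes l: "l \<le> 1" "nat \<lfloor>\<alpha>\<rfloor> = l" and \<alpha>: "0 < \<alpha>" "\<alpha> < real l + 1"
    and f: "f \<in> (I_BMO \<alpha> :: (('a::euclidean_space \<Rightarrow> complex) \<Rightarrow> complex) set set)"
  shows "f \<in> tempered_mod l" "is_function_mod l f"
proof -
  obtain b :: "'a \<Rightarrow> complex" where b: "b \<in> bmo" "f = riesz_bmo \<alpha> b" using f by (auto simp: I_BMO_def)
  obtain F where F: "locally_integrable F" "defines_tempered F"
    "\<And>g. g \<in> schwartz_vanishing l \<Longrightarrow> has_bochner_integral lebesgue (\<lambda>x. b x * riesz_potential \<alpha> g x) (distribution_of F g)"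
    using riesz_bmo_function[OF b(1) l(1) \<alpha>] by blast
  have eq: "f = poly_rel l `` {distribution_of F}"
    unfolding b(2) by (rule riesz_bmo_eq_class[OF F(2) l(2) F(3)])
  show "f \<in> tempered_mod l"
    unfolding tempered_mod_def eq using F(2) by (intro quotientI) (simp add: defines_tempered_def)
  show "is_function_mod l f"
    unfolding is_function_mod_def using F(1,2) eq by blast
qed

theorem proposition2p7:
  fixes \<alpha> :: real
  shows "(0 < \<alpha> \<and> \<alpha> < 1 \<longrightarrow>
            (I_BMO \<alpha> :: (('a::euclidean_space \<Rightarrow> complex) \<Rightarrow> complex) set set) \<subseteq> tempered_mod 0 \<and>
            (\<forall>f \<in> (I_BMO \<alpha> :: (('a \<Rightarrow> complex) \<Rightarrow> complex) set set). is_function_mod 0 f)) \<and>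
         (1 \<le> \<alpha> \<and> \<alpha> < 2 \<longrightarrow>
            (I_BMO \<alpha> :: (('a \<Rightarrow> complex) \<Rightarrow> complex) set set) \<subseteq> tempered_mod 1 \<and>
            (\<forall>f \<in> (I_BMO \<alpha> :: (('a \<Rightarrow> complex) \<Rightarrow> complex) set set). is_function_mod 1 f))"
proof (intro conjI impI subsetI ballI)
  fix f :: "(('a \<Rightarrow> complex) \<Rightarrow> complex) set" assume f: "f \<in> I_BMO \<alpha>"
  {
    assume a: "0 < \<alpha> \<and> \<alpha> < 1"
    then have "nat \<lfloor>\<alpha>\<rfloor> = 0" by linarith
    with a f show "f \<in> tempered_mod 0" "is_function_mod 0 f"
      using I_BMO_functions[of 0 \<alpha> f] by simp_all
  next
    assume a: "1 \<le> \<alpha> \<and> \<alpha> < 2"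
    then have "nat \<lfloor>\<alpha>\<rfloor> = 1" by linarith
    with a f show "f \<in> tempered_mod 1" "is_function_mod 1 f"
      using I_BMO_functions[of 1 \<alpha> f] by simp_all
  }
qed

end
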